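(* Given a compact hypersurface $Z\subset\mathbb{R}^n$ of class $C^1$ with $\rho(Z)>0$, there exists a $C^1$ function $f:\mathbb{R}^n\to\mathbb{R}$ whose zero set is $Z$ and such that for every disk $D$ containing $Z$ such that $\mathrm{dist}(Z,\partial D)>\rho(Z)$, we have $$\kappa^{(1)}(f,D)\leq 2\left(1+\frac{1}{\rho(Z)}\right).$$ If moreover $Z$ is of class $C^2$, then the function $f$ can be chosen of class $C^2$ and satisfying (for every such disk $D$) $$\kappa^{(2)}(f,D)\leq 2\left(1+\frac{1}{\rho(Z)}+\frac{5n}{\rho(Z)^2}\right).$$
   Context: The reach of a $C^1$ hypersurface $Z\subset\mathbb{R}^n$ is $$\rho(Z)=\sup\left\{t>0:\ \text{for all } x\in\mathbb{R}^n,\ \mathrm{dist}(x,Z)<t\implies\exists!\,z\in Z \text{ with } \mathrm{dist}(x,Z)=\mathrm{dist}(x,z)\right\}.$$ A disk $D\subset\mathbb{R}^n$ is a closed Euclidean ball of positive radius. For $f$ of class $C^\ell$, $\ell\ge1$, $$\|f\|_{C^\ell(D,\mathbb{R})}=\sup_{z\in D}\left(\sum_{|\alpha|\le\ell}|\partial^\alpha f(z)|^2\right)^{1/2},$$ $$\delta(f,D)=\min\left\{\inf_{z\in D}\left(|f(z)|^2+|\nabla f(z)|^2\right)^{1/2},\ \inf_{z\in\partial D}\left(|f(z)|^2+|\nabla(f|_{\partial D})(z)|^2\right)^{1/2}\right\},$$ $$\kappa^{(\ell)}(f,D)=\frac{\|f\|_{C^\ell(D,\mathbb{R})}}{\delta(f,D)}.$$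 *)

theory Defs
  imports "HOL-Analysis.Analysis"
begin

definition partial_deriv :: "'n \<Rightarrow> (real^'n \<Rightarrow> real) \<Rightarrow> real^'n \<Rightarrow> real" where
  "partial_deriv i f x = deriv (\<lambda>t. f (x + t *\<^sub>R axis i 1)) 0"

definition grad :: "(real^'n \<Rightarrow> real) \<Rightarrow> real^'n \<Rightarrow> real^'n" where
  "grad f x = (\<chi> i. partial_deriv i f x)"

text \<open>Only meaningful for open \<open>U\<close>: the derivatives are unrestricted ones.\<close>

fun Ck_on :: "nat \<Rightarrow> (real^'n) set \<Rightarrow> (real^'n \<Rightarrow> real) \<Rightarrow> bool" where
  "Ck_on 0 U f \<longleftrightarrow> continuous_on U f"
| "Ck_on (Suc k) U f \<longleftrightarrow>
     (\<forall>x\<in>U. f differentiable (at x)) \<and> (\<forall>i. Ck_on k U (partial_deriv i f))"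

text \<open>
  A multi-index is a function \<open>\<alpha> :: 'n \<Rightarrow> nat\<close>. The coordinates carry no order, so the partial
  derivatives are taken in an arbitrary order; by symmetry of higher derivatives the choice is
  irrelevant for \<open>f\<close> of class C^k with \<open>\<bar>\<alpha>\<bar> \<le> k\<close>.
\<close>

definition multi_deriv :: "('n \<Rightarrow> nat) \<Rightarrow> (real^'n \<Rightarrow> real) \<Rightarrow> real^'n \<Rightarrow> real" where
  "multi_deriv \<alpha> f = foldr partial_deriv (SOME js. \<forall>i. count_list js i = \<alpha> i) f"

text \<open>Embedded, without boundary; for \<open>k \<ge> 1\<close>. Neither connected nor orientable by assumption.\<close>

definition hypersurface :: "nat \<Rightarrow> (real^'n) set \<Rightarrow> bool" where
  "hypersurface k Z \<longleftrightarrow>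
     (\<forall>z\<in>Z. \<exists>U g. open U \<and> z \<in> U \<and> Ck_on k U g \<and> Z \<inter> U = {x \<in> U. g x = 0} \<and>
                  (\<forall>x\<in>U. grad g x \<noteq> 0))"

text \<open>
  Distances, the reach and the condition number take values in \<open>[0,\<infinity>]\<close>. This makes the distance to
  the empty set infinite (whereas \<open>infdist x {} = 0\<close>), allows an infinite reach, and gives
  \<open>a / 0 = \<infinity>\<close> for \<open>a \<noteq> 0\<close> and \<open>1 / \<infinity> = 0\<close>.
\<close>

definition dist_to :: "real^'n \<Rightarrow> (real^'n) set \<Rightarrow> ennreal" where
  "dist_to x Z = (INF z\<in>Z. ennreal (dist x z))"

definition dist_sets :: "(real^'n) set \<Rightarrow> (real^'n) set \<Rightarrow> ennreal" where
  "dist_sets Y Z = (INF y\<in>Y. dist_to y Z)"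

definition reach :: "(real^'n) set \<Rightarrow> ennreal" where
  "reach Z = Sup {ennreal t | t. t > 0 \<and>
     (\<forall>x. dist_to x Z < ennreal t \<longrightarrow> (\<exists>!z. z \<in> Z \<and> dist_to x Z = ennreal (dist x z)))}"

definition Ck_norm :: "nat \<Rightarrow> (real^'n \<Rightarrow> real) \<Rightarrow> real^'n \<Rightarrow> real \<Rightarrow> ennreal" where
  "Ck_norm k f c r =
     (SUP z\<in>cball c r. ennreal (sqrt (\<Sum>\<alpha> | (\<Sum>i\<in>UNIV. \<alpha> i) \<le> k. (multi_deriv \<alpha> f z)\<^sup>2)))"

text \<open>
  The gradient at \<open>z\<close> of the restriction of \<open>f\<close> to \<open>sphere c r\<close>: the vector of the tangent space
  \<open>{v. v \<bullet> (z - c) = 0}\<close> that represents the derivative of the restriction.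
\<close>

definition sphere_grad :: "(real^'n \<Rightarrow> real) \<Rightarrow> real^'n \<Rightarrow> real \<Rightarrow> real^'n \<Rightarrow> real^'n" where
  "sphere_grad f c r z =
     (THE v. v \<bullet> (z - c) = 0 \<and> (f has_derivative (\<lambda>h. v \<bullet> h)) (at z within sphere c r))"

definition discr_dist :: "(real^'n \<Rightarrow> real) \<Rightarrow> real^'n \<Rightarrow> real \<Rightarrow> ennreal" where
  "discr_dist f c r = min
     (INF z\<in>cball c r. ennreal (sqrt ((f z)\<^sup>2 + (norm (grad f z))\<^sup>2)))
     (INF z\<in>sphere c r. ennreal (sqrt ((f z)\<^sup>2 + (norm (sphere_grad f c r z))\<^sup>2)))"

definition cond_num :: "nat \<Rightarrow> (real^'n \<Rightarrow> real) \<Rightarrow> real^'n \<Rightarrow> real \<Rightarrow> ennreal" where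
  "cond_num k f c r = Ck_norm k f c r / discr_dist f c r"

lemma finite_multi_indices: "finite {\<alpha> :: 'n::finite \<Rightarrow> nat. (\<Sum>i\<in>UNIV. \<alpha> i) \<le> k}"
proof (rule finite_subset)
  have "\<alpha> i \<le> k" if "(\<Sum>i\<in>UNIV. \<alpha> i) \<le> k" for \<alpha> :: "'n \<Rightarrow> nat" and i
    using member_le_sum[of i UNIV \<alpha>] that by auto
  then show "{\<alpha> :: 'n \<Rightarrow> nat. (\<Sum>i\<in>UNIV. \<alpha> i) \<le> k} \<subseteq> PiE UNIV (\<lambda>_. {..k})"
    by auto
  show "finite (PiE UNIV (\<lambda>_. {..k}) :: ('n \<Rightarrow> nat) set)"
    by (rule finite_PiE) auto
qed

lemma exists_list_of_multi_index:
  fixes \<alpha> :: "'n::finite \<Rightarrow> nat"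
  shows "\<exists>js. \<forall>i. count_list js i = \<alpha> i"
proof -
  obtain js where js: "mset js = Abs_multiset \<alpha>"
    using ex_mset by blast
  have "count (mset js) i = \<alpha> i" for i
    unfolding js by (subst Abs_multiset_inverse) auto
  then show ?thesis
    by (metis count_mset)
qed

lemma partial_deriv_eq:
  assumes "(f has_derivative f') (at x)"
  shows "partial_deriv i f x = f' (axis i 1)"
proof -
  have "((\<lambda>t. f (x + t *\<^sub>R axis i 1)) has_derivative (\<lambda>t. f' (t *\<^sub>R axis i 1))) (at 0)"
    by (rule has_derivative_compose[where g = f]) (auto intro!: derivative_eq_intros simp: assms)
  moreover have "(\<lambda>t. f' (t *\<^sub>R axis i 1)) = (*) (f' (axis i 1))"
    by (simp add: linear_cmul[OF has_derivative_linear[OF assms]] fun_eq_iff)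
  ultimately have "((\<lambda>t. f (x + t *\<^sub>R axis i 1)) has_field_derivative f' (axis i 1)) (at 0)"
    by (simp add: has_field_derivative_def)
  then show ?thesis
    unfolding partial_deriv_def by (rule DERIV_imp_deriv)
qed

lemma has_derivative_grad:
  assumes "f differentiable (at x)"
  shows "(f has_derivative (\<lambda>h. grad f x \<bullet> h)) (at x)"
proof -
  obtain f' where f': "(f has_derivative f') (at x)"
    using assms by (auto simp: differentiable_def)
  have lin: "linear f'"
    using f' by (rule has_derivative_linear)
  have "f' h = grad f x \<bullet> h" for h
  proof -
    have "f' h = f' (\<Sum>i\<in>UNIV. h $ i *\<^sub>R axis i 1)"
      using basis_expansion[of h] by (simp add: scalar_mult_eq_scaleR)
    also have "\<dots> = (\<Sum>i\<in>UNIV. h $ i *\<^sub>R f' (axis i 1))"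
      by (simp add: linear_sum[OF lin] linear_cmul[OF lin])
    also have "\<dots> = grad f x \<bullet> h"
      by (simp add: grad_def inner_vec_def partial_deriv_eq[OF f'] mult.commute)
    finally show ?thesis .
  qed
  then have "f' = (\<lambda>h. grad f x \<bullet> h)" by auto
  then show ?thesis using f' by simp
qed

lemma dist_to_eq_infdist: "Z \<noteq> {} \<Longrightarrow> dist_to x Z = ennreal (infdist x Z)"
proof (rule antisym)
  assume Z: "Z \<noteq> {}"
  show "ennreal (infdist x Z) \<le> dist_to x Z"
    unfolding dist_to_def by (intro INF_greatest ennreal_leI infdist_le)
  show "dist_to x Z \<le> ennreal (infdist x Z)"
  proof (rule ennreal_le_epsilon)
    fix e :: real assume "e > 0"
    then obtain z where "z \<in> Z" "dist x z < infdist x Z + e"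
      using cInf_lessD[of "dist x ` Z" "infdist x Z + e"] Z by (auto simp: infdist_def)
    then have "dist_to x Z \<le> ennreal (infdist x Z + e)"
      unfolding dist_to_def by (meson INF_lower2 ennreal_leI less_imp_le)
    then show "dist_to x Z \<le> ennreal (infdist x Z) + ennreal e"
      using \<open>e > 0\<close> by (simp add: ennreal_plus infdist_nonneg)
  qed
qed

text \<open>The gradient of the restriction is the tangential part of the gradient.\<close>

lemma sphere_grad_unique:
  fixes c z :: "real^'n"
  assumes z: "z \<in> sphere c r" and r: "r > 0"
    and v: "v \<bullet> (z - c) = 0" "(f has_derivative (\<lambda>h. v \<bullet> h)) (at z within sphere c r)"
    and w: "w \<bullet> (z - c) = 0" "(f has_derivative (\<lambda>h. w \<bullet> h)) (at z within sphere c r)"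
  shows "v = w"
proof (rule ccontr)
  assume "v \<noteq> w"
  define u where "u = v - w"
  have u: "u \<noteq> 0" "u \<bullet> (z - c) = 0"
    using \<open>v \<noteq> w\<close> v(1) w(1) by (auto simp: u_def inner_diff_left)
  define k where "k = r / norm u"
  have k: "k > 0" using r u by (simp add: k_def)
  define \<gamma> where "\<gamma> t = c + cos t *\<^sub>R (z - c) + (k * sin t) *\<^sub>R u" for t :: real
  have zc: "(z - c) \<bullet> (z - c) = r\<^sup>2"
    using z by (simp add: dist_norm norm_minus_commute flip: power2_norm_eq_inner)
  have ku: "k\<^sup>2 * (u \<bullet> u) = r\<^sup>2"
    using u by (simp add: k_def power_divide flip: power2_norm_eq_inner)
  have "\<gamma> t \<in> sphere c r" for t
  proof -
    let ?p = "cos t *\<^sub>R (z - c) + (k * sin t) *\<^sub>R u"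
    have uz: "(z - c) \<bullet> u = 0" using u(2) by (simp add: inner_commute)
    have "?p \<bullet> ?p = (cos t)\<^sup>2 * ((z - c) \<bullet> (z - c)) + (sin t)\<^sup>2 * (k\<^sup>2 * (u \<bullet> u))"
      using u(2) uz
      by (simp only: inner_add_left inner_add_right inner_scaleR_left inner_scaleR_right)
         (simp add: power2_eq_square algebra_simps)
    also have "\<dots> = ((cos t)\<^sup>2 + (sin t)\<^sup>2) * r\<^sup>2"
      by (simp only: zc ku distrib_right)
    finally have "(norm ?p)\<^sup>2 = r\<^sup>2"
      by (simp add: power2_norm_eq_inner)
    then have "norm ?p = r"
      using r by (simp add: power2_eq_iff_nonneg)
    moreover have "dist c (\<gamma> t) = norm ?p"
      unfolding \<gamma>_def dist_norm by (subst norm_minus_commute) (simp add: algebra_simps)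
    ultimately show ?thesis by simp
  qed
  then have img: "\<gamma> ` UNIV \<subseteq> sphere c r" by auto
  have d\<gamma>: "(\<gamma> has_derivative (\<lambda>t. t *\<^sub>R (k *\<^sub>R u))) (at 0)"
    unfolding \<gamma>_def by (auto intro!: derivative_eq_intros)
  have "((\<lambda>y. f y - f y) has_derivative (\<lambda>h. v \<bullet> h - w \<bullet> h)) (at z within sphere c r)"
    by (rule has_derivative_diff[OF v(2) w(2)])
  then have d0: "((\<lambda>y. 0 :: real) has_derivative (\<lambda>h. u \<bullet> h)) (at z within sphere c r)"
    by (simp add: u_def inner_diff_left)
  have "\<gamma> 0 = z" by (simp add: \<gamma>_def)
  then have "((\<lambda>y. 0 :: real) has_derivative (\<lambda>h. u \<bullet> h)) (at (\<gamma> 0) within \<gamma> ` UNIV)"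
    using has_derivative_subset[OF d0 img] by simp
  from has_derivative_in_compose[OF d\<gamma> this]
  have "((\<lambda>t. 0 :: real) has_derivative (\<lambda>t. u \<bullet> (t *\<^sub>R (k *\<^sub>R u)))) (at (0::real))" .
  then have "(\<lambda>t::real. u \<bullet> (t *\<^sub>R (k *\<^sub>R u))) = (\<lambda>t. 0)"
    using has_derivative_unique has_derivative_const by blast
  then have "u \<bullet> (1 *\<^sub>R (k *\<^sub>R u)) = 0" by metis
  then show False using u k by simp
qed

lemma sphere_grad_eq:
  fixes c z :: "real^'n"
  assumes z: "z \<in> sphere c r" and r: "r > 0" and f: "f differentiable (at z)"
  shows "sphere_grad f c r z = grad f z - ((grad f z \<bullet> (z - c)) / r\<^sup>2) *\<^sub>R (z - c)"
proof -
  define k where "k = (grad f z \<bullet> (z - c)) / r\<^sup>2"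
  let ?v = "grad f z - k *\<^sub>R (z - c)"
  have zc: "(z - c) \<bullet> (z - c) = r\<^sup>2"
    using z by (simp add: dist_norm norm_minus_commute flip: power2_norm_eq_inner)
  have tang: "?v \<bullet> (z - c) = 0"
    using r by (simp only: inner_diff_left[of "grad f z"] inner_scaleR_left zc) (simp add: k_def)
  let ?q = "\<lambda>y. f y - (k / 2) * ((y - c) \<bullet> (y - c) - r\<^sup>2)"
  have "(?q has_derivative (\<lambda>h. grad f z \<bullet> h - (k / 2) * ((z - c) \<bullet> h + h \<bullet> (z - c))))
          (at z within sphere c r)"
    by (auto intro!: derivative_eq_intros has_derivative_at_withinI[OF has_derivative_grad[OF f]])
  moreover have "(\<lambda>h. grad f z \<bullet> h - (k / 2) * ((z - c) \<bullet> h + h \<bullet> (z - c))) = (\<lambda>h. ?v \<bullet> h)"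
    by (rule ext)
       (simp only: inner_diff_left[of "grad f z"] inner_scaleR_left inner_commute[of _ "z - c"], simp)
  ultimately have dq: "(?q has_derivative (\<lambda>h. ?v \<bullet> h)) (at z within sphere c r)"
    by simp
  have "(f has_derivative (\<lambda>h. ?v \<bullet> h)) (at z within sphere c r)"
  proof (rule has_derivative_transform[OF z _ dq])
    fix y assume "y \<in> sphere c r"
    then have "(y - c) \<bullet> (y - c) = r\<^sup>2"
      by (simp add: dist_norm norm_minus_commute flip: power2_norm_eq_inner)
    then show "f y = ?q y" by simp
  qed
  then have "sphere_grad f c r z = ?v"
    unfolding sphere_grad_def
    by (intro the_equality conjI tang) (use sphere_grad_unique[OF z r] tang in auto)
  then show ?thesis by (simp add: k_def)
qed

end

theory Submission
  imports Defs
begin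

text \<open>The function is \<open>f = \<phi> \<circ> s\<close>, where \<open>s\<close> is a signed distance to \<open>Z\<close> and \<open>\<phi>\<close> is an odd profile that is constant
  outside \<open>[-r, r]\<close> for some \<open>r\<close> slightly smaller than the reach \<open>\<rho>\<close>. The pair of signed distance and unit
  normal is locally defined up to a common sign and constant far away from \<open>Z\<close>, so contractibility of
  \<open>\<real>\<^sup>n\<close> provides a global sign, without any orientability assumption. The function \<open>s\<close> is 1-Lipschitz and
  differentiable with unit gradient \<open>N\<close> where \<open>\<bar>s\<bar> < \<rho>\<close>. Hence it grows at unit speed along \<open>N\<close>, and the distance
  functions from the points \<open>x \<plusminus> e N x\<close> with \<open>e < \<rho> - \<bar>s x\<bar>\<close> squeeze \<open>s\<close> between two paraboloids. This bounds the
  Lipschitz constant of \<open>N\<close> at \<open>x\<close> by \<open>1 / (\<rho> - \<bar>s x\<bar>)\<close>, which controls the Hessian of \<open>f\<close> in the \<open>C\<^sup>2\<close> case.\<close>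

section \<open>Lifting signs\<close>

text \<open>The factor 2 is the quotient of 3/2 and 3/4: the profile gets slope
  \<open>3/2 / min \<rho> 2\<close> at 0, steep enough for the value and gradient of
  \<open>f\<close> together never to drop below 3/4, flat enough for the derivatives to stay below
  3/2 times the bracket. The cap at 2 keeps the slope at least 3/4 however large the reach is. On
  the boundary sphere \<open>\<bar>f\<bar> = 1\<close>, so the tangential gradient never has to be
  estimated. The obstacle in the C^2 case is a circle: off \<open>Z\<close> the normal field is the
  one on \<open>Z\<close> composed with the foot map \<open>x - s x *\<^sub>R N x\<close>, whose
  differentiability seems to presuppose that of \<open>N\<close>. The circle breaks on
  \<open>Z\<close> itself. There the factor \<open>s\<close> vanishes, so the foot map is
  differentiable although \<open>N\<close> is merely known to be continuous, and \<open>N\<close>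
  inherits a derivative from a local C^1 normal. This derivative is carried off \<open>Z\<close> by
  inverting \<open>y + t *\<^sub>R N y\<close> with \<open>t\<close> frozen; that the derivative of
  this map is invertible follows from the Lipschitz bound on \<open>N\<close>, in place of curvature
  estimates for \<open>Z\<close>.\<close>

text \<open>A continuous choice of sign is transported along the contraction \<open>x \<mapsto> (k / n) x\<close>, whose steps are
  below a Lebesgue number of the cover by sets on which the sign is determined by the inner product.\<close>

lemma sign_lift:
  fixes u0 :: "'a::euclidean_space \<Rightarrow> 'b::real_inner"
  assumes nz: "\<And>x. u0 x \<noteq> 0"
    and loc: "\<And>x. \<exists>W v. open W \<and> x \<in> W \<and> continuous_on W v \<and> (\<forall>y\<in>W. v y = u0 y \<or> v y = - u0 y)"
    and out: "\<And>x. norm x \<ge> R \<Longrightarrow> u0 x = e" and R: "R > 0"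
  shows "\<exists>u. continuous_on UNIV u \<and> (\<forall>x. u x = u0 x \<or> u x = - u0 x)"
proof -
  define K where "K = cball (0::'a) R"
  have K: "compact K" "K \<noteq> {}"
    using R by (auto simp: K_def)
  have nbhd: "\<exists>B. open B \<and> x \<in> B \<and> (\<forall>y\<in>B. \<forall>y'\<in>B. u0 y \<bullet> u0 y' \<noteq> 0)" for x
  proof -
    obtain W v where W: "open W" "x \<in> W" "continuous_on W v"
      and v: "\<And>y. y \<in> W \<Longrightarrow> v y = u0 y \<or> v y = - u0 y"
      using loc[of x] by blast
    have vx: "v x \<noteq> 0" using v[OF W(2)] nz[of x] by auto
    \<comment> \<open>On this ball the inner product of two values of \<open>v\<close> is at least
      (1 - 1/3 - 1/3 - 1/9) times the squared norm of \<open>v x\<close>. That it is nonzero is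
      insensitive to signs and so passes from \<open>v\<close> to \<open>u0\<close>.\<close>
    define B where "B = W \<inter> v -` ball (v x) (norm (v x) / 3)"
    have "open B" unfolding B_def
      using W continuous_on_open_vimage[of W v] by (metis Int_commute open_ball)
    moreover have "x \<in> B" using W vx by (simp add: B_def)
    moreover have "u0 y \<bullet> u0 y' \<noteq> 0" if "y \<in> B" "y' \<in> B" for y y'
    proof -
      define a where "a = norm (v x)"
      have a: "a > 0" using vx by (simp add: a_def)
      have 1: "norm (v y - v x) < a / 3" "norm (v y' - v x) < a / 3"
        using that by (auto simp: B_def a_def dist_norm norm_minus_commute)
      have "v y \<bullet> v y' = v x \<bullet> v x + v x \<bullet> (v y' - v x) + (v y - v x) \<bullet> v x + (v y - v x) \<bullet> (v y' - v x)"
        by (simp add: inner_diff_left inner_diff_right)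
      moreover have "\<bar>v x \<bullet> (v y' - v x)\<bar> \<le> a * (a/3)"
        using Cauchy_Schwarz_ineq2[of "v x" "v y' - v x"] mult_left_mono[of _ "a/3" a] 1 a
        unfolding a_def by (meson less_eq_real_def norm_ge_zero order_trans)
      moreover have "\<bar>(v y - v x) \<bullet> v x\<bar> \<le> (a/3) * a"
        using Cauchy_Schwarz_ineq2[of "v y - v x" "v x"] mult_right_mono[of _ "a/3" a] 1 a
        unfolding a_def by (meson less_eq_real_def norm_ge_zero order_trans)
      moreover have "\<bar>(v y - v x) \<bullet> (v y' - v x)\<bar> \<le> (a/3) * (a/3)"
        using Cauchy_Schwarz_ineq2[of "v y - v x" "v y' - v x"] mult_mono[of "norm (v y - v x)" "a/3" "norm (v y' - v x)" "a/3"] 1 a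
        by (meson less_eq_real_def norm_ge_zero order_trans divide_nonneg_nonneg zero_le_numeral)
      moreover have "v x \<bullet> v x = a * a" by (simp add: a_def dot_square_norm power2_eq_square)
      moreover have "a * a > 0" using a by simp
      ultimately have "v y \<bullet> v y' > 0" by (simp add: abs_le_iff)
      then show ?thesis using v[of y] v[of y'] that by (auto simp: B_def)
    qed
    ultimately show ?thesis by blast
  qed
  define \<C> where "\<C> = {B. open B \<and> (\<forall>y\<in>B. \<forall>y'\<in>B. u0 y \<bullet> u0 y' \<noteq> 0)}"
  have "K \<subseteq> \<Union>\<C>" using nbhd unfolding \<C>_def by blast
  then obtain \<delta> where \<delta>: "\<delta> > 0" and leb: "\<And>T. T \<subseteq> K \<Longrightarrow> diameter T < \<delta> \<Longrightarrow> \<exists>B\<in>\<C>. T \<subseteq> B"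
    using Lebesgue_number_lemma[OF K(1), of \<C>] K(2) unfolding \<C>_def
    by (metis (no_types, lifting) ex_in_conv mem_Collect_eq Union_empty subset_empty)
  have close: "u0 x \<bullet> u0 y \<noteq> 0" if xy: "x \<in> K" "y \<in> K" "dist x y < \<delta>" for x y
  proof -
    have "diameter {x, y} \<le> dist x y"
      by (rule diameter_le) (auto simp: dist_norm norm_minus_commute)
    then have "diameter {x, y} < \<delta>" using that by simp
    then obtain B where "B \<in> \<C>" "{x, y} \<subseteq> B" using leb[of "{x,y}"] xy by auto
    then show ?thesis by (simp add: \<C>_def)
  qed
  obtain n :: nat where n: "real n * \<delta> > R" using \<delta> reals_Archimedean3 by blast
  then have n0: "n > 0" using R by (cases n) auto
  have "\<exists>w. continuous_on K w \<and> (\<forall>x\<in>K. w x = u0 ((k / n) *\<^sub>R x) \<or> w x = - u0 ((k / n) *\<^sub>R x))"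
    if "k \<le> n" for k :: nat
    using that
  proof (induction k)
    case 0
    show ?case by (rule exI[of _ "\<lambda>_. u0 0"]) auto
  next
    case (Suc k)
    then obtain w where w: "continuous_on K w"
      and wu: "\<And>x. x \<in> K \<Longrightarrow> w x = u0 ((k / n) *\<^sub>R x) \<or> w x = - u0 ((k / n) *\<^sub>R x)" by auto
    define q where "q x = (Suc k / n) *\<^sub>R x" for x :: 'a
    \<comment> \<open>The sign at stage \<open>Suc k\<close> is copied from stage \<open>k\<close>
      over the same point of \<open>K\<close>. It is well defined because the two arguments of
      \<open>u0\<close> are less than \<delta> apart, and continuous because \<open>w'\<close> does
      not change when \<open>u0\<close> is replaced by a local continuous choice
      \<open>v\<close>.\<close>
    define w' where "w' x = sgn (w x \<bullet> u0 (q x)) *\<^sub>R u0 (q x)" for x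
    have inK: "(t / n) *\<^sub>R x \<in> K" if "t \<le> n" "x \<in> K" for t :: nat and x
    proof -
      have "real t / n * norm x \<le> 1 * R"
        using that n0 by (intro mult_mono) (auto simp: K_def)
      then show ?thesis by (simp add: K_def)
    qed
    have wq: "w x \<bullet> u0 (q x) \<noteq> 0" if "x \<in> K" for x
    proof -
      have "dist ((k / n) *\<^sub>R x) (q x) = norm ((k/n - Suc k / n) *\<^sub>R x)"
        by (simp only: dist_norm q_def scaleR_left_diff_distrib)
      also have "\<dots> = norm x / n"
        by (simp add: diff_divide_distrib[symmetric])
      also have "\<dots> \<le> R / n" using that by (simp add: K_def divide_right_mono)
      also have "\<dots> < \<delta>" using n n0 by (simp add: field_simps)
      finally have "u0 ((k / n) *\<^sub>R x) \<bullet> u0 (q x) \<noteq> 0"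
        using inK[of k x] inK[of "Suc k" x] that Suc.prems by (intro close) (auto simp: q_def)
      then show ?thesis using wu[OF that] by auto
    qed
    have "continuous (at x within K) w'" if x: "x \<in> K" for x
    proof -
      obtain W v where W: "open W" "q x \<in> W" "continuous_on W v"
        and v: "\<And>y. y \<in> W \<Longrightarrow> v y = u0 y \<or> v y = - u0 y"
        using loc[of "q x"] by blast
      have oq: "open (q -` W)" using W(1) unfolding q_def
        by (intro open_vimage continuous_intros) auto
      let ?S = "K \<inter> q -` W"
      have cq: "continuous_on ?S (\<lambda>x. v (q x))"
        by (rule continuous_on_compose2[OF W(3)]) (auto simp: q_def intro!: continuous_intros)
      have nz': "w y \<bullet> v (q y) \<noteq> 0" if "y \<in> ?S" for y
        using wq[of y] v[of "q y"] that by auto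
      have "continuous_on ?S (\<lambda>x. sgn (w x \<bullet> v (q x)) *\<^sub>R v (q x))"
        using nz' by (intro continuous_intros cq continuous_on_subset[OF w]) auto
      then have "continuous_on ?S w'"
      proof (rule continuous_on_eq)
        fix y assume "y \<in> ?S"
        then show "sgn (w y \<bullet> v (q y)) *\<^sub>R v (q y) = w' y"
          using v[of "q y"] by (auto simp: w'_def sgn_minus)
      qed
      then have "continuous (at x within K \<inter> q -` W) w'"
        using x W(2) by (simp add: continuous_on_eq_continuous_within)
      moreover have "at x within K \<inter> q -` W = at x within K"
        by (rule at_within_nhd[OF _ oq]) (use W in auto)
      ultimately show ?thesis by simp
    qed
    then have "continuous_on K w'" by (simp add: continuous_on_eq_continuous_within)
    moreover have "w' x = u0 (q x) \<or> w' x = - u0 (q x)" if "x \<in> K" for x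
      using wq[OF that] by (auto simp: w'_def sgn_real_def)
    ultimately show ?case unfolding q_def by blast
  qed
  from this[of n] n0 obtain w where w: "continuous_on K w"
    and wu: "\<And>x. x \<in> K \<Longrightarrow> w x = u0 x \<or> w x = - u0 x" by auto
  \<comment> \<open>The radial retraction onto \<open>K\<close> extends \<open>w\<close> to the
    whole space. It does not alter \<open>u0\<close>, which is constant on and outside the sphere of
    radius \<open>R\<close>.\<close>
  define p where "p x = (R / max R (norm x)) *\<^sub>R x" for x :: 'a
  have pK: "p x \<in> K" for x
  proof -
    have "R * norm x \<le> R * max R (norm x)" using R by simp
    then have "R / max R (norm x) * norm x \<le> R" using R by (simp add: divide_le_eq max_def)
    then show ?thesis using R by (simp add: p_def K_def)
  qed
  have "continuous_on UNIV (\<lambda>x. w (p x))"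
    by (rule continuous_on_compose2[OF w])
       (use R pK in \<open>auto simp: p_def[abs_def] intro!: continuous_intros\<close>)
  moreover have "u0 (p x) = u0 x" for x
  proof (cases "norm x \<le> R")
    case True then show ?thesis using R by (simp add: p_def max_def)
  next
    case False
    then have "norm (p x) = R" using R by (auto simp: p_def max_def)
    then show ?thesis using out[of "p x"] out[of x] False by auto
  qed
  ultimately show ?thesis using wu[OF pK] by (intro exI[of _ "\<lambda>x. w (p x)"]) auto
qed

section \<open>Functions with unit gradient on a tube\<close>

locale eikonal =
  fixes s :: "'a::euclidean_space \<Rightarrow> real" and N :: "'a \<Rightarrow> 'a" and \<rho> :: real
  assumes lip: "\<bar>s x - s y\<bar> \<le> dist x y"
    and der: "\<bar>s x\<bar> < \<rho> \<Longrightarrow> (s has_derivative (\<lambda>h. N x \<bullet> h)) (at x)"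
    and unit: "\<bar>s x\<bar> < \<rho> \<Longrightarrow> norm (N x) = 1"
begin

text \<open>Lets one-sided statements about moving along the normal be transferred to the opposite
  direction.\<close>

lemma eikonal_uminus: "eikonal (\<lambda>x. - s x) (\<lambda>x. - N x) \<rho>"
proof
  show "\<bar>- s x - - s y\<bar> \<le> dist x y" for x y using lip[of x y] by linarith
  show "((\<lambda>x. - s x) has_derivative (\<lambda>h. - N x \<bullet> h)) (at x)" if "\<bar>- s x\<bar> < \<rho>" for x
    using has_derivative_minus[OF der[of x]] that by simp
  show "norm (- N x) = 1" if "\<bar>- s x\<bar> < \<rho>" for x using unit[of x] that by simp
qed

lemma continuous_s: "continuous_on A s"
  unfolding continuous_on_iff
proof (intro ballI allI impI)
  fix x e assume "(e::real) > 0"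
  then show "\<exists>d>0. \<forall>x'\<in>A. dist x' x < d \<longrightarrow> dist (s x') (s x) < e"
    by (intro exI[of _ e]) (metis dist_real_def lip order_le_less_trans)
qed

lemma directional:
  assumes "\<bar>s x\<bar> < \<rho>"
  shows "((\<lambda>t. (s (x + t *\<^sub>R v) - s x) / t) \<longlongrightarrow> N x \<bullet> v) (at_right 0)"
proof -
  have "((\<lambda>t. s (x + t *\<^sub>R v)) has_derivative (\<lambda>t. N x \<bullet> (t *\<^sub>R v))) (at 0)"
    by (rule has_derivative_compose[where g = s])
       (auto intro!: derivative_eq_intros simp: der[OF assms])
  then have "((\<lambda>t. s (x + t *\<^sub>R v)) has_field_derivative (N x \<bullet> v)) (at 0)"
    by (simp add: has_field_derivative_def mult_commute_abs)
  then have "((\<lambda>t. s (x + t *\<^sub>R v)) has_field_derivative (N x \<bullet> v)) (at 0 within {0<..})"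
    by (rule DERIV_subset) simp
  then show ?thesis by (simp add: has_field_derivative_iff)
qed

text \<open>Unit growth along \<open>m\<close> gives inner product 1 between two unit vectors, which
  is the equality case of Cauchy-Schwarz.\<close>

lemma N_eqI:
  assumes "\<bar>s x\<bar> < \<rho>" "norm m = 1" "l > 0" and s: "\<And>t. 0 < t \<Longrightarrow> t < l \<Longrightarrow> s (x + t *\<^sub>R m) = s x + t"
  shows "N x = m"
proof -
  have "eventually (\<lambda>t. (s (x + t *\<^sub>R m) - s x) / t = 1) (at_right 0)"
    using eventually_at_right_real[OF \<open>l > 0\<close>] by eventually_elim (auto simp: s)
  then have "((\<lambda>t. (s (x + t *\<^sub>R m) - s x) / t) \<longlongrightarrow> 1) (at_right 0)"
    by (rule tendsto_eventually)
  then have "N x \<bullet> m = 1"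
    using tendsto_unique[OF _ directional[OF assms(1)]] by (simp add: trivial_limit_at_right_real)
  moreover have "N x \<bullet> N x = 1" "m \<bullet> m = 1"
    using assms(2) unit[OF assms(1)] by (simp_all add: dot_square_norm)
  ultimately have "(N x - m) \<bullet> (N x - m) = 0"
    by (simp add: inner_diff_left inner_diff_right inner_commute)
  then show ?thesis by simp
qed

text \<open>If the Lipschitz bound is attained between two points, it is attained on the whole
  segment between them, so \<open>s\<close> grows at unit speed there and the normal at either end
  is the direction of the segment.\<close>

lemma line:
  assumes x: "\<bar>s x\<bar> < \<rho>" and xy: "s y - s x = dist x y" "x \<noteq> y"
  shows "y = x + dist x y *\<^sub>R N x" and "\<bar>s y\<bar> < \<rho> \<Longrightarrow> N y = N x"
proof -
  define l where "l = dist x y"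
  define m where "m = (y - x) /\<^sub>R l"
  have l: "l > 0" and m: "norm m = 1" and y: "y = x + l *\<^sub>R m"
    using xy by (auto simp: l_def m_def dist_norm norm_minus_commute)
  have s: "s (x + t *\<^sub>R m) = s x + t" if "0 \<le> t" "t \<le> l" for t
  proof -
    have "dist x (x + t *\<^sub>R m) = t" using that m by (simp add: dist_norm)
    moreover have "y - (x + t *\<^sub>R m) = (l - t) *\<^sub>R m" by (simp add: y algebra_simps)
    then have "dist y (x + t *\<^sub>R m) = l - t" using that m by (simp add: dist_norm)
    ultimately show ?thesis
      using lip[of x "x + t *\<^sub>R m"] lip[of y "x + t *\<^sub>R m"] xy(1) l_def by linarith
  qed
  have Nx: "N x = m" by (rule N_eqI[OF x m l]) (simp add: s)
  then show "y = x + dist x y *\<^sub>R N x" using y by (simp add: l_def)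
  assume sy: "\<bar>s y\<bar> < \<rho>"
  \<comment> \<open>Seen from \<open>y\<close>, the segment is traversed in direction
    \<open>- m\<close>, along which \<open>- s\<close> is the growing function.\<close>
  interpret minus: eikonal "\<lambda>x. - s x" "\<lambda>x. - N x" \<rho> by (rule eikonal_uminus)
  have "- N y = - m"
  proof (rule minus.N_eqI[OF _ _ l])
    fix t :: real assume t: "0 < t" "t < l"
    have "y + t *\<^sub>R - m = x + (l - t) *\<^sub>R m" by (simp add: y algebra_simps)
    then have "s (y + t *\<^sub>R - m) = s x + (l - t)" using s[of "l - t"] t by simp
    then show "- s (y + t *\<^sub>R - m) = - s y + t" using xy(1) by (simp add: l_def)
  qed (use sy m in auto)
  then show "N y = N x" using Nx by simp
qed

text \<open>A point of the closed ball maximising the slightly tilted function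
  \<open>\<lambda>y. s y - (1 - \<eta>) * dist x y\<close> lies on the boundary sphere, since \<open>s\<close> increases at unit rate in
  the direction \<open>N\<close>.\<close>

lemma s_grows:
  assumes e: "0 < e" "e < \<rho> - \<bar>s x\<bar>" and \<eta>: "0 < \<eta>" "\<eta> < 1"
  shows "\<exists>y. dist x y = e \<and> s y \<ge> s x + (1 - \<eta>) * e"
proof -
  define \<Psi> where "\<Psi> y = s y - (1 - \<eta>) * dist x y" for y
  have "continuous_on (cball x e) \<Psi>"
    unfolding \<Psi>_def by (intro continuous_intros continuous_s)
  then obtain y where y: "y \<in> cball x e" and max: "\<And>y'. y' \<in> cball x e \<Longrightarrow> \<Psi> y' \<le> \<Psi> y"
    using continuous_attains_sup[of "cball x e" \<Psi>] e by auto
  have sy: "\<bar>s y\<bar> < \<rho>" using lip[of y x] y e by (simp add: dist_commute)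
  have "\<not> dist x y < e"
  proof
    assume d: "dist x y < e"
    have "((\<lambda>t. (s (y + t *\<^sub>R N y) - s y) / t) \<longlongrightarrow> 1) (at_right 0)"
      using directional[OF sy, of "N y"] unit[OF sy] by (simp add: dot_square_norm)
    then have "eventually (\<lambda>t. (s (y + t *\<^sub>R N y) - s y) / t > 1 - \<eta>) (at_right 0)"
      using \<eta> by (intro order_tendstoD(1)) auto
    moreover have "eventually (\<lambda>t. t \<in> {0<..<e - dist x y}) (at_right 0)"
      using d by (intro eventually_at_right_real) auto
    ultimately have "eventually (\<lambda>t::real. False) (at_right 0)"
    proof eventually_elim
      case (elim t)
      have le: "dist x (y + t *\<^sub>R N y) \<le> dist x y + t"
        using dist_triangle[of x "y + t *\<^sub>R N y" y] elim unit[OF sy] by (simp add: dist_norm)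
      then have "\<Psi> (y + t *\<^sub>R N y) \<le> \<Psi> y" using elim by (intro max) auto
      moreover have "(1 - \<eta>) * dist x (y + t *\<^sub>R N y) \<le> (1 - \<eta>) * (dist x y + t)"
        using le \<eta> by (intro mult_left_mono) auto
      moreover have "s (y + t *\<^sub>R N y) - s y > (1 - \<eta>) * t"
        using elim by (simp add: field_simps)
      ultimately show ?case by (simp add: \<Psi>_def algebra_simps)
    qed
    then show False by (simp add: trivial_limit_at_right_real)
  qed
  then have "dist x y = e" using y by simp
  moreover have "\<Psi> x \<le> \<Psi> y" using e by (intro max) auto
  ultimately show ?thesis by (intro exI[of _ y]) (auto simp: \<Psi>_def)
qed

text \<open>Letting \<eta> tend to 0 in \<open>s_grows\<close>, the maximum of \<open>s\<close> over
  the sphere is \<open>s x + e\<close>, the largest value that the Lipschitz bound permits. The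
  equality case \<open>line\<close> then forces the maximiser to be
  \<open>x + e *\<^sub>R N x\<close>.\<close>

lemma advance_pos:
  assumes e: "0 < e" "e < \<rho> - \<bar>s x\<bar>"
  shows "s (x + e *\<^sub>R N x) = s x + e" "N (x + e *\<^sub>R N x) = N x"
proof -
  obtain y0 where "dist x y0 = e" using s_grows[OF e, of "1/2"] by auto
  then have "sphere x e \<noteq> {}" by auto
  then obtain y where y: "y \<in> sphere x e" and max: "\<And>y'. y' \<in> sphere x e \<Longrightarrow> s y' \<le> s y"
    using continuous_attains_sup[of "sphere x e" s] continuous_s by auto
  have "s x + e - s y \<le> \<eta>" if "\<eta> > 0" for \<eta>
  proof (cases "\<eta> < e")
    case True
    then have "0 < \<eta> / e" "\<eta> / e < 1" using that e by auto
    then obtain y' where "dist x y' = e" "s y' \<ge> s x + (1 - \<eta> / e) * e"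
      using s_grows[OF e, of "\<eta> / e"] by auto
    then show ?thesis using max[of y'] e by (simp add: algebra_simps)
  next
    case False
    moreover obtain y' where "dist x y' = e" "s y' \<ge> s x + (1 - 1/2) * e"
      using s_grows[OF e, of "1/2"] by auto
    ultimately show ?thesis using max[of y'] e by simp
  qed
  then have "s x + e - s y \<le> 0" by (rule field_le_epsilon[of _ 0, simplified])
  then have sy: "s y - s x = dist x y" using lip[of x y] y by simp
  have x: "\<bar>s x\<bar> < \<rho>" and "\<bar>s y\<bar> < \<rho>" and "x \<noteq> y" using e sy y by auto
  from line[OF x sy \<open>x \<noteq> y\<close>] this y sy
  show "s (x + e *\<^sub>R N x) = s x + e" "N (x + e *\<^sub>R N x) = N x" by auto
qed

lemma advance:
  assumes e: "\<bar>e\<bar> < \<rho> - \<bar>s x\<bar>"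
  shows "s (x + e *\<^sub>R N x) = s x + e" "N (x + e *\<^sub>R N x) = N x"
proof -
  interpret minus: eikonal "\<lambda>x. - s x" "\<lambda>x. - N x" \<rho> by (rule eikonal_uminus)
  have "s (x + e *\<^sub>R N x) = s x + e \<and> N (x + e *\<^sub>R N x) = N x"
    using advance_pos[of e x] minus.advance_pos[of "- e" x] e
    by (cases "e > 0"; cases "e < 0") auto
  then show "s (x + e *\<^sub>R N x) = s x + e" "N (x + e *\<^sub>R N x) = N x" by auto
qed

lemma quad_upper:
  assumes e: "0 < e" "e < \<rho> - \<bar>s x\<bar>"
  shows "s y - s x - N x \<bullet> (y - x) \<le> (norm (y - x))\<^sup>2 / (2 * e)"
proof -
  define L where "L = dist y (x + (- e) *\<^sub>R N x)"
  have x: "\<bar>s x\<bar> < \<rho>" using e by simp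
  have "L\<^sup>2 = (norm ((y - x) + e *\<^sub>R N x))\<^sup>2" by (simp add: L_def dist_norm algebra_simps)
  also have "\<dots> = (norm (y - x))\<^sup>2 + 2 * e * (N x \<bullet> (y - x)) + e\<^sup>2 * (N x \<bullet> N x)"
    unfolding power2_norm_eq_inner
    by (simp add: inner_add_left inner_add_right inner_commute power2_eq_square)
  finally have L2: "L\<^sup>2 = (norm (y - x))\<^sup>2 + 2 * e * (N x \<bullet> (y - x)) + e\<^sup>2"
    using unit[OF x] by (simp add: dot_square_norm)
  \<comment> \<open>Replaces the cone \<open>L\<close> by the paraboloid
    \<open>(L\<^sup>2 + e\<^sup>2) / (2 * e)\<close>, which touches it to first order where
    \<open>L = e\<close>, that is at \<open>x\<close>.\<close>
  have "0 \<le> (L - e)\<^sup>2" by simp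
  then have "2 * e * L \<le> L\<^sup>2 + e\<^sup>2" by (simp add: power2_diff mult_ac)
  then have "2 * e * L \<le> (norm (y - x))\<^sup>2 + 2 * e * (N x \<bullet> (y - x)) + 2 * e * e"
    unfolding L2 by (simp add: power2_eq_square)
  then have "L \<le> (norm (y - x))\<^sup>2 / (2 * e) + N x \<bullet> (y - x) + e"
    using e by (simp add: field_simps)
  moreover have "s y - (s x - e) \<le> L"
    using lip[of y "x + (- e) *\<^sub>R N x"] advance(1)[of "- e" x] e by (simp add: L_def)
  ultimately show ?thesis by simp
qed

lemma quad_lower:
  assumes e: "0 < e" "e < \<rho> - \<bar>s x\<bar>"
  shows "s y - s x - N x \<bullet> (y - x) \<ge> - ((norm (y - x))\<^sup>2 / (2 * e))"
proof -
  interpret minus: eikonal "\<lambda>x. - s x" "\<lambda>x. - N x" \<rho> by (rule eikonal_uminus)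
  show ?thesis using minus.quad_upper[of e x y] e by simp
qed

text \<open>The two-sided quadratic bounds at \<open>x\<close> and \<open>x'\<close> are compared at two points that are symmetric
  about the midpoint; a single comparison point would lose a factor in the Lipschitz constant.\<close>

lemma N_lipschitz:
  assumes e: "0 < e" "e < \<rho> - \<bar>s x\<bar>" "e < \<rho> - \<bar>s x'\<bar>"
  shows "norm (N x' - N x) \<le> dist x' x / e"
proof (cases "N x' = N x")
  case True then show ?thesis using e by simp
next
  case False
  define a where "a = (1/2) *\<^sub>R (x' - x)"
  \<comment> \<open>The direction of \<open>b\<close> turns its inner product with the difference of
    normals into a norm. Its length, equal to that of \<open>a\<close>, gives the sharp constant
    once the parallelogram law is applied.\<close>
  define b where "b = (norm a / norm (N x' - N x)) *\<^sub>R (N x' - N x)"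
  define y where "y = x + a + b"
  define y' where "y' = x + a - b"
  have nb: "norm b = norm a" using False by (simp add: b_def)
  have x': "x' = x + 2 *\<^sub>R a" by (simp add: a_def)
  have d: "y - x = a + b" "y' - x = a - b" "y - x' = b - a" "y' - x' = - (a + b)"
    by (simp_all add: y_def y'_def x' scaleR_2)
  have "norm (b - a) = norm (a - b)" "norm (- (a + b)) = norm (a + b)"
    by (simp_all only: norm_minus_commute norm_minus_cancel)
  \<comment> \<open>When the four bounds are combined, all values of \<open>s\<close> and all terms
    with \<open>a\<close> in the inner products cancel.\<close>
  then have "2 * ((N x' - N x) \<bullet> b) \<le> 2 * (((norm (a + b))\<^sup>2 + (norm (a - b))\<^sup>2) / (2 * e))"
    using quad_upper[OF e(1,2), of y] quad_lower[OF e(1,2), of y']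
      quad_upper[OF e(1,3), of y'] quad_lower[OF e(1,3), of y]
    unfolding d
    by (simp add: inner_add_right inner_diff_right inner_diff_left add_divide_distrib)
  also have "(norm (a + b))\<^sup>2 + (norm (a - b))\<^sup>2 = 2 * ((norm a)\<^sup>2 + (norm b)\<^sup>2)"
    unfolding power2_norm_eq_inner
    by (simp add: inner_add_left inner_add_right inner_diff_left inner_diff_right)
  also have "(N x' - N x) \<bullet> b = norm a * norm (N x' - N x)"
    using False by (simp add: b_def dot_square_norm power2_eq_square)
  finally have "norm a * norm (N x' - N x) \<le> norm a * (2 * norm a / e)"
    using e by (simp add: nb power2_eq_square field_simps)
  moreover have "norm a > 0" using False by (auto simp: a_def)
  ultimately have "norm (N x' - N x) \<le> 2 * norm a / e" by (rule mult_left_le_imp_le)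
  then show ?thesis by (simp add: a_def dist_norm)
qed

lemma N_lipschitz_near:
  assumes x: "\<bar>s x\<bar> < \<rho>"
  obtains e where "e > 0" "\<And>y. dist x y < e \<Longrightarrow> \<bar>s y\<bar> < \<rho>"
    "\<And>y y'. dist x y < e \<Longrightarrow> dist x y' < e \<Longrightarrow> norm (N y - N y') \<le> dist y y' / e"
proof
  \<comment> \<open>Half of the gap to the edge of the tube serves both as the radius of the ball
    and as the \<open>e\<close> of the Lipschitz bound: a move shorter than \<open>e\<close> leaves
    more than the other half.\<close>
  define e where "e = (\<rho> - \<bar>s x\<bar>) / 2"
  show e: "e > 0" using x by (simp add: e_def)
  have *: "e < \<rho> - \<bar>s y\<bar>" if "dist x y < e" for y
  proof -
    have "\<bar>s y\<bar> \<le> \<bar>s x\<bar> + dist x y" using lip[of x y] by linarith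
    then show ?thesis using that by (simp add: e_def)
  qed
  show "\<bar>s y\<bar> < \<rho>" if "dist x y < e" for y using *[OF that] e by linarith
  show "norm (N y - N y') \<le> dist y y' / e" if "dist x y < e" "dist x y' < e" for y y'
    using N_lipschitz[OF e *[OF that(2)] *[OF that(1)]] .
qed

lemma isCont_N:
  assumes x: "\<bar>s x\<bar> < \<rho>"
  shows "isCont N x"
proof -
  obtain e where e: "e > 0" "\<And>y. dist x y < e \<Longrightarrow> norm (N y - N x) \<le> dist y x / e"
    using N_lipschitz_near[OF x] by (metis dist_self)
  have "((\<lambda>y. N y - N x) \<longlongrightarrow> 0) (at x)"
  proof (rule Lim_null_comparison)
    show "eventually (\<lambda>y. norm (N y - N x) \<le> dist y x / e) (at x)"
      unfolding eventually_at using e by (metis dist_commute)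
    show "((\<lambda>y. dist y x / e) \<longlongrightarrow> 0) (at x)"
      using e by (auto intro!: tendsto_eq_intros)
  qed
  then show ?thesis by (simp add: isCont_def LIM_zero_iff)
qed

end

section \<open>Derivatives of the normal field\<close>

lemma has_derivative_direction:
  fixes f :: "'a::real_normed_vector \<Rightarrow> 'b::real_normed_vector"
  assumes f: "(f has_derivative f') (at z)"
  shows "((\<lambda>t. (f (z + t *\<^sub>R w) - f z) /\<^sub>R t) \<longlongrightarrow> f' w) (at_right 0)"
proof -
  interpret f': bounded_linear f' using f by (rule has_derivative_bounded_linear)
  have "((\<lambda>t. f (z + t *\<^sub>R w)) has_derivative (\<lambda>t. f' (t *\<^sub>R w))) (at 0)"
    by (rule has_derivative_compose[where g = f]) (auto intro!: derivative_eq_intros simp: f)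
  then have "((\<lambda>t. f (z + t *\<^sub>R w)) has_derivative (\<lambda>t. f' (t *\<^sub>R w))) (at_right 0)"
    by (rule has_derivative_subset) simp
  then have "((\<lambda>t. norm ((f (z + t *\<^sub>R w) - f z) - t *\<^sub>R f' w) / norm t) \<longlongrightarrow> 0) (at_right 0)"
    unfolding has_derivative_iff_norm by (simp add: f'.scaleR)
  moreover have "eventually (\<lambda>t. norm ((f (z + t *\<^sub>R w) - f z) - t *\<^sub>R f' w) / norm t
      = norm ((f (z + t *\<^sub>R w) - f z) /\<^sub>R t - f' w)) (at_right 0)"
    using eventually_at_right_less
  proof eventually_elim
    case (elim t)
    have "(f (z + t *\<^sub>R w) - f z) /\<^sub>R t - f' w = ((f (z + t *\<^sub>R w) - f z) - t *\<^sub>R f' w) /\<^sub>R t"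
      using elim by (simp add: scaleR_diff_right)
    then show ?case by (simp add: divide_inverse mult.commute)
  qed
  ultimately have "((\<lambda>t. norm ((f (z + t *\<^sub>R w) - f z) /\<^sub>R t - f' w)) \<longlongrightarrow> 0) (at_right 0)"
    by (rule Lim_transform_eventually)
  then show ?thesis by (simp add: tendsto_norm_zero_iff LIM_zero_iff)
qed

text \<open>Compares difference quotients along one ray. With \<open>g\<close> the identity it turns
  a Lipschitz bound into a bound on the derivative; with a general \<open>g\<close> it shows that
  the kernel of \<open>g'\<close> lies in the kernel of \<open>f'\<close>.\<close>

lemma derivative_norm_le:
  fixes f :: "'a::real_normed_vector \<Rightarrow> 'b::real_normed_vector" and g :: "'a \<Rightarrow> 'c::real_normed_vector"
  assumes f: "(f has_derivative f') (at z)" and g: "(g has_derivative g') (at z)"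
    and le: "eventually (\<lambda>y. norm (f y - f z) \<le> C * norm (g y - g z)) (nhds z)"
  shows "norm (f' w) \<le> C * norm (g' w)"
proof (rule tendsto_le[OF trivial_limit_at_right_real])
  show "((\<lambda>t. norm ((f (z + t *\<^sub>R w) - f z) /\<^sub>R t)) \<longlongrightarrow> norm (f' w)) (at_right 0)"
    by (intro tendsto_norm has_derivative_direction f)
  show "((\<lambda>t. C * norm ((g (z + t *\<^sub>R w) - g z) /\<^sub>R t)) \<longlongrightarrow> C * norm (g' w)) (at_right 0)"
    by (intro tendsto_intros has_derivative_direction g)
  have "((\<lambda>t. z + t *\<^sub>R w) \<longlongrightarrow> z + 0 *\<^sub>R w) (at_right 0)" by (intro tendsto_intros)
  then have "filterlim (\<lambda>t. z + t *\<^sub>R w) (nhds z) (at_right 0)" by simp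
  from eventually_compose_filterlim[OF le this]
  show "eventually (\<lambda>t. norm ((f (z + t *\<^sub>R w) - f z) /\<^sub>R t)
      \<le> C * norm ((g (z + t *\<^sub>R w) - g z) /\<^sub>R t)) (at_right 0)"
    using eventually_at_right_less
  proof eventually_elim
    case (elim t)
    then have "inverse t * norm (f (z + t *\<^sub>R w) - f z) \<le> inverse t * (C * norm (g (z + t *\<^sub>R w) - g z))"
      by (intro mult_left_mono) auto
    then show ?case using elim by (simp add: mult_ac)
  qed
qed

context eikonal
begin

lemma eventually_tube: "\<bar>s x\<bar> < r \<Longrightarrow> eventually (\<lambda>y. \<bar>s y\<bar> < r) (nhds x)"
  using open_Collect_less[of "\<lambda>y. \<bar>s y\<bar>" "\<lambda>_. r"]
  by (auto intro!: continuous_intros continuous_s simp: eventually_nhds)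

lemma eventually_lipschitz:
  assumes x: "\<bar>s x\<bar> < \<rho>" and e: "0 < e" "e < \<rho> - \<bar>s x\<bar>"
  shows "eventually (\<lambda>y. norm (N y - N x) \<le> (1 / e) * norm (y - x)) (nhds x)"
proof -
  have "\<bar>s x\<bar> < \<rho> - e" using e by simp
  from eventually_tube[OF this] show ?thesis
    by eventually_elim (use e N_lipschitz[of e x] in \<open>auto simp: dist_norm\<close>)
qed

text \<open>Every positive \<open>e\<close> below \<open>\<rho> - \<bar>s x\<bar>\<close> yields the
  local Lipschitz constant \<open>1 / e\<close>. A violation of the limiting bound is strict and
  leaves room for such an \<open>e\<close> in between.\<close>

lemma derivative_N_bound:
  assumes x: "\<bar>s x\<bar> < \<rho>" and A: "(N has_derivative A) (at x)"
  shows "norm (A w) \<le> norm w / (\<rho> - \<bar>s x\<bar>)"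
proof (rule ccontr)
  define r where "r = \<rho> - \<bar>s x\<bar>"
  have r: "r > 0" using x by (simp add: r_def)
  assume "\<not> norm (A w) \<le> norm w / (\<rho> - \<bar>s x\<bar>)"
  then have less: "norm w < norm (A w) * r" using r by (simp add: r_def[symmetric] field_simps)
  then have Aw: "norm (A w) > 0" using r by (metis norm_ge_zero norm_zero mult_zero_left less_irrefl less_le_trans not_less zero_less_norm_iff order.strict_iff_order)
  then have "norm w / norm (A w) < r" using less by (simp add: field_simps)
  then obtain e where e: "norm w / norm (A w) < e" "e < r" using dense by blast
  have e0: "0 < e" using e(1) Aw by (meson divide_nonneg_nonneg le_less_trans norm_ge_zero)
  have "norm (A w) \<le> (1 / e) * norm w"
    by (rule derivative_norm_le[OF A has_derivative_ident eventually_lipschitz[OF x e0]])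
       (use e in \<open>simp add: r_def\<close>)
  then show False using e0 e Aw by (simp add: field_simps)
qed

text \<open>Obtained by differentiating the identity \<open>N y \<bullet> N y = 1\<close>, valid
  throughout the tube.\<close>

lemma derivative_N_orthogonal:
  assumes x: "\<bar>s x\<bar> < \<rho>" and A: "(N has_derivative A) (at x)"
  shows "N x \<bullet> A w = 0"
proof -
  have "((\<lambda>y. N y \<bullet> N y) has_derivative (\<lambda>h. N x \<bullet> A h + A h \<bullet> N x)) (at x)"
    by (rule has_derivative_inner[OF A A])
  moreover have "((\<lambda>y. N y \<bullet> N y) has_derivative (\<lambda>h. 0)) (at x)"
  proof (rule has_derivative_transform_eventually[OF has_derivative_const[of 1]])
    show "eventually (\<lambda>y. 1 = N y \<bullet> N y) (at x)"
      using eventually_tube[OF x] unfolding eventually_at_filter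
      by eventually_elim (simp add: unit dot_square_norm)
  qed (simp_all add: unit[OF x] dot_square_norm)
  ultimately have "(\<lambda>h. N x \<bullet> A h + A h \<bullet> N x) = (\<lambda>h. 0)" by (rule has_derivative_unique)
  then have "N x \<bullet> A w + A w \<bullet> N x = 0" by metis
  then show ?thesis by (simp add: inner_commute)
qed

text \<open>Expressed through \<open>s\<close> and \<open>N\<close> instead of as a choice of
  nearest point, so that its regularity can be read off from theirs.\<close>

definition foot :: "'a \<Rightarrow> 'a" where "foot x = x - s x *\<^sub>R N x"

end

section \<open>Foot points and the normal field on the zero set\<close>

text \<open>One application of \<open>advance\<close> reaches the zero set only if
  \<open>\<bar>s x\<bar> < \<rho> / 2\<close>. The assumption provides a zero at distance
  \<open>\<bar>s x\<bar>\<close> in the whole tube; for a signed distance it is a nearest point of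
  \<open>Z\<close>.\<close>

locale eikonal_foot = eikonal +
  assumes foot_exists: "\<bar>s x\<bar> < \<rho> \<Longrightarrow> \<exists>z. s z = 0 \<and> dist x z = \<bar>s x\<bar>"
begin

text \<open>The nearest zero attains the Lipschitz bound for \<open>s\<close> or for
  \<open>- s\<close>, depending on the sign of \<open>s x\<close>. The equality case
  \<open>line\<close> therefore places it on the normal line through \<open>x\<close>.\<close>

lemma foot:
  assumes x: "\<bar>s x\<bar> < \<rho>"
  shows "s (foot x) = 0" "N (foot x) = N x"
proof -
  interpret minus: eikonal "\<lambda>x. - s x" "\<lambda>x. - N x" \<rho> by (rule eikonal_uminus)
  obtain z where z: "s z = 0" "dist x z = \<bar>s x\<bar>" using foot_exists[OF x] by blast
  have \<rho>: "\<bar>s z\<bar> < \<rho>" using x z by simp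
  have "z = foot x \<and> N z = N x"
  proof (cases "s x = 0")
    case True then show ?thesis using z by (simp add: foot_def)
  next
    case False
    then have xz: "x \<noteq> z" using z by auto
    show ?thesis
    proof (cases "s x < 0")
      case True
      then show ?thesis using line[OF x _ xz] z \<rho> by (simp add: foot_def)
    next
      case False
      then show ?thesis using minus.line[OF _ _ xz] x z \<rho> by (simp add: foot_def)
    qed
  qed
  then show "s (foot x) = 0" "N (foot x) = N x" using z by auto
qed

lemma isCont_foot: "\<bar>s x\<bar> < \<rho> \<Longrightarrow> isCont foot x"
  unfolding foot_def using continuous_s[of UNIV]
  by (intro continuous_intros isCont_N) (auto simp: continuous_on_eq_continuous_at)

text \<open>The path is taken through the foot, from which any distance below \<rho> may be
  travelled in both directions, whereas \<open>advance\<close> at \<open>x\<close> itself stops at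
  \<open>\<rho> - \<bar>s x\<bar>\<close>.\<close>

lemma N_along_normal:
  assumes x: "\<bar>s x\<bar> < \<rho>" and t: "\<bar>s x - t\<bar> < \<rho>"
  shows "N (x - t *\<^sub>R N x) = N x"
proof -
  have \<rho>: "0 < \<rho>" using x by linarith
  have "x - t *\<^sub>R N x = foot x + (s x - t) *\<^sub>R N (foot x)"
    using foot[OF x] by (simp add: foot_def algebra_simps)
  moreover have "N (foot x + (s x - t) *\<^sub>R N (foot x)) = N (foot x)"
    by (rule advance) (use foot[OF x] t in auto)
  ultimately show ?thesis using foot[OF x] by simp
qed

text \<open>The product of \<open>s\<close> and \<open>N\<close> is differentiable at
  \<open>z\<close> because \<open>s z = 0\<close>: continuity of \<open>N\<close> at
  \<open>z\<close> is enough. The derivative is the orthogonal projection along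
  \<open>N z\<close>.\<close>

lemma has_derivative_foot:
  assumes z: "s z = 0" and \<rho>: "\<rho> > 0"
  shows "(foot has_derivative (\<lambda>h. h - (N z \<bullet> h) *\<^sub>R N z)) (at z)"
proof -
  have z': "\<bar>s z\<bar> < \<rho>" using z \<rho> by simp
  have "((\<lambda>y. s y *\<^sub>R N y) has_derivative (\<lambda>h. (N z \<bullet> h) *\<^sub>R N z)) (at z)"
    unfolding has_derivative_iff_norm
  proof
    show "bounded_linear (\<lambda>h. (N z \<bullet> h) *\<^sub>R N z)"
      by (intro bounded_linear_scaleR_const bounded_linear_inner_right)
    have ds: "((\<lambda>y. norm ((s y - s z) - N z \<bullet> (y - z)) / norm (y - z)) \<longlongrightarrow> 0) (at z)"
      using der[OF z'] unfolding has_derivative_iff_norm by blast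
    have dN: "((\<lambda>y. norm (N y - N z)) \<longlongrightarrow> 0) (at z)"
      using isCont_N[OF z'] by (simp add: isCont_def tendsto_norm_zero_iff LIM_zero_iff)
    show "((\<lambda>y. norm (s y *\<^sub>R N y - s z *\<^sub>R N z - (N z \<bullet> (y - z)) *\<^sub>R N z) / norm (y - z)) \<longlongrightarrow> 0) (at z)"
    proof (rule Lim_null_comparison)
      show "((\<lambda>y. norm ((s y - s z) - N z \<bullet> (y - z)) / norm (y - z) + norm (N y - N z)) \<longlongrightarrow> 0) (at z)"
        using tendsto_add[OF ds dN] by simp
      show "eventually (\<lambda>y. norm (norm (s y *\<^sub>R N y - s z *\<^sub>R N z - (N z \<bullet> (y - z)) *\<^sub>R N z) / norm (y - z))
          \<le> norm ((s y - s z) - N z \<bullet> (y - z)) / norm (y - z) + norm (N y - N z)) (at z)"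
        using eventually_tube[OF z'] unfolding eventually_at_filter
      proof eventually_elim
        case (elim y)
        show ?case
        proof (intro impI)
          assume "y \<noteq> z"
          then have n: "norm (y - z) > 0" by simp
          \<comment> \<open>The first summand is the linearisation error of \<open>s\<close> times a
            unit vector. The second is at most \<open>norm (y - z)\<close> times a quantity tending
            to 0.\<close>
          have "s y *\<^sub>R N y - s z *\<^sub>R N z - (N z \<bullet> (y - z)) *\<^sub>R N z
            = (s y - s z - N z \<bullet> (y - z)) *\<^sub>R N y + (N z \<bullet> (y - z)) *\<^sub>R (N y - N z)"
            using z by (simp add: algebra_simps)
          then have "norm (s y *\<^sub>R N y - s z *\<^sub>R N z - (N z \<bullet> (y - z)) *\<^sub>R N z)
            \<le> norm (s y - s z - N z \<bullet> (y - z)) * norm (N y) + \<bar>N z \<bullet> (y - z)\<bar> * norm (N y - N z)"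
            by (metis norm_triangle_ineq norm_scaleR real_norm_def)
          also have "\<dots> \<le> norm (s y - s z - N z \<bullet> (y - z)) + norm (y - z) * norm (N y - N z)"
            using Cauchy_Schwarz_ineq2[of "N z" "y - z"] unit[OF z'] unit[OF elim]
            by (simp add: mult_right_mono)
          finally show "norm (norm (s y *\<^sub>R N y - s z *\<^sub>R N z - (N z \<bullet> (y - z)) *\<^sub>R N z) / norm (y - z))
          \<le> norm ((s y - s z) - N z \<bullet> (y - z)) / norm (y - z) + norm (N y - N z)"
            using n by (simp add: field_simps)
        qed
      qed
    qed
  qed
  then show ?thesis unfolding foot_def by (intro has_derivative_diff has_derivative_ident)
qed

text \<open>Taken as a bounded operator, so that continuity of the derivative of \<open>N\<close> is
  continuity in operator norm.\<close>

definition J :: "'a \<Rightarrow> 'a \<Rightarrow>\<^sub>L 'a" where "J x = Blinfun (frechet_derivative N (at x))"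

lemma J_works: "N differentiable (at x) \<Longrightarrow> (N has_derivative J x) (at x)"
  unfolding J_def
  by (metis bounded_linear_Blinfun_apply frechet_derivative_works has_derivative_bounded_linear)

lemma J_eqI: "(N has_derivative blinfun_apply A) (at x) \<Longrightarrow> J x = A"
  unfolding J_def by (metis blinfun_apply_inverse frechet_derivative_at)

text \<open>Near \<open>z\<close>, \<open>N\<close> is \<open>G\<close> composed with
  \<open>foot\<close>, up to a sign that is constant by continuity. The chain rule at
  \<open>z\<close> precomposes \<open>G'\<close> with the projection along
  \<open>N z\<close>.\<close>

lemma N_derivative_at_zero:
  assumes z: "s z = 0" and \<rho>: "\<rho> > 0" and U: "open U" "z \<in> U"
    and G: "(G has_derivative blinfun_apply G') (at z)"
    and NG: "\<And>y. y \<in> U \<Longrightarrow> s y = 0 \<Longrightarrow> N y = G y \<or> N y = - G y"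
  shows "(N has_derivative blinfun_apply
    ((N z \<bullet> G z) *\<^sub>R (G' o\<^sub>L (id_blinfun - (blinfun_scaleR_left (N z) o\<^sub>L blinfun_inner_left (N z)))))) (at z)"
proof -
  define \<epsilon> where "\<epsilon> = N z \<bullet> G z"
  have z': "\<bar>s z\<bar> < \<rho>" using z \<rho> by simp
  have fz: "foot z = z" using z by (simp add: foot_def)
  have NG1: "(N y = G y \<or> N y = - G y) \<and> G y \<bullet> G y = 1" if "y \<in> U" "s y = 0" for y
    using NG[OF that] unit[of y] that \<rho> by (auto simp: dot_square_norm)
  then have \<epsilon>: "\<epsilon> = 1 \<or> \<epsilon> = -1" using z U by (force simp: \<epsilon>_def)
  have "isCont (\<lambda>y. N y \<bullet> G (foot y)) z"
  proof (rule isCont_inner[OF isCont_N[OF z'] isCont_o2[OF isCont_foot[OF z']]])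
    show "isCont G (foot z)" using has_derivative_continuous[OF G] fz by simp
  qed
  then have "((\<lambda>y. N y \<bullet> G (foot y)) \<longlongrightarrow> \<epsilon>) (at z)" by (simp add: isCont_def \<epsilon>_def fz)
  \<comment> \<open>Near \<open>z\<close> this inner product can only be 1 or -1, so distance below
    1 from \<epsilon> pins it down.\<close>
  then have "eventually (\<lambda>y. dist (N y \<bullet> G (foot y)) \<epsilon> < 1) (at z)" by (rule tendstoD) simp
  moreover have "eventually (\<lambda>y. foot y \<in> U) (at z)"
    using isCont_foot[OF z'] U unfolding isCont_def fz by (rule topological_tendstoD)
  moreover have "eventually (\<lambda>y. \<bar>s y\<bar> < \<rho>) (at z)"
    using eventually_tube[OF z'] by (auto simp: eventually_at_filter elim: eventually_mono)
  ultimately have ev: "eventually (\<lambda>y. \<epsilon> *\<^sub>R G (foot y) = N y) (at z)"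
  proof eventually_elim
    case (elim y)
    have "N y = G (foot y) \<or> N y = - G (foot y)" "G (foot y) \<bullet> G (foot y) = 1"
      using NG1[of "foot y"] foot[of y] elim by auto
    then show ?case using \<epsilon> elim(1) by (auto simp: dist_real_def)
  qed
  have "((\<lambda>y. \<epsilon> *\<^sub>R G (foot y)) has_derivative (\<lambda>h. \<epsilon> *\<^sub>R G' (h - (N z \<bullet> h) *\<^sub>R N z))) (at z)"
    using G fz by (intro has_derivative_scaleR_right has_derivative_compose[OF has_derivative_foot[OF z \<rho>], where g = G]) simp
  then have "(N has_derivative (\<lambda>h. \<epsilon> *\<^sub>R G' (h - (N z \<bullet> h) *\<^sub>R N z))) (at z)"
  proof (rule has_derivative_transform_eventually[OF _ ev])
    show "\<epsilon> *\<^sub>R G (foot z) = N z" using NG1[of z] z U fz by (auto simp: \<epsilon>_def)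
  qed simp
  moreover have "blinfun_apply (\<epsilon> *\<^sub>R (G' o\<^sub>L (id_blinfun - (blinfun_scaleR_left (N z) o\<^sub>L blinfun_inner_left (N z)))))
      = (\<lambda>h. \<epsilon> *\<^sub>R G' (h - (N z \<bullet> h) *\<^sub>R N z))"
    by (auto simp: blinfun.bilinear_simps inner_commute)
  ultimately show ?thesis by (simp add: \<epsilon>_def)
qed

end

section \<open>Differentiability of the normal field on the whole tube\<close>

text \<open>\<open>G\<close> is compared with \<open>N\<close> on the zero set only, and the sign
  may vary from point to point. This is what the normalised gradient of a local C^2 equation
  provides without any choice of orientation.\<close>

locale eikonal_C2 = eikonal_foot +
  assumes zero_set_C2: "s z = 0 \<Longrightarrow> \<exists>U G G'. open U \<and> z \<in> U \<and>
    (\<forall>y\<in>U. (G has_derivative blinfun_apply (G' y)) (at y)) \<and> continuous_on U G' \<and>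
    (\<forall>y\<in>U. s y = 0 \<longrightarrow> N y = G y \<or> N y = - G y)"
begin

lemma N_has_derivative_zero:
  assumes z: "s z = 0" and \<rho>: "\<rho> > 0"
  shows "(N has_derivative J z) (at z)"
proof -
  obtain U G G' where U: "open U" "z \<in> U"
    and G: "\<And>y. y \<in> U \<Longrightarrow> (G has_derivative blinfun_apply (G' y)) (at y)"
    and NG: "\<And>y. y \<in> U \<Longrightarrow> s y = 0 \<Longrightarrow> N y = G y \<or> N y = - G y"
    using zero_set_C2[OF z] by blast
  have "N differentiable (at z)"
    using N_derivative_at_zero[OF z \<rho> U G[OF U(2)] NG] unfolding differentiable_def by blast
  then show ?thesis by (rule J_works)
qed

text \<open>\<open>N_derivative_at_zero\<close> gives a formula for \<open>J\<close> at foot points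
  in terms of \<open>N\<close>, \<open>G\<close> and \<open>G'\<close>, all of which are continuous
  when evaluated there.\<close>

lemma isCont_J_foot:
  assumes x: "\<bar>s x\<bar> < \<rho>"
  shows "isCont (\<lambda>y. J (foot y)) x"
proof -
  have \<rho>: "\<rho> > 0" using x by linarith
  obtain U G G' where U: "open U" "foot x \<in> U"
    and G: "\<And>y. y \<in> U \<Longrightarrow> (G has_derivative blinfun_apply (G' y)) (at y)"
    and G': "continuous_on U G'"
    and NG: "\<And>y. y \<in> U \<Longrightarrow> s y = 0 \<Longrightarrow> N y = G y \<or> N y = - G y"
    using zero_set_C2[OF foot(1)[OF x]] by blast
  let ?F = "\<lambda>y. (N y \<bullet> G (foot y)) *\<^sub>R (G' (foot y) o\<^sub>L
    (id_blinfun - (blinfun_scaleR_left (N y) o\<^sub>L blinfun_inner_left (N y))))"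
  have eq: "J (foot y) = ?F y" if "\<bar>s y\<bar> < \<rho>" "foot y \<in> U" for y
    using J_eqI[OF N_derivative_at_zero[OF foot(1)[OF that(1)] \<rho> U(1) that(2) G[OF that(2)] NG]]
      foot(2)[OF that(1)] by simp
  have "isCont (\<lambda>y. G (foot y)) x"
    by (intro isCont_o2[OF isCont_foot[OF x]] has_derivative_continuous[OF G[OF U(2)]])
  moreover have "isCont (\<lambda>y. G' (foot y)) x"
    using G' U by (intro isCont_o2[OF isCont_foot[OF x]]) (simp add: continuous_on_eq_continuous_at)
  moreover have "isCont (\<lambda>y. blinfun_scaleR_left (N y)) x" "isCont (\<lambda>y. blinfun_inner_left (N y)) x"
    using isCont_N[OF x] by (auto intro!: continuous_intros
        bounded_linear.continuous[OF bounded_linear_blinfun_scaleR_left]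
        bounded_linear.continuous[OF bounded_linear_blinfun_inner_left])
  ultimately have "(?F \<longlongrightarrow> ?F x) (at x)"
    using isCont_N[OF x] unfolding isCont_def by (intro tendsto_intros)
  moreover have "eventually (\<lambda>y. ?F y = J (foot y)) (at x)"
  proof -
    have "eventually (\<lambda>y. foot y \<in> U) (at x)"
      using isCont_foot[OF x] U unfolding isCont_def by (rule topological_tendstoD)
    moreover have "eventually (\<lambda>y. \<bar>s y\<bar> < \<rho>) (at x)"
      using eventually_tube[OF x] by (auto simp: eventually_at_filter elim: eventually_mono)
    ultimately show ?thesis by eventually_elim (simp add: eq)
  qed
  ultimately have "((\<lambda>y. J (foot y)) \<longlongrightarrow> ?F x) (at x)" by (rule Lim_transform_eventually)
  then show ?thesis using eq[OF x U(2)] by (simp add: isCont_def)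
qed

text \<open>The kernel is trivial because \<open>y \<mapsto> y + t N y\<close>, with \<open>t = s x\<close>, has a Lipschitz inverse near the foot
  point: \<open>N\<close> is constant along normals and Lipschitz near \<open>x\<close>.\<close>

lemma J_foot_injective:
  assumes x: "\<bar>s x\<bar> < \<rho>" and w: "w + s x *\<^sub>R J (foot x) w = 0"
  shows "w = 0"
proof -
  define z where "z = foot x"
  define t where "t = s x"
  define X where "X y = y + t *\<^sub>R N y" for y
  have \<rho>: "\<rho> > 0" using x by linarith
  have z: "s z = 0" "N z = N x" "\<bar>s z\<bar> < \<rho> - \<bar>t\<bar>" using foot[OF x] x by (auto simp: z_def t_def)
  then have z': "\<bar>s z\<bar> < \<rho>" using \<rho> by simp
  have Xz: "X z = x" using z(2) by (simp add: X_def z_def foot_def t_def)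
  have D: "(N has_derivative J z) (at z)" by (rule N_has_derivative_zero[OF z(1) \<rho>])
  then have DX: "(X has_derivative (\<lambda>w. w + t *\<^sub>R J z w)) (at z)"
    unfolding X_def by (intro has_derivative_add has_derivative_ident has_derivative_scaleR_right)
  obtain e where e: "e > 0" "\<And>y y'. dist x y < e \<Longrightarrow> dist x y' < e \<Longrightarrow> norm (N y - N y') \<le> dist y y' / e"
    using N_lipschitz_near[OF x] by metis
  have "isCont X z" by (rule has_derivative_continuous[OF DX])
  then have "filterlim X (nhds x) (nhds z)" using Xz by (simp add: isCont_def tendsto_nhds_iff)
  then have "eventually (\<lambda>y. X y \<in> ball x e) (nhds z)"
    using e(1) by (intro topological_tendstoD) auto
  then have "eventually (\<lambda>y. norm (N y - N z) \<le> (1 / e) * norm (X y - X z)) (nhds z)"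
    using eventually_tube[OF z(3)]
  proof eventually_elim
    case (elim y)
    have "N (X y) = N y" unfolding X_def using elim by (intro advance(2)) simp
    then show ?case using e(2)[of "X y" x] elim e(1) Xz z(2) by (simp add: dist_norm)
  qed
  \<comment> \<open>The derivative of \<open>X\<close> at \<open>z\<close> kills \<open>w\<close>,
    so the comparison leaves \<open>norm (J z w) \<le> 0\<close>.\<close>
  from derivative_norm_le[OF D DX this, of w] w
  have "J z w = 0" by (simp add: z_def t_def)
  then show ?thesis using w by (simp add: z_def)
qed

lemma foot_inverse:
  assumes x: "\<bar>s x\<bar> < \<rho>"
  obtains M' where "bounded_linear M'" "\<And>w. M' (w + s x *\<^sub>R J (foot x) w) = w"
    "\<And>w. M' w + s x *\<^sub>R J (foot x) (M' w) = w"
proof -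
  define M where "M w = w + s x *\<^sub>R J (foot x) w" for w
  have M: "linear M"
    by (rule linearI) (simp_all add: M_def blinfun.bilinear_simps algebra_simps)
  have "inj M" unfolding linear_injective_0[OF M] M_def using J_foot_injective[OF x] by blast
  then obtain M' where M': "linear M'" "M' \<circ> M = id" using linear_injective_left_inverse[OF M] by blast
  then have "M \<circ> M' = id" using linear_inverse_left[OF M M'(1)] by blast
  then have "M' (M w) = w" "M (M' w) = w" for w using M'(2) by (auto simp: fun_eq_iff)
  then show thesis using M'(1) by (intro that[of M']) (auto simp: M_def linear_conv_bounded_linear)
qed

text \<open>With \<open>t = s x\<close> frozen, \<open>N = N \<circ> Y\<close> near \<open>x\<close>
  and \<open>Y x\<close> is the foot, where \<open>N\<close> is already differentiable.
  \<open>Y\<close> is a continuous local right inverse of \<open>X\<close>, whose derivative at the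
  foot is invertible. Differentiability of \<open>X\<close> at this single point suffices for that
  of \<open>Y\<close>; a version for C^1 maps could not be applied at this stage.\<close>

lemma N_has_derivative:
  assumes x: "\<bar>s x\<bar> < \<rho>"
  shows "(N has_derivative J x) (at x)"
proof -
  define z where "z = foot x"
  define t where "t = s x"
  define X where "X y = y + t *\<^sub>R N y" for y
  define Y where "Y y = y - t *\<^sub>R N y" for y
  have \<rho>: "\<rho> > 0" using x by linarith
  have z: "s z = 0" using foot[OF x] by (auto simp: z_def)
  have Yx: "Y x = z" by (simp add: Y_def z_def foot_def t_def)
  have D: "(N has_derivative J z) (at z)" by (rule N_has_derivative_zero[OF z \<rho>])
  then have DX: "(X has_derivative (\<lambda>w. w + t *\<^sub>R J z w)) (at (Y x))"
    unfolding X_def Yx by (intro has_derivative_add has_derivative_ident has_derivative_scaleR_right)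
  obtain M' where M': "bounded_linear M'" "\<And>w. M' (w + t *\<^sub>R J z w) = w"
    using foot_inverse[OF x] unfolding z_def t_def by metis
  define T where "T = {y. \<bar>s y\<bar> < \<rho>} \<inter> {y. \<bar>s y - t\<bar> < \<rho>}"
  have T: "open T" unfolding T_def
    by (intro open_Int open_Collect_less continuous_intros continuous_s)
  have xT: "x \<in> T" using x \<rho> by (simp add: T_def t_def)
  have NY: "N (Y y) = N y" if "y \<in> T" for y
    using N_along_normal[of y t] that by (simp add: Y_def T_def)
  have DY: "(Y has_derivative M') (at x)"
  proof (rule has_derivative_inverse_basic[of X _ Y x M' T, OF DX M'(1) _ _ T xT])
    show "M' \<circ> (\<lambda>w. w + t *\<^sub>R J z w) = id" using M'(2) by auto
    show "continuous (at x) Y" unfolding Y_def by (intro continuous_intros isCont_N x)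
    show "X (Y y) = y" if "y \<in> T" for y using NY[OF that] by (simp add: X_def) (simp add: Y_def)
  qed
  have "((\<lambda>y. N (Y y)) has_derivative (\<lambda>h. J z (M' h))) (at x)"
    using D Yx by (intro has_derivative_compose[OF DY, where g = N]) simp
  then have "(N has_derivative (\<lambda>h. J z (M' h))) (at x)"
    by (rule has_derivative_transform_within_open[OF _ T xT NY])
  then have "N differentiable (at x)" unfolding differentiable_def by blast
  then show ?thesis by (rule J_works)
qed

text \<open>The identity \<open>N (y + t *\<^sub>R N y) = N y\<close>, differentiated at the foot.
  It is the classical law by which the shape operator changes along parallel hypersurfaces, and it
  determines \<open>J x\<close> from \<open>J (foot x)\<close>.\<close>

lemma J_foot:
  assumes x: "\<bar>s x\<bar> < \<rho>"
  shows "J x o\<^sub>L (id_blinfun + s x *\<^sub>R J (foot x)) = J (foot x)"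
proof (rule blinfun_eqI)
  fix w
  define z where "z = foot x"
  define t where "t = s x"
  define X where "X y = y + t *\<^sub>R N y" for y
  have \<rho>: "\<rho> > 0" using x by linarith
  have z: "s z = 0" "N z = N x" "\<bar>s z\<bar> < \<rho> - \<bar>t\<bar>" using foot[OF x] x by (auto simp: z_def t_def)
  have D: "(N has_derivative J z) (at z)" by (rule N_has_derivative_zero[OF z(1) \<rho>])
  have Xz: "X z = x" using z(2) by (simp add: X_def z_def foot_def t_def)
  have DX: "(X has_derivative (\<lambda>w. w + t *\<^sub>R J z w)) (at z)"
    unfolding X_def using D by (intro has_derivative_add has_derivative_ident has_derivative_scaleR_right)
  have "((\<lambda>y. N (X y)) has_derivative (\<lambda>w. J x (w + t *\<^sub>R J z w))) (at z)"
    using N_has_derivative[OF x] Xz by (intro has_derivative_compose[OF DX, where g = N]) simp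
  moreover have "eventually (\<lambda>y. N (X y) = N y) (nhds z)"
    using eventually_tube[OF z(3)] by eventually_elim (simp add: X_def advance(2))
  then have "eventually (\<lambda>y. N (X y) = N y) (at z)" "N (X z) = N z"
    by (auto simp: eventually_at_filter elim: eventually_mono dest: eventually_nhds_x_imp_x)
  ultimately have "(N has_derivative (\<lambda>w. J x (w + t *\<^sub>R J z w))) (at z)"
    by (rule has_derivative_transform_eventually) simp
  from has_derivative_unique[OF D this]
  have "J z w = J x (w + t *\<^sub>R J z w)" by (rule fun_cong)
  then show "blinfun_apply (J x o\<^sub>L (id_blinfun + s x *\<^sub>R J (foot x))) w = blinfun_apply (J (foot x)) w"
    by (simp add: blinfun.bilinear_simps z_def t_def)
qed

lemma norm_J_le:
  assumes x: "\<bar>s x\<bar> < \<rho>"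
  shows "norm (J x) \<le> 1 / (\<rho> - \<bar>s x\<bar>)"
proof (rule norm_blinfun_bound)
  show "norm (J x w) \<le> 1 / (\<rho> - \<bar>s x\<bar>) * norm w" for w
    using derivative_N_bound[OF x N_has_derivative[OF x], of w] by simp
qed (use x in simp)

lemma isCont_J:
  assumes x: "\<bar>s x\<bar> < \<rho>"
  shows "isCont J x"
proof -
  define M where "M y = id_blinfun + s y *\<^sub>R J (foot y)" for y
  obtain M0 where M0: "bounded_linear M0" "\<And>w. M0 w + s x *\<^sub>R J (foot x) (M0 w) = w"
    by (rule foot_inverse[OF x]) blast
  define M' where "M' = Blinfun M0"
  have inv: "M x o\<^sub>L M' = id_blinfun"
    using M0 by (intro blinfun_eqI) (simp add: M_def M'_def bounded_linear_Blinfun_apply blinfun.bilinear_simps)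
  have isCont_s: "isCont s x" using continuous_s[of UNIV] by (simp add: continuous_on_eq_continuous_at)
  have contM: "isCont M x"
    unfolding M_def by (intro continuous_intros isCont_J_foot[OF x] isCont_s)
  \<comment> \<open>Only the fixed inverse of \<open>M x\<close> appears, so continuity of operator
    inversion is avoided; the factor \<open>J y\<close> is controlled by
    \<open>norm_J_le\<close>.\<close>
  have diff: "J y - J x = ((J y o\<^sub>L (M x - M y)) + (J (foot y) - J (foot x))) o\<^sub>L M'"
    if "\<bar>s y\<bar> < \<rho>" for y
  proof -
    have "((J y o\<^sub>L (M x - M y)) + (J (foot y) - J (foot x))) = (J y - J x) o\<^sub>L M x"
      using J_foot[OF that] J_foot[OF x]
      by (simp add: M_def[symmetric] bounded_bilinear.diff_left[OF bounded_bilinear_blinfun_compose]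
          bounded_bilinear.diff_right[OF bounded_bilinear_blinfun_compose])
    then show ?thesis using inv
      by (intro blinfun_eqI) (metis blinfun_apply_blinfun_compose blinfun_apply_id_blinfun id_apply)
  qed
  define e where "e = (\<rho> - \<bar>s x\<bar>) / 2"
  have e: "e > 0" using x by (simp add: e_def)
  have "\<bar>s x\<bar> < \<rho> - e" using e by (simp add: e_def field_simps)
  from eventually_tube[OF this]
  have near: "eventually (\<lambda>y. \<bar>s y\<bar> < \<rho> - e) (at x)"
    by (auto simp: eventually_at_filter elim: eventually_mono)
  have "((\<lambda>y. J y - J x) \<longlongrightarrow> 0) (at x)"
  proof (rule Lim_null_comparison)
    show "((\<lambda>y. (1 / e * norm (M x - M y) + norm (J (foot y) - J (foot x))) * norm M') \<longlongrightarrow> 0) (at x)"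
      using contM isCont_J_foot[OF x] e unfolding isCont_def by (auto intro!: tendsto_eq_intros)
    show "eventually (\<lambda>y. norm (J y - J x)
        \<le> (1 / e * norm (M x - M y) + norm (J (foot y) - J (foot x))) * norm M') (at x)"
      using near
    proof eventually_elim
      case (elim y)
      then have y: "\<bar>s y\<bar> < \<rho>" using e by simp
      have "norm (J y) \<le> 1 / (\<rho> - \<bar>s y\<bar>)" by (rule norm_J_le[OF y])
      also have "\<dots> \<le> 1 / e" using elim e by (intro divide_left_mono) auto
      finally have Jy: "norm (J y) \<le> 1 / e" .
      have "norm ((J y o\<^sub>L (M x - M y)) + (J (foot y) - J (foot x)))
          \<le> norm (J y o\<^sub>L (M x - M y)) + norm (J (foot y) - J (foot x))"
        by (rule norm_triangle_ineq)
      also have "norm (J y o\<^sub>L (M x - M y)) \<le> norm (J y) * norm (M x - M y)"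
        by (rule norm_blinfun_compose)
      also have "\<dots> \<le> 1 / e * norm (M x - M y)" using Jy by (intro mult_right_mono) auto
      finally have "norm ((J y o\<^sub>L (M x - M y)) + (J (foot y) - J (foot x)))
          \<le> 1 / e * norm (M x - M y) + norm (J (foot y) - J (foot x))" by simp
      then show ?case unfolding diff[OF y]
        by (intro order_trans[OF norm_blinfun_compose] mult_right_mono) auto
    qed
  qed
  then show ?thesis by (simp add: isCont_def LIM_zero_iff)
qed

end

section \<open>The signed distance\<close>

text \<open>Normality is read off from the distance function, so that uniqueness up to sign and the fact
  that nearest-point segments are normal need no tangent spaces.\<close>

definition unit_normal :: "'a::euclidean_space set \<Rightarrow> 'a \<Rightarrow> 'a \<Rightarrow> bool" where
  "unit_normal Z z \<nu> \<longleftrightarrow> norm \<nu> = 1 \<and>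
     (\<forall>\<eta>>0. \<exists>\<delta>>0. \<forall>h. norm h < \<delta> \<longrightarrow> \<bar>infdist (z + h) Z - \<bar>\<nu> \<bullet> h\<bar>\<bar> \<le> \<eta> * norm h)"

lemma abs_infdist_diff_le: "\<bar>infdist x A - infdist y A\<bar> \<le> dist x y"
  using infdist_triangle[of x A y] infdist_triangle[of y A x] by (simp add: dist_commute abs_le_iff)

lemma unit_eqI:
  fixes m \<nu> :: "'a::real_inner"
  assumes "norm m = 1" "norm \<nu> = 1" "\<bar>\<nu> \<bullet> m\<bar> = 1"
  shows "m = \<nu> \<or> m = - \<nu>"
proof -
  have 1: "m \<bullet> m = 1" "\<nu> \<bullet> \<nu> = 1" using assms by (simp_all add: dot_square_norm)
  consider "\<nu> \<bullet> m = 1" | "\<nu> \<bullet> m = -1" using assms(3) by linarith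
  then show ?thesis
  proof cases
    case 1
    then have "(m - \<nu>) \<bullet> (m - \<nu>) = 0"
      using \<open>m \<bullet> m = 1\<close> \<open>\<nu> \<bullet> \<nu> = 1\<close> by (simp add: inner_diff_left inner_diff_right inner_commute)
    then show ?thesis by simp
  next
    case 2
    then have "(m + \<nu>) \<bullet> (m + \<nu>) = 0"
      using \<open>m \<bullet> m = 1\<close> \<open>\<nu> \<bullet> \<nu> = 1\<close> by (simp add: inner_add_left inner_add_right inner_commute)
    then show ?thesis by (simp add: eq_neg_iff_add_eq_0)
  qed
qed

text \<open>Along a unit normal the distance to \<open>Z\<close> behaves like
  \<open>t * \<bar>\<nu> \<bullet> m\<bar>\<close> to first order. Growth at unit rate therefore
  forces equality in Cauchy-Schwarz.\<close>

lemma unit_normal_ray: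
  assumes \<nu>: "unit_normal Z z \<nu>" and m: "norm m = 1"
    and ray: "\<And>\<eta>. \<eta> > 0 \<Longrightarrow> \<exists>\<delta>>0. \<forall>t. 0 < t \<and> t < \<delta> \<longrightarrow> infdist (z + t *\<^sub>R m) Z \<ge> t - \<eta> * t"
  shows "m = \<nu> \<or> m = - \<nu>"
proof (rule unit_eqI[OF m])
  show n1: "norm \<nu> = 1" using \<nu> by (simp add: unit_normal_def)
  have "1 - \<bar>\<nu> \<bullet> m\<bar> \<le> \<eta>" if "\<eta> > 0" for \<eta>
  proof -
    have "\<eta> / 2 > 0" using that by simp
    then obtain \<delta> where \<delta>: "\<delta> > 0"
      "\<And>h. norm h < \<delta> \<Longrightarrow> \<bar>infdist (z + h) Z - \<bar>\<nu> \<bullet> h\<bar>\<bar> \<le> \<eta> / 2 * norm h"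
      using \<nu> unfolding unit_normal_def by blast
    obtain \<delta>' where \<delta>': "\<delta>' > 0" "\<And>t. 0 < t \<Longrightarrow> t < \<delta>' \<Longrightarrow> infdist (z + t *\<^sub>R m) Z \<ge> t - \<eta>/2 * t"
      using ray[OF \<open>\<eta>/2 > 0\<close>] by blast
    define t where "t = min \<delta> \<delta>' / 2"
    have t: "0 < t" "t < \<delta>" "t < \<delta>'" using \<delta> \<delta>' by (auto simp: t_def)
    have "infdist (z + t *\<^sub>R m) Z - \<bar>\<nu> \<bullet> (t *\<^sub>R m)\<bar> \<le> \<eta> / 2 * norm (t *\<^sub>R m)"
      using t m by (intro abs_le_D1[OF \<delta>(2)]) simp
    then have "t - \<eta>/2 * t - t * \<bar>\<nu> \<bullet> m\<bar> \<le> \<eta> / 2 * t"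
      using \<delta>'(2)[OF t(1,3)] t m by (simp add: abs_mult)
    then have "t * (1 - \<bar>\<nu> \<bullet> m\<bar>) \<le> t * \<eta>" by (simp add: algebra_simps)
    then show ?thesis using t by simp
  qed
  then have "1 - \<bar>\<nu> \<bullet> m\<bar> \<le> 0" by (rule field_le_epsilon[of _ 0, simplified])
  moreover have "\<bar>\<nu> \<bullet> m\<bar> \<le> 1" using Cauchy_Schwarz_ineq2[of \<nu> m] m n1 by simp
  ultimately show "\<bar>\<nu> \<bullet> m\<bar> = 1" by simp
qed

lemma unit_normal_unique:
  assumes "unit_normal Z z \<nu>" "unit_normal Z z m"
  shows "m = \<nu> \<or> m = - \<nu>"
proof (rule unit_normal_ray[OF assms(1)])
  show m: "norm m = 1" using assms(2) by (simp add: unit_normal_def)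
  fix \<eta> :: real assume "\<eta> > 0"
  then obtain \<delta> where \<delta>: "\<delta> > 0" "\<And>h. norm h < \<delta> \<Longrightarrow> \<bar>infdist (z + h) Z - \<bar>m \<bullet> h\<bar>\<bar> \<le> \<eta> * norm h"
    using assms(2) unfolding unit_normal_def by blast
  show "\<exists>\<delta>>0. \<forall>t. 0 < t \<and> t < \<delta> \<longrightarrow> infdist (z + t *\<^sub>R m) Z \<ge> t - \<eta> * t"
  proof (intro exI[of _ \<delta>] conjI allI impI \<delta>(1))
    fix t assume "0 < t \<and> t < \<delta>"
    then show "infdist (z + t *\<^sub>R m) Z \<ge> t - \<eta> * t"
      using \<delta>(2)[of "t *\<^sub>R m"] m by (simp add: dot_square_norm)
  qed
qed

lemma unit_normal_uminus: "unit_normal Z z \<nu> \<Longrightarrow> unit_normal Z z (- \<nu>)"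
  by (simp add: unit_normal_def)

text \<open>Replaces the implicit function theorem. For the upper bound, the intermediate value
  theorem finds a zero of \<open>g\<close> on the normal line through \<open>z + h\<close>, close to
  the tangent plane. For the lower bound, the nearest point of \<open>Z\<close> is itself a zero of
  \<open>g\<close>, hence close to the tangent plane.\<close>

lemma unit_normal_grad:
  fixes g :: "'a::euclidean_space \<Rightarrow> real"
  assumes Z: "closed Z" "z \<in> Z" and U: "open U" "z \<in> U"
    and g: "continuous_on U g" "Z \<inter> U = {x \<in> U. g x = 0}"
    and dg: "(g has_derivative (\<lambda>h. v \<bullet> h)) (at z)" and v: "v \<noteq> 0"
  shows "unit_normal Z z (v /\<^sub>R norm v)"
  unfolding unit_normal_def
proof (intro conjI allI impI)
  define a where "a = norm v"
  define \<nu> where "\<nu> = v /\<^sub>R norm v"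
  have a: "a > 0" and n1: "norm \<nu> = 1" and v_eq: "v = a *\<^sub>R \<nu>" using v by (simp_all add: a_def \<nu>_def)
  show "norm (v /\<^sub>R norm v) = 1" using v by simp
  have gz: "g z = 0" using Z U g by blast
  fix \<eta>0 :: real assume \<eta>0: "\<eta>0 > 0"
  define \<eta> where "\<eta> = min (\<eta>0 / 2) 1"
  have \<eta>: "\<eta> > 0" "\<eta> \<le> 1" "2 * \<eta> \<le> \<eta>0" using \<eta>0 by (auto simp: \<eta>_def)
  obtain \<delta>1 where \<delta>1: "\<delta>1 > 0"
    \<comment> \<open>The factor 1/4 offsets \<open>norm (\<gamma> r) \<le> 3 * norm h\<close>
      below: the error is at most 3/4 of \<open>a * e\<close>, which decides the sign of
      \<open>g\<close> at both ends.\<close>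
    and gd: "\<And>h. norm h < \<delta>1 \<Longrightarrow> \<bar>g (z + h) - a * (\<nu> \<bullet> h)\<bar> \<le> (a * \<eta> / 4) * norm h"
  proof -
    have "a * \<eta> / 4 > 0" using a \<eta> by simp
    then obtain d where d: "d > 0"
      "\<And>y. norm (y - z) < d \<Longrightarrow> norm (g y - g z - v \<bullet> (y - z)) \<le> (a * \<eta> / 4) * norm (y - z)"
      using dg unfolding has_derivative_at_alt by blast
    show thesis using d(2)[of "z + _"] gz by (intro that[OF d(1)]) (simp add: v_eq)
  qed
  obtain \<delta>2 where \<delta>2: "\<delta>2 > 0" "ball z \<delta>2 \<subseteq> U" using U open_contains_ball by blast
  define \<delta> where "\<delta> = min \<delta>1 \<delta>2 / 4"
  have \<delta>: "\<delta> > 0" "4 * \<delta> \<le> \<delta>1" "4 * \<delta> \<le> \<delta>2" using \<delta>1 \<delta>2 by (auto simp: \<delta>_def)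
  have "\<bar>infdist (z + h) Z - \<bar>\<nu> \<bullet> h\<bar>\<bar> \<le> \<eta>0 * norm h" if h: "norm h < \<delta>" for h
  proof (cases "h = 0")
    case True
    then show ?thesis using Z by simp
  next
    case False
    then have h0: "norm h > 0" by simp
    have \<nu>h: "\<bar>\<nu> \<bullet> h\<bar> \<le> norm h" using Cauchy_Schwarz_ineq2[of \<nu> h] n1 by simp
    have "infdist (z + h) Z - \<bar>\<nu> \<bullet> h\<bar> \<le> \<eta>0 * norm h"
    proof -
      \<comment> \<open>Runs along the normal line through \<open>h\<close>, parametrised by the
        component in direction \<nu>.\<close>
      define \<gamma> where "\<gamma> r = h + (- (\<nu> \<bullet> h) + r) *\<^sub>R \<nu>" for r :: real
      have n\<gamma>: "norm (\<gamma> r) \<le> 3 * norm h" if "\<bar>r\<bar> \<le> \<eta> * norm h" for r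
      proof -
        have "\<eta> * norm h \<le> 1 * norm h" using \<eta> by (intro mult_right_mono) auto
        then have "\<bar>- (\<nu> \<bullet> h) + r\<bar> \<le> 2 * norm h" using that \<nu>h by linarith
        then show ?thesis unfolding \<gamma>_def
          using norm_triangle_ineq[of h "(- (\<nu> \<bullet> h) + r) *\<^sub>R \<nu>"] n1 by simp
      qed
      have \<nu>\<gamma>: "\<nu> \<bullet> \<gamma> r = r" for r
        using n1 by (simp add: \<gamma>_def inner_add_right dot_square_norm)
      have gr: "\<bar>g (z + \<gamma> r) - a * r\<bar> \<le> (a * \<eta> / 4) * (3 * norm h)" if "\<bar>r\<bar> \<le> \<eta> * norm h" for r
      proof -
        have "norm (\<gamma> r) < \<delta>1" using n\<gamma>[OF that] h \<delta> h0 by linarith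
        then have "\<bar>g (z + \<gamma> r) - a * r\<bar> \<le> (a * \<eta> / 4) * norm (\<gamma> r)"
          using gd[of "\<gamma> r"] by (simp add: \<nu>\<gamma>)
        also have "\<dots> \<le> (a * \<eta> / 4) * (3 * norm h)"
          using n\<gamma>[OF that] a \<eta> by (intro mult_left_mono) auto
        finally show ?thesis .
      qed
      define e where "e = \<eta> * norm h"
      have e: "e > 0" using \<eta> h0 by (simp add: e_def)
      have ae: "(a * \<eta> / 4) * (3 * norm h) = (3/4) * (a * e)" "a * e > 0"
        using a e by (simp_all add: e_def)
      have inU: "z + \<gamma> r \<in> U" if "\<bar>r\<bar> \<le> e" for r
      proof -
        have "norm (\<gamma> r) < \<delta>2"
          using n\<gamma>[of r] that h \<delta> h0 unfolding e_def by linarith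
        then show ?thesis using \<delta>2(2) by (auto simp: dist_norm subset_iff)
      qed
      have "g (z + \<gamma> (- e)) \<le> 0" "0 \<le> g (z + \<gamma> e)"
      proof -
        have "\<bar>g (z + \<gamma> e) - a * e\<bar> \<le> (3/4) * (a * e)"
          using gr[of e] e unfolding ae(1) by (simp add: e_def)
        then show "0 \<le> g (z + \<gamma> e)" using ae(2) by linarith
        have "\<bar>g (z + \<gamma> (- e)) - a * (- e)\<bar> \<le> (3/4) * (a * e)"
          using gr[of "- e"] e unfolding ae(1) by (simp add: e_def)
        then have "\<bar>g (z + \<gamma> (- e)) + a * e\<bar> \<le> (3/4) * (a * e)" by simp
        then show "g (z + \<gamma> (- e)) \<le> 0" using ae(2) by linarith
      qed
      moreover have "continuous_on {- e..e} (\<lambda>r. g (z + \<gamma> r))"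
        by (rule continuous_on_compose2[OF g(1)]) (use inU in \<open>auto simp: \<gamma>_def intro!: continuous_intros\<close>)
      ultimately obtain r where r: "- e \<le> r" "r \<le> e" "g (z + \<gamma> r) = 0"
        using IVT'[of "\<lambda>r. g (z + \<gamma> r)" "- e" 0 e] e by auto
      moreover have "z + \<gamma> r \<in> U" using r by (intro inU) simp
      ultimately have "z + \<gamma> r \<in> Z" using g(2) by blast
      then have "infdist (z + h) Z \<le> dist (z + h) (z + \<gamma> r)" by (rule infdist_le)
      also have "\<dots> = \<bar>- (\<nu> \<bullet> h) + r\<bar>" using n1 by (simp add: \<gamma>_def dist_norm)
      also have "\<dots> \<le> \<bar>\<nu> \<bullet> h\<bar> + e" using r by linarith
      also have "e \<le> \<eta>0 * norm h"
        using \<eta> unfolding e_def by (intro mult_right_mono) auto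
      finally show ?thesis by simp
    qed
    moreover have "\<bar>\<nu> \<bullet> h\<bar> - infdist (z + h) Z \<le> \<eta>0 * norm h"
    proof -
      obtain p where p: "p \<in> Z" "infdist (z + h) Z = dist (z + h) p"
        using infdist_attains_inf[OF Z(1)] Z(2) by blast
      have "dist (z + h) p \<le> norm h"
        using infdist_le[OF Z(2), of "z + h"] p by (simp add: dist_norm)
      then have pz: "norm (p - z) \<le> 2 * norm h"
        using dist_triangle[of p z "z + h"] by (simp add: dist_norm dist_commute norm_minus_commute)
      then have "norm (p - z) < \<delta>1" "norm (p - z) < \<delta>2" using h \<delta> h0 by linarith+
      then have "p \<in> U" using \<delta>2 by (auto simp: dist_norm norm_minus_commute subset_iff)
      then have "g p = 0" using p g(2) by blast
      then have "a * \<bar>\<nu> \<bullet> (p - z)\<bar> \<le> (a * \<eta> / 4) * norm (p - z)"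
        using gd[of "p - z"] \<open>norm (p - z) < \<delta>1\<close> a by (simp add: abs_mult)
      also have "\<dots> \<le> (a * \<eta> / 4) * (2 * norm h)"
        using pz a \<eta> by (intro mult_left_mono) auto
      finally have "a * \<bar>\<nu> \<bullet> (p - z)\<bar> \<le> a * (\<eta> / 2 * norm h)" by (simp add: field_simps)
      then have "\<bar>\<nu> \<bullet> (p - z)\<bar> \<le> \<eta> / 2 * norm h" using a by simp
      also have "\<dots> \<le> \<eta>0 * norm h" using \<eta> by (intro mult_right_mono) auto
      finally have "\<bar>\<nu> \<bullet> (p - z)\<bar> \<le> \<eta>0 * norm h" .
      moreover have "\<bar>\<nu> \<bullet> (z + h - p)\<bar> \<le> dist (z + h) p"
        using Cauchy_Schwarz_ineq2[of \<nu> "z + h - p"] n1 by (simp add: dist_norm)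
      moreover have "\<nu> \<bullet> h = \<nu> \<bullet> (z + h - p) + \<nu> \<bullet> (p - z)"
        by (simp add: inner_add_right inner_diff_right)
      ultimately show ?thesis using p(2) by linarith
    qed
    ultimately show ?thesis by (simp add: abs_le_iff)
  qed
  then show "\<exists>\<delta>>0. \<forall>h. norm h < \<delta> \<longrightarrow> \<bar>infdist (z + h) Z - \<bar>(v /\<^sub>R norm v) \<bullet> h\<bar>\<bar> \<le> \<eta>0 * norm h"
    using \<delta>(1) unfolding \<nu>_def by blast
qed

section \<open>Construction of the global signed distance\<close>

lemma signed_distance:
  fixes Z :: "'a::euclidean_space set"
  assumes Z: "compact Z" "Z \<noteq> {}" and \<rho>: "\<rho> > 0"
    and uniq: "\<And>x. infdist x Z < \<rho> \<Longrightarrow> \<exists>!z. z \<in> Z \<and> infdist x Z = dist x z"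
    and loc: "\<And>z. z \<in> Z \<Longrightarrow> \<exists>U G. open U \<and> z \<in> U \<and> continuous_on U G \<and> (\<forall>y\<in>Z \<inter> U. unit_normal Z y (G y))"
  shows "\<exists>s N. eikonal s N \<rho> \<and> (\<forall>x. \<bar>s x\<bar> = infdist x Z) \<and> (\<forall>z\<in>Z. unit_normal Z z (N z))"
proof -
  define d where "d x = infdist x Z" for x
  have clZ: "closed Z" using Z by (simp add: compact_imp_closed)
  have d0: "d x \<ge> 0" for x by (simp add: d_def infdist_nonneg)
  have dZ: "d x = 0 \<longleftrightarrow> x \<in> Z" for x
    using in_closed_iff_infdist_zero[OF clZ Z(2)] by (simp add: d_def)
  have dlip: "\<bar>d x - d y\<bar> \<le> dist x y" for x y unfolding d_def by (rule abs_infdist_diff_le)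
  have dle: "d x \<le> dist x z" if "z \<in> Z" for x z using that by (simp add: d_def infdist_le)
  have contd: "continuous_on A d" for A unfolding d_def by (intro continuous_intros)
  have open_d: "open {x. d x < r}" for r by (intro open_Collect_less continuous_intros contd)
  define P where "P x = (THE z. z \<in> Z \<and> d x = dist x z)" for x
  have P: "P x \<in> Z" "d x = dist x (P x)" if "d x < \<rho>" for x
    using theI'[OF uniq[of x]] that unfolding P_def d_def by auto
  have Pu: "z = P x" if "d x < \<rho>" "z \<in> Z" "d x = dist x z" for x z
    using uniq[of x] that P[of x] unfolding d_def by metis
  have PZ: "P z = z" if "z \<in> Z" for z
    using Pu[of z z] that dZ[of z] \<rho> by simp
  have contP: "isCont P x" if x: "d x < \<rho>" for x
  proof -
    define r where "r = (d x + \<rho>) / 2"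
    have r: "d x < r" "r < \<rho>" using x by (auto simp: r_def)
    \<comment> \<open>Uniqueness of nearest points identifies the graph of \<open>P\<close> with a
      closed set; as \<open>P\<close> takes values in the compact set \<open>Z\<close>, this gives
      continuity.\<close>
    have "(\<lambda>x. (x, P x)) ` {x. d x \<le> r} = {w. fst w \<in> {x. d x \<le> r} \<and> snd w \<in> Z \<and> d (fst w) = dist (fst w) (snd w)}"
      using P Pu r by force
    moreover have "closed \<dots>"
    proof -
      have "closed (fst -` {x. d x \<le> r} :: ('a \<times> 'a) set)"
        by (intro closed_vimage_fst closed_Collect_le continuous_intros contd)
      moreover have "closed (snd -` Z :: ('a \<times> 'a) set)" by (intro closed_vimage_snd clZ)
      moreover have "closed {w. d (fst w) = dist (fst w) (snd w)}"
        by (intro closed_Collect_eq continuous_intros continuous_on_compose2[OF contd]) auto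
      moreover have "{w. fst w \<in> {x. d x \<le> r} \<and> snd w \<in> Z \<and> d (fst w) = dist (fst w) (snd w)}
          = fst -` {x. d x \<le> r} \<inter> (snd -` Z \<inter> {w. d (fst w) = dist (fst w) (snd w)})" by auto
      ultimately show ?thesis by (metis closed_Int)
    qed
    ultimately have "continuous_on {x. d x \<le> r} P"
      using P r by (intro continuous_from_closed_graph[OF Z(1)]) auto
    then have "continuous_on {x. d x < r} P" by (rule continuous_on_subset) auto
    then show ?thesis using open_d r by (simp add: continuous_on_eq_continuous_at)
  qed
  have unit_n: "norm \<nu> = 1" if "unit_normal Z z \<nu>" for z \<nu> using that by (simp add: unit_normal_def)
  have normal: "x - P x = ((x - P x) \<bullet> \<nu>) *\<^sub>R \<nu> \<and> \<bar>(x - P x) \<bullet> \<nu>\<bar> = d x"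
    if x: "d x < \<rho>" and \<nu>: "unit_normal Z (P x) \<nu>" for x \<nu>
  proof (cases "d x = 0")
    case True then show ?thesis using dZ PZ by simp
  next
    case False
    then have dx: "d x > 0" using d0[of x] by simp
    define m where "m = (x - P x) /\<^sub>R d x"
    have nx: "norm (x - P x) = d x" using P(2)[OF x] by (simp add: dist_norm)
    then have m: "norm m = 1" "x - P x = d x *\<^sub>R m" using dx by (auto simp: m_def)
    \<comment> \<open>Between \<open>P x\<close> and \<open>x\<close> the distance to
      \<open>Z\<close> grows at unit speed, by the Lipschitz property of \<open>d\<close> seen from
      \<open>x\<close>.\<close>
    have "m = \<nu> \<or> m = - \<nu>"
    proof (rule unit_normal_ray[OF \<nu> m(1)])
      fix \<eta> :: real assume \<eta>: "\<eta> > 0"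
      show "\<exists>\<delta>>0. \<forall>t. 0 < t \<and> t < \<delta> \<longrightarrow> t - \<eta> * t \<le> infdist (P x + t *\<^sub>R m) Z"
      proof (intro exI[of _ "d x"] conjI allI impI dx)
        fix t assume t: "0 < t \<and> t < d x"
        have "x - (P x + t *\<^sub>R m) = (d x - t) *\<^sub>R m" using m(2) by (simp add: algebra_simps)
        then have "dist x (P x + t *\<^sub>R m) = d x - t" using m t by (simp add: dist_norm)
        then have "t \<le> d (P x + t *\<^sub>R m)" using dlip[of x "P x + t *\<^sub>R m"] by linarith
        moreover have "\<eta> * t > 0" using \<eta> t by simp
        ultimately show "t - \<eta> * t \<le> infdist (P x + t *\<^sub>R m) Z" by (simp add: d_def)
      qed
    qed
    then show ?thesis using m(2) unit_n[OF \<nu>] dx by (auto simp: dot_square_norm)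
  qed
  define \<nu>0 where "\<nu>0 z = (SOME \<nu>. unit_normal Z z \<nu>)" for z
  have \<nu>0: "unit_normal Z z (\<nu>0 z)" if "z \<in> Z" for z
    unfolding \<nu>0_def using loc[OF that] that by (metis IntI someI)
  \<comment> \<open>Truncation at \<open>\<rho>/2\<close> makes the pair below equal to
    \<open>(\<rho>/2, 0)\<close> up to sign for distances between \<open>\<rho>/2\<close> and
    \<rho>. It thus continues beyond the tube, where no nearest point need be unique.\<close>
  define clip where "clip t = max (- \<rho>/2) (min (\<rho>/2) t)" for t :: real
  have clip_minus: "clip (- t) = - clip t" for t using \<rho> by (auto simp: clip_def max_def min_def)
  have clip_abs: "\<bar>clip t\<bar> = min \<bar>t\<bar> (\<rho>/2)" for t using \<rho> by (auto simp: clip_def max_def min_def)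
  have clip_id: "clip t = t" if "\<bar>t\<bar> \<le> \<rho>/2" for t using that by (auto simp: clip_def max_def min_def)
  define v where "v \<nu> x = (clip ((x - P x) \<bullet> \<nu>), max 0 (\<rho>/2 - d x) *\<^sub>R \<nu>)" for \<nu> x
  have v_minus: "v (- \<nu>) x = - v \<nu> x" for \<nu> x by (simp add: v_def clip_minus)
  have v_fst: "\<bar>fst (v \<nu> x)\<bar> = min (d x) (\<rho>/2)" if "d x < \<rho>" "unit_normal Z (P x) \<nu>" for \<nu> x
    using normal[OF that] by (simp add: v_def clip_abs)
  \<comment> \<open>The signed distance together with the unit normal: on the tube these are only defined up to
    a common sign, and the second component keeps the pair away from 0 on \<open>Z\<close>.\<close>
  define u0 where "u0 x = (if d x < \<rho> then v (\<nu>0 (P x)) x else (\<rho>/2, 0))" for x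
  have v_u0: "v \<nu> x = u0 x \<or> v \<nu> x = - u0 x" if x: "d x < \<rho>" and \<nu>: "unit_normal Z (P x) \<nu>" for x \<nu>
    using unit_normal_unique[OF \<nu>0[OF P(1)[OF x]] \<nu>] x by (auto simp: u0_def v_minus)
  obtain B where B: "B > 0" "\<And>z. z \<in> Z \<Longrightarrow> norm z \<le> B"
    using compact_imp_bounded[OF Z(1)] bounded_pos by blast
  have "\<exists>u. continuous_on UNIV u \<and> (\<forall>x. u x = u0 x \<or> u x = - u0 x)"
  proof (rule sign_lift)
    show "u0 x \<noteq> 0" for x
    proof (cases "d x < \<rho>")
      case True
      let ?\<nu> = "\<nu>0 (P x)"
      have \<nu>: "unit_normal Z (P x) ?\<nu>" using \<nu>0 P True by blast
      show ?thesis
      proof (cases "d x < \<rho>/2")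
        case True
        then have "snd (u0 x) \<noteq> 0" using unit_n[OF \<nu>] \<open>d x < \<rho>\<close> by (auto simp: v_def u0_def)
        then show ?thesis by auto
      next
        case False
        then have "fst (u0 x) \<noteq> 0" using v_fst[OF True \<nu>] \<rho> \<open>d x < \<rho>\<close> by (auto simp: u0_def)
        then show ?thesis by auto
      qed
    next
      case False
      then have "fst (u0 x) \<noteq> 0" using \<rho> by (simp add: u0_def)
      then show ?thesis by auto
    qed
    show "\<exists>W v. open W \<and> x \<in> W \<and> continuous_on W v \<and> (\<forall>y\<in>W. v y = u0 y \<or> v y = - u0 y)" for x
    proof (cases "d x < \<rho>")
      case True
      then obtain U G where U: "open U" "P x \<in> U" "continuous_on U G"
        and G: "\<And>y. y \<in> Z \<inter> U \<Longrightarrow> unit_normal Z y (G y)"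
        using loc[OF P(1)[OF True]] by blast
      define W where "W = P -` U \<inter> {x. d x < \<rho>}"
      have cP: "continuous_on {x. d x < \<rho>} P"
        using contP by (auto intro: continuous_at_imp_continuous_on)
      have "open W" unfolding W_def using cP U(1) continuous_on_open_vimage[OF open_d] by blast
      moreover have "x \<in> W" using True U by (simp add: W_def)
      moreover have "continuous_on W (\<lambda>y. v (G (P y)) y)"
      proof -
        have 1: "continuous_on W P" by (rule continuous_on_subset[OF cP]) (auto simp: W_def)
        have 2: "continuous_on W (\<lambda>y. G (P y))"
          by (rule continuous_on_compose2[OF U(3) 1]) (auto simp: W_def)
        show ?thesis unfolding v_def clip_def by (intro continuous_intros 1 2 contd)
      qed
      moreover have "v (G (P y)) y = u0 y \<or> v (G (P y)) y = - u0 y" if "y \<in> W" for y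
        using that P G by (intro v_u0) (auto simp: W_def)
      ultimately show ?thesis by blast
    next
      case False
      let ?W = "{x. \<rho>/2 < d x}"
      have "open ?W" by (intro open_Collect_less continuous_intros contd)
      moreover have "(\<rho>/2, 0) = u0 y \<or> (\<rho>/2, 0) = - u0 y" if "y \<in> ?W" for y
      proof (cases "d y < \<rho>")
        case True
        then have "\<bar>fst (u0 y)\<bar> = \<rho>/2" "snd (u0 y) = 0"
          using that v_fst[OF True \<nu>0[OF P(1)]] by (auto simp: u0_def v_def)
        then show ?thesis using \<rho> by (cases "u0 y") auto
      qed (simp add: u0_def)
      ultimately show ?thesis using False \<rho>
        by (intro exI[of _ ?W] exI[of _ "\<lambda>_. (\<rho>/2, 0)"]) auto
    qed
    show "u0 x = (\<rho>/2, 0)" if "norm x \<ge> B + \<rho>" for x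
    proof -
      obtain z where "z \<in> Z" "d x = dist x z"
        using infdist_attains_inf[OF clZ Z(2)] unfolding d_def by metis
      then have "\<rho> \<le> d x"
        using that B(2)[of z] norm_triangle_sub[of x z] by (simp add: dist_norm)
      then show ?thesis by (simp add: u0_def)
    qed
    show "B + \<rho> > 0" using B \<rho> by simp
  qed
  then obtain u where contu: "continuous_on UNIV u" and u: "\<And>x. u x = u0 x \<or> u x = - u0 x" by blast
  have uv: "\<exists>\<nu>. unit_normal Z (P x) \<nu> \<and> u x = v \<nu> x" if x: "d x < \<rho>" for x
    using u[of x] x \<nu>0[OF P(1)[OF x]] unit_normal_uminus[OF \<nu>0[OF P(1)[OF x]]] v_minus
    unfolding u0_def by metis
  have fst_u: "\<bar>fst (u x)\<bar> = min (d x) (\<rho>/2)" for x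
  proof (cases "d x < \<rho>")
    case True then show ?thesis using uv[OF True] v_fst by metis
  next
    case False then show ?thesis using u[of x] \<rho> by (auto simp: u0_def)
  qed
  have fst_u0: "fst (u x) = 0 \<longleftrightarrow> d x = 0" for x
    using \<rho> d0[of x] fst_u[of x] by (auto simp: min_def split: if_splits)
  have cont_fst: "continuous_on A (\<lambda>x. fst (u x))" for A
    using contu by (auto intro!: continuous_intros elim: continuous_on_subset)
  define s where "s x = sgn (fst (u x)) * d x" for x
  have s_abs: "\<bar>s x\<bar> = d x" for x
    using fst_u0[of x] d0[of x] by (auto simp: s_def abs_mult sgn_real_def)
  \<comment> \<open>A change of sign along the segment forces a point \<open>p\<close> of
    \<open>Z\<close> on it, and for points of the segment the triangle inequality is an
    equality.\<close>
  have opposite: "d x + d y \<le> dist x y" if "fst (u x) < 0" "0 < fst (u y)" for x y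
  proof -
    have "connected ((\<lambda>x. fst (u x)) ` closed_segment x y)"
      by (intro connected_continuous_image cont_fst connected_segment)
    then have "0 \<in> (\<lambda>x. fst (u x)) ` closed_segment x y"
      using that by (elim connectedD_interval[of _ "fst (u x)" "fst (u y)"]) auto
    then obtain p where p: "p \<in> closed_segment x y" "d p = 0" using fst_u0 by force
    then have "dist x y = dist x p + dist p y"
      using between_mem_segment[of x y p] by (simp add: between)
    then show ?thesis using p(2) dlip[of x p] dlip[of p y] by linarith
  qed
  have s_lip: "\<bar>s x - s y\<bar> \<le> dist x y" for x y
  proof -
    consider "fst (u x) < 0" "0 < fst (u y)" | "fst (u y) < 0" "0 < fst (u x)"
      | "d x = 0" | "d y = 0" | "sgn (fst (u x)) = sgn (fst (u y))" "fst (u x) \<noteq> 0"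
      using fst_u0 by (metis linorder_neqE_linordered_idom sgn_neg sgn_pos)
    then show ?thesis
    proof cases
      case 1
      then show ?thesis using opposite[of x y] d0[of x] d0[of y] by (simp add: s_def)
    next
      case 2
      then show ?thesis using opposite[of y x] d0[of x] d0[of y] by (simp add: s_def dist_commute)
    next
      case 5
      then have "\<bar>s x - s y\<bar> = \<bar>sgn (fst (u x))\<bar> * \<bar>d x - d y\<bar>"
        by (simp add: s_def right_diff_distrib[symmetric] abs_mult)
      then show ?thesis using dlip[of x y] 5 by (simp add: abs_sgn_eq)
    qed (use s_abs[of x] s_abs[of y] dlip[of x y] in \<open>simp_all add: s_def\<close>)
  qed
  have s_sign: "eventually (\<lambda>y. s y = (s x / d x) * d y) (at x)" if "d x \<noteq> 0" for x
  proof -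
    have "isCont (\<lambda>y. sgn (fst (u y))) x"
      using cont_fst[of UNIV] that fst_u0[of x]
      by (intro continuous_at_within_sgn) (auto simp: continuous_on_eq_continuous_at)
    then have "eventually (\<lambda>y. dist (sgn (fst (u y))) (sgn (fst (u x))) < 1) (at x)"
      unfolding isCont_def by (rule tendstoD) simp
    then show ?thesis
      by eventually_elim
         (use that fst_u0[of x] in \<open>auto simp: s_def sgn_real_def dist_real_def split: if_splits\<close>)
  qed
  \<comment> \<open>Near \<open>Z\<close> the normal is recovered from the second component of
    \<open>u\<close>, continuously across \<open>Z\<close>, where the other quotient would be 0/0.
    Further out that component vanishes and the quotient by \<open>s x\<close> takes over.\<close>
  define N where "N x = (if d x < \<rho>/2 then snd (u x) /\<^sub>R (\<rho>/2 - d x) else (x - P x) /\<^sub>R s x)" for x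
  have N: "unit_normal Z (P x) (N x) \<and> x - P x = s x *\<^sub>R N x" if x: "d x < \<rho>" for x
  proof -
    obtain \<nu> where \<nu>: "unit_normal Z (P x) \<nu>" and ux: "u x = v \<nu> x" using uv[OF x] by blast
    define c where "c = (x - P x) \<bullet> \<nu>"
    have c: "x - P x = c *\<^sub>R \<nu>" "\<bar>c\<bar> = d x" using normal[OF x \<nu>] by (auto simp: c_def)
    show ?thesis
    proof (cases "d x < \<rho>/2")
      case True
      then have "N x = \<nu>" by (simp add: N_def ux v_def)
      moreover have "fst (u x) = c" using clip_id[of c] c(2) True by (simp add: ux v_def c_def)
      then have "s x = c" using c by (auto simp: s_def sgn_mult_abs simp flip: c(2))
      ultimately show ?thesis using \<nu> c by simp
    next
      case False
      then have dx: "d x > 0" using \<rho> by simp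
      then have "s x \<noteq> 0" using s_abs[of x] by auto
      moreover have "N x = (inverse (s x) * c) *\<^sub>R \<nu>" using False by (simp add: N_def c(1))
      moreover have "c = s x \<or> c = - s x" using s_abs[of x] c(2) by linarith
      ultimately show ?thesis using \<nu> c unit_normal_uminus[OF \<nu>] by auto
    qed
  qed
  have N_unit: "norm (N x) = 1" if "d x < \<rho>" for x using N[OF that] unit_n by blast
  have contN: "isCont N z" if "z \<in> Z" for z
  proof -
    have "continuous_on {x. d x < \<rho>/2} (\<lambda>x. snd (u x) /\<^sub>R (\<rho>/2 - d x))"
      by (intro continuous_intros contd continuous_on_subset[OF contu]) auto
    then have "continuous_on {x. d x < \<rho>/2} N"
      by (rule continuous_on_eq) (simp add: N_def)
    moreover have "z \<in> {x. d x < \<rho>/2}" using that dZ[of z] \<rho> by simp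
    ultimately show ?thesis using continuous_on_eq_continuous_at[OF open_d] by blast
  qed
  have der: "(s has_derivative (\<lambda>h. N x \<bullet> h)) (at x)" if x: "d x < \<rho>" for x
  proof (cases "d x = 0")
    case True
    then have xZ: "x \<in> Z" "P x = x" "s x = 0" using dZ PZ by (auto simp: s_def)
    define \<nu> where "\<nu> = N x"
    have \<nu>: "unit_normal Z x \<nu>" using N[OF x] xZ by (simp add: \<nu>_def)
    show ?thesis unfolding has_derivative_at_alt
    proof (intro conjI allI impI)
      show "bounded_linear (\<lambda>h. N x \<bullet> h)" by (rule bounded_linear_inner_right)
      fix \<epsilon> :: real assume \<epsilon>: "\<epsilon> > 0"
      \<comment> \<open>Two thirds of the error come from the deviation of \<open>P y\<close> from
        the tangent plane, one third from the turning of the normal.\<close>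
      define \<eta> where "\<eta> = \<epsilon> / 3"
      have \<eta>: "\<eta> > 0" using \<epsilon> by (simp add: \<eta>_def)
      obtain \<delta>1 where \<delta>1: "\<delta>1 > 0"
        "\<And>h. norm h < \<delta>1 \<Longrightarrow> \<bar>infdist (x + h) Z - \<bar>\<nu> \<bullet> h\<bar>\<bar> \<le> \<eta> * norm h"
        using \<nu> \<eta> unfolding unit_normal_def by blast
      obtain \<delta>2 where \<delta>2: "\<delta>2 > 0" "\<And>y. dist y x < \<delta>2 \<Longrightarrow> dist (N y) \<nu> < \<eta>"
        using contN[OF xZ(1)] \<eta> unfolding continuous_at_eps_delta \<nu>_def by blast
      define \<delta> where "\<delta> = min (min (\<delta>1/2) \<delta>2) \<rho>"
      have \<delta>: "\<delta> > 0" "2 * \<delta> \<le> \<delta>1" "\<delta> \<le> \<delta>2" "\<delta> \<le> \<rho>" using \<delta>1 \<delta>2 \<rho> by (auto simp: \<delta>_def)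
      show "\<exists>\<delta>>0. \<forall>y. norm (y - x) < \<delta> \<longrightarrow> norm (s y - s x - N x \<bullet> (y - x)) \<le> \<epsilon> * norm (y - x)"
      proof (intro exI[of _ \<delta>] conjI allI impI \<delta>(1))
        fix y assume y: "norm (y - x) < \<delta>"
        have dy: "d y \<le> norm (y - x)" using dle[OF xZ(1), of y] by (simp add: dist_norm)
        then have dy\<rho>: "d y < \<rho>" using y \<delta> by linarith
        have py: "norm (P y - x) \<le> 2 * norm (y - x)"
          using dist_triangle[of "P y" x y] P[OF dy\<rho>] dy by (simp add: dist_norm norm_minus_commute)
        then have "\<bar>infdist (x + (P y - x)) Z - \<bar>\<nu> \<bullet> (P y - x)\<bar>\<bar> \<le> \<eta> * norm (P y - x)"
          using y \<delta> by (intro \<delta>1) linarith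
        moreover have "infdist (P y) Z = 0" using P(1)[OF dy\<rho>] by simp
        ultimately have "\<bar>\<nu> \<bullet> (P y - x)\<bar> \<le> \<eta> * norm (P y - x)" by simp
        also have "\<dots> \<le> \<eta> * (2 * norm (y - x))" using py \<eta> by (intro mult_left_mono) auto
        finally have 1: "\<bar>\<nu> \<bullet> (P y - x)\<bar> \<le> 2 * (\<eta> * norm (y - x))" by simp
        have "\<bar>\<nu> \<bullet> (\<nu> - N y)\<bar> \<le> \<eta>"
          using Cauchy_Schwarz_ineq2[of \<nu> "\<nu> - N y"] unit_n[OF \<nu>] \<delta>2(2)[of y] y \<delta>
          by (simp add: dist_norm norm_minus_commute)
        then have "\<bar>s y * (\<nu> \<bullet> (\<nu> - N y))\<bar> \<le> norm (y - x) * \<eta>"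
          unfolding abs_mult using s_abs[of y] dy by (intro mult_mono) auto
        moreover have "s y - \<nu> \<bullet> (y - x) = s y * (\<nu> \<bullet> (\<nu> - N y)) - \<nu> \<bullet> (P y - x)"
        proof -
          have "\<nu> \<bullet> (y - x) = \<nu> \<bullet> (s y *\<^sub>R N y) + \<nu> \<bullet> (P y - x)"
            using N[OF dy\<rho>] by (metis diff_add_cancel inner_add_right add_diff_eq)
          then show ?thesis using unit_n[OF \<nu>] by (simp add: inner_diff_right dot_square_norm algebra_simps)
        qed
        ultimately have "\<bar>s y - \<nu> \<bullet> (y - x)\<bar> \<le> 3 * (\<eta> * norm (y - x))"
          using 1 mult.commute[of "norm (y - x)" \<eta>] by linarith
        then show "norm (s y - s x - N x \<bullet> (y - x)) \<le> \<epsilon> * norm (y - x)"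
          using xZ by (simp add: \<nu>_def \<eta>_def)
      qed
    qed
  next
    case False
    then have dx: "d x > 0" using d0[of x] by simp
    \<comment> \<open>An envelope argument: \<open>P x\<close> as a competitor at \<open>y\<close>
      bounds the increment from above, \<open>P y\<close> as a competitor at \<open>x\<close> bounds
      it from below, and continuity of \<open>P\<close> closes the gap.\<close>
    have "((\<lambda>y. (d y)\<^sup>2) has_derivative (\<lambda>h. 2 * ((x - P x) \<bullet> h))) (at x)"
      unfolding has_derivative_at_alt
    proof (intro conjI allI impI)
      show "bounded_linear (\<lambda>h. 2 * ((x - P x) \<bullet> h))"
        by (intro bounded_linear_const_mult bounded_linear_inner_right)
      fix \<epsilon> :: real assume \<epsilon>: "\<epsilon> > 0"
      then obtain \<delta>2 where \<delta>2: "\<delta>2 > 0" "\<And>y. dist y x < \<delta>2 \<Longrightarrow> dist (P y) (P x) < \<epsilon>/4"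
        using contP[OF x] unfolding continuous_at_eps_delta by (metis divide_pos_pos zero_less_numeral)
      define \<delta> where "\<delta> = min (min \<delta>2 (\<epsilon>/2)) (\<rho> - d x)"
      have \<delta>: "\<delta> > 0" "\<delta> \<le> \<delta>2" "\<delta> \<le> \<epsilon>/2" "\<delta> \<le> \<rho> - d x" using \<delta>2(1) \<epsilon> x by (auto simp: \<delta>_def min_def)
      show "\<exists>\<delta>>0. \<forall>y. norm (y - x) < \<delta> \<longrightarrow>
          norm ((d y)\<^sup>2 - (d x)\<^sup>2 - 2 * ((x - P x) \<bullet> (y - x))) \<le> \<epsilon> * norm (y - x)"
      proof (intro exI[of _ \<delta>] conjI allI impI \<delta>(1))
        fix y assume y: "norm (y - x) < \<delta>"
        have dy: "d y < \<rho>" using dlip[of y x] y \<delta> by (simp add: dist_norm)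
        define h where "h = y - x"
        have yx: "y = x + h" by (simp add: h_def)
        have sq: "(dist y p)\<^sup>2 = (dist x p)\<^sup>2 + 2 * ((x - p) \<bullet> h) + (norm h)\<^sup>2" for p
          unfolding dist_norm yx power2_norm_eq_inner
          by (simp add: inner_add_left inner_add_right inner_diff_left inner_diff_right inner_commute)
        have "(d y)\<^sup>2 \<le> (dist y (P x))\<^sup>2"
          using dle[OF P(1)[OF x], of y] d0 by (intro power_mono) auto
        then have up: "(d y)\<^sup>2 - (d x)\<^sup>2 - 2 * ((x - P x) \<bullet> h) \<le> (norm h)\<^sup>2"
          using sq[of "P x"] P(2)[OF x] by simp
        have "(d x)\<^sup>2 \<le> (dist x (P y))\<^sup>2"
          using dle[OF P(1)[OF dy], of x] d0 by (intro power_mono) auto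
        then have lo: "(d y)\<^sup>2 - (d x)\<^sup>2 - 2 * ((x - P x) \<bullet> h) \<ge> - (2 * ((P y - P x) \<bullet> h))"
          using sq[of "P y"] arg_cong[OF P(2)[OF dy], of "\<lambda>t. t\<^sup>2"] zero_le_power2[of "norm h"]
          unfolding inner_diff_left right_diff_distrib by linarith
        have "\<bar>(P y - P x) \<bullet> h\<bar> \<le> norm (P y - P x) * norm h" by (rule Cauchy_Schwarz_ineq2)
        also have "\<dots> \<le> \<epsilon>/4 * norm h"
          using \<delta>2(2)[of y] y \<delta> by (intro mult_right_mono) (auto simp: dist_norm)
        finally have 1: "2 * \<bar>(P y - P x) \<bullet> h\<bar> \<le> \<epsilon>/2 * norm h" by simp
        have "(norm h)\<^sup>2 \<le> \<epsilon>/2 * norm h"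
          unfolding power2_eq_square using y \<delta> by (intro mult_right_mono) (auto simp: h_def)
        then have "\<bar>(d y)\<^sup>2 - (d x)\<^sup>2 - 2 * ((x - P x) \<bullet> h)\<bar> \<le> \<epsilon>/2 * norm h"
          using up lo 1 by linarith
        also have "\<dots> \<le> \<epsilon> * norm h" using \<epsilon> by (intro mult_right_mono) auto
        finally show "norm ((d y)\<^sup>2 - (d x)\<^sup>2 - 2 * ((x - P x) \<bullet> (y - x))) \<le> \<epsilon> * norm (y - x)"
          by (simp add: h_def)
      qed
    qed
    then have "((\<lambda>y. sqrt ((d y)\<^sup>2)) has_derivative
        (\<lambda>h. 2 * ((x - P x) \<bullet> h) * (inverse (sqrt ((d x)\<^sup>2)) / 2))) (at x)"
      using dx by (intro has_derivative_real_sqrt) auto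
    moreover have "2 * ((x - P x) \<bullet> h) * (inverse (sqrt ((d x)\<^sup>2)) / 2) = (x - P x) \<bullet> h / d x" for h
      using dx by (simp add: inverse_eq_divide)
    ultimately have "((\<lambda>y. sqrt ((d y)\<^sup>2)) has_derivative (\<lambda>h. (x - P x) \<bullet> h / d x)) (at x)"
      by simp
    then have "(d has_derivative (\<lambda>h. (x - P x) \<bullet> h / d x)) (at x)" using d0 by simp
    then have "((\<lambda>y. (s x / d x) * d y) has_derivative (\<lambda>h. (s x / d x) * ((x - P x) \<bullet> h / d x))) (at x)"
      by (rule has_derivative_mult_right)
    moreover have "(s x / d x) * ((x - P x) \<bullet> h / d x) = N x \<bullet> h" for h
    proof -
      have "(s x)\<^sup>2 = (d x)\<^sup>2" by (simp flip: s_abs)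
      then have ss: "s x * s x = d x * d x" by (simp add: power2_eq_square)
      have "(s x / d x) * ((x - P x) \<bullet> h / d x) = (s x * s x) * (N x \<bullet> h) / (d x * d x)"
        using N[OF x] by simp
      also have "\<dots> = N x \<bullet> h" unfolding ss using dx by simp
      finally show ?thesis .
    qed
    ultimately have "((\<lambda>y. (s x / d x) * d y) has_derivative (\<lambda>h. N x \<bullet> h)) (at x)" by simp
    moreover have "eventually (\<lambda>y. (s x / d x) * d y = s y) (at x)" "(s x / d x) * d x = s x"
      using s_sign[OF False] dx by (auto elim!: eventually_mono)
    ultimately show ?thesis by (rule has_derivative_transform_eventually) simp
  qed
  have "eikonal s N \<rho>"
    using s_lip der N_unit by unfold_locales (auto simp: s_abs)
  moreover have "unit_normal Z z (N z)" if "z \<in> Z" for z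
    using N[of z] that dZ[of z] PZ \<rho> by simp
  ultimately show ?thesis using s_abs by (intro exI[of _ s] exI[of _ N]) (auto simp: d_def)
qed

section \<open>The cut-off profile\<close>

text \<open>The \<open>C\<^sup>2\<close> cut-off profile is the odd polynomial with derivative proportional to \<open>(1 - t^4)\<^sup>2\<close> on
  \<open>[-1, 1]\<close>, normalised to reach the values 1 and -1 at the ends.\<close>

definition bump :: "real \<Rightarrow> real" where "bump t = max 0 (1 - t ^ 4)"

definition profile_poly :: "real \<Rightarrow> real" where "profile_poly t = (45 * t - 18 * t ^ 5 + 5 * t ^ 9) / 32"

definition profile :: "real \<Rightarrow> real" where "profile t = (if \<bar>t\<bar> < 1 then profile_poly t else sgn t)"

definition profile' :: "real \<Rightarrow> real" where "profile' t = 45 / 32 * (bump t)\<^sup>2"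

definition profile'' :: "real \<Rightarrow> real" where "profile'' t = - (45 / 4) * t ^ 3 * bump t"

text \<open>Handles the points where two pieces are glued with derivative 0.\<close>

lemma DERIV_zero_squeeze:
  fixes f g :: "real \<Rightarrow> real"
  assumes f: "(f has_real_derivative 0) (at x)"
    and le: "eventually (\<lambda>y. \<bar>g y - g x\<bar> \<le> \<bar>f y - f x\<bar>) (at x)"
  shows "(g has_real_derivative 0) (at x)"
  unfolding has_field_derivative_iff
proof (rule Lim_null_comparison)
  show "((\<lambda>y. \<bar>(f y - f x) / (y - x)\<bar>) \<longlongrightarrow> 0) (at x)"
    using f unfolding has_field_derivative_iff by (rule tendsto_rabs_zero)
  show "eventually (\<lambda>y. norm ((g y - g x) / (y - x)) \<le> \<bar>(f y - f x) / (y - x)\<bar>) (at x)"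
    using le by eventually_elim (simp add: abs_divide divide_right_mono)
qed

lemma DERIV_max_squared: "((\<lambda>u. (max 0 u)\<^sup>2) has_real_derivative 2 * max 0 u) (at (u::real))"
proof -
  consider "u > 0" | "u < 0" | "u = 0" by linarith
  then show ?thesis
  proof cases
    case 1
    have "((\<lambda>u. u\<^sup>2) has_real_derivative 2 * max 0 u) (at u)"
      using 1 by (auto intro!: derivative_eq_intros)
    then show ?thesis
      by (rule has_field_derivative_transform_within_open[of _ _ _ "{0<..}"]) (use 1 in auto)
  next
    case 2
    have "((\<lambda>u. 0) has_real_derivative 2 * max 0 u) (at u)" using 2 by simp
    then show ?thesis
      by (rule has_field_derivative_transform_within_open[of _ _ _ "{..<0}"]) (use 2 in auto)
  next
    case 3
    have "((\<lambda>u::real. u\<^sup>2) has_real_derivative 0) (at 0)" by (auto intro!: derivative_eq_intros)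
    then have "((\<lambda>u::real. (max 0 u)\<^sup>2) has_real_derivative 0) (at 0)"
      by (rule DERIV_zero_squeeze) (auto simp: max_def)
    then show ?thesis using 3 by simp
  qed
qed

lemma DERIV_profile': "(profile' has_real_derivative profile'' t) (at t)"
proof -
  have "((\<lambda>t. 1 - t ^ 4) has_real_derivative - (4 * t ^ 3)) (at t)"
    by (auto intro!: derivative_eq_intros)
  from DERIV_chain2[OF DERIV_max_squared this]
  have "((\<lambda>t. (bump t)\<^sup>2) has_real_derivative 2 * bump t * - (4 * t ^ 3)) (at t)"
    unfolding bump_def .
  from DERIV_cmult[OF this, of "45 / 32"]
  show ?thesis unfolding profile'_def[abs_def] profile''_def by (simp add: mult_ac)
qed

lemma profile_poly_DERIV: "(profile_poly has_real_derivative 45 / 32 * (1 - t ^ 4)\<^sup>2) (at t)"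
  unfolding profile_poly_def[abs_def]
  by (auto intro!: derivative_eq_intros simp: power2_eq_square field_simps eval_nat_numeral)

lemma profile_poly_1: "profile_poly 1 = 1" by (simp add: profile_poly_def)

lemma profile_minus: "profile (- t) = - profile t"
  by (simp add: profile_def profile_poly_def sgn_minus field_simps)

lemma bump_minus: "bump (- t) = bump t"
  by (simp add: bump_def)

lemma bump_nonneg: "0 \<le> bump t" and bump_le_1: "bump t \<le> 1"
  by (simp_all add: bump_def)

lemma bump_eq: "\<bar>t\<bar> \<le> 1 \<Longrightarrow> bump t = 1 - t ^ 4"
  using power_le_one[of "\<bar>t\<bar>" 4] by (simp add: bump_def)

lemma bump_eq_0: "1 \<le> \<bar>t\<bar> \<Longrightarrow> bump t = 0"
  using one_le_power[of "\<bar>t\<bar>" 4] by (simp add: bump_def)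

lemma DERIV_profile: "(profile has_real_derivative profile' t) (at t)"
proof -
  have at_1: "(profile has_real_derivative 0) (at 1)"
  proof (rule DERIV_zero_squeeze)
    show "(profile_poly has_real_derivative 0) (at 1)" using profile_poly_DERIV[of 1] by simp
    have "eventually (\<lambda>y::real. y \<in> {0<..<2}) (at 1)" by (intro eventually_at_in_open') auto
    then show "eventually (\<lambda>y. \<bar>profile y - profile 1\<bar> \<le> \<bar>profile_poly y - profile_poly 1\<bar>) (at 1)"
      by eventually_elim (auto simp: profile_def profile_poly_1)
  qed
  consider "\<bar>t\<bar> < 1" | "\<bar>t\<bar> > 1" | "t = 1" | "t = -1" by linarith
  then show ?thesis
  proof cases
    case 1
    have "(profile_poly has_real_derivative profile' t) (at t)"
      using profile_poly_DERIV[of t] bump_eq[of t] 1 by (simp add: profile'_def)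
    then show ?thesis
      by (rule has_field_derivative_transform_within_open[of _ _ _ "{-1<..<1}"])
         (use 1 in \<open>auto simp: profile_def\<close>)
  next
    case 2
    have "((\<lambda>_. sgn t) has_real_derivative profile' t) (at t)"
      using 2 bump_eq_0[of t] by (simp add: profile'_def)
    then show ?thesis
      by (rule has_field_derivative_transform_within_open[of _ _ _ "if t > 0 then {1<..} else {..<-1}"])
         (use 2 in \<open>auto simp: profile_def sgn_real_def split: if_splits\<close>)
  next
    case 3
    then show ?thesis using at_1 by (simp add: profile'_def bump_eq_0)
  next
    case 4
    have "((\<lambda>t. - profile (- t)) has_real_derivative 0) (at (-1))"
      using at_1 by (auto intro!: derivative_eq_intros DERIV_chain'[where g = profile])
    then show ?thesis using 4 by (simp add: profile_minus profile'_def bump_eq_0)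
  qed
qed

lemma continuous_bump: "continuous_on A bump"
  unfolding bump_def[abs_def] by (intro continuous_intros)

lemma continuous_profile'': "continuous_on A profile''"
  unfolding profile''_def[abs_def] by (intro continuous_intros continuous_bump)

lemma profile_nonneg:
  assumes "0 \<le> t"
  shows "0 \<le> profile t" "profile t \<le> 1"
proof -
  have inc: "profile_poly a \<le> profile_poly b" if "a \<le> b" for a b
    by (rule DERIV_nonneg_imp_nondecreasing[OF that]) (blast intro: profile_poly_DERIV zero_le_power2 mult_nonneg_nonneg divide_nonneg_nonneg zero_le_numeral)
  show "0 \<le> profile t" "profile t \<le> 1"
    using assms inc[of 0 t] inc[of t 1] by (auto simp: profile_def profile_poly_1 sgn_real_def) (simp_all add: profile_poly_def)
qed

lemma profile_squared_le_1: "(profile t)\<^sup>2 \<le> 1"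
proof -
  have "(profile \<bar>t\<bar>)\<^sup>2 \<le> 1" using profile_nonneg[of "\<bar>t\<bar>"] by (simp add: power_le_one)
  moreover have "(profile \<bar>t\<bar>)\<^sup>2 = (profile t)\<^sup>2" by (cases "t \<ge> 0") (auto simp: profile_minus)
  ultimately show ?thesis by simp
qed

lemma profile_lower: assumes "0 \<le> t" "t \<le> 1" shows "t \<le> profile t"
proof (cases "t < 1")
  case True
  define u where "u = t ^ 4"
  have u: "0 \<le> u" "u \<le> 1" using assms by (auto simp: u_def power_le_one)
  have "profile_poly t - t = t * ((1 - u) * (13 - 5 * u)) / 32"
    by (simp add: profile_poly_def u_def algebra_simps flip: power_Suc power_add) (simp add: eval_nat_numeral field_simps)
  also have "\<dots> \<ge> 0" using assms u by (intro divide_nonneg_nonneg mult_nonneg_nonneg) auto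
  finally show ?thesis using True assms by (simp add: profile_def)
qed (use assms in \<open>simp add: profile_def\<close>)

lemma profile_eq_0_iff: "profile t = 0 \<longleftrightarrow> t = 0"
proof -
  have pos: "profile t > 0" if "t > 0" for t
    using profile_lower[of t] that by (cases "t \<le> 1") (auto simp: profile_def)
  show ?thesis using pos[of t] pos[of "- t"] profile_minus[of t]
    by (cases "t = 0") (force simp: profile_def profile_poly_def)+
qed

text \<open>\<open>9/16 * bump t ^ 4\<close> is the square of the smallest slope
  \<open>3/4 * (bump t)\<^sup>2\<close> that occurs. Equality holds at 0; near 0 the profile gains a
  multiple of \<open>t\<^sup>2\<close>, which outweighs the loss of order \<open>t ^ 4\<close> in
  the slope.\<close>

lemma profile_jet_lower: "(profile t)\<^sup>2 + 9/16 * bump t ^ 4 \<ge> 9/16"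
proof -
  have *: "(profile t)\<^sup>2 + 9/16 * bump t ^ 4 \<ge> 9/16" if t: "0 \<le> t" for t
  proof (cases "t \<le> 3/4")
    case True
    define u where "u = t ^ 4"
    have "u \<le> (3/4) ^ 4" unfolding u_def using t True by (intro power_mono) auto
    then have u: "0 \<le> u" "u \<le> 81/256" by (simp_all add: u_def power_divide)
    have "profile t = t * (45 - 18 * u + 5 * u\<^sup>2) / 32"
      using True t by (simp add: profile_def profile_poly_def u_def algebra_simps eval_nat_numeral)
    \<comment> \<open>1.228 is just below \<open>(45 - 18 * 81/256) / 32\<close>, and its square
      exceeds 3/2.\<close>
    moreover have "t * (45 - 18 * u + 5 * u\<^sup>2) / 32 \<ge> t * (1228/1000)"
    proof -
      have "45 - 18 * u + 5 * u\<^sup>2 \<ge> 32 * (1228/1000)" using u zero_le_power2[of u] by linarith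
      then have "t * (45 - 18 * u + 5 * u\<^sup>2) \<ge> t * (32 * (1228/1000))" using t by (rule mult_left_mono)
      then show ?thesis by simp
    qed
    ultimately have "(t * (1228/1000))\<^sup>2 \<le> (profile t)\<^sup>2" using t by (intro power_mono) auto
    then have P: "3/2 * t\<^sup>2 \<le> (profile t)\<^sup>2"
    proof -
      assume "(t * (1228/1000))\<^sup>2 \<le> (profile t)\<^sup>2"
      moreover have "(t * (1228/1000))\<^sup>2 = 94249/62500 * t\<^sup>2" by (simp add: power_mult_distrib power_divide)
      ultimately show ?thesis using zero_le_power2[of t] by linarith
    qed
    have "bump t = 1 - u" using t True by (simp add: bump_eq u_def)
    moreover have "1 + real 4 * (- u) \<le> (1 + (- u)) ^ 4" using u by (intro Bernoulli_inequality) simp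
    ultimately have B: "1 - 4 * u \<le> bump t ^ 4" by simp
    have "t\<^sup>2 \<le> (3/4)\<^sup>2" using t True by (intro power_mono) auto
    then have "t\<^sup>2 * t\<^sup>2 \<le> 9/16 * t\<^sup>2" by (intro mult_right_mono) (auto simp: power2_eq_square)
    then have "u \<le> 9/16 * t\<^sup>2" by (simp add: u_def power2_eq_square eval_nat_numeral)
    then show ?thesis using P B zero_le_power2[of t] by linarith
  next
    case False
    have "3/4 \<le> profile t"
    proof (cases "t \<le> 1")
      case True then show ?thesis using profile_lower[of t] t False by linarith
    qed (use t in \<open>simp add: profile_def\<close>)
    then have "(3/4)\<^sup>2 \<le> (profile t)\<^sup>2" by (intro power_mono) auto
    then show ?thesis using bump_nonneg[of t] by (simp add: power2_eq_square add_increasing2)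
  qed
  show ?thesis using *[of t] *[of "- t"] by (cases "t \<ge> 0") (auto simp: profile_minus bump_minus)
qed

text \<open>The maximum of \<open>t^3 * (1 - t^4)\<close> is about 0.3027. The quartic is linearised at \<open>4/5\<close>, close to the
  maximiser.\<close>

lemma cube_bump_le:
  assumes "0 \<le> t" shows "t ^ 3 * bump t \<le> 61/200"
proof (cases "t \<le> 1")
  case True
  have "0 \<le> (t - 4/5)\<^sup>2 * (t\<^sup>2 + 2 * (4/5) * t + 3 * (4/5)\<^sup>2)"
    using assms by (intro mult_nonneg_nonneg add_nonneg_nonneg) auto
  also have "\<dots> = t ^ 4 - 256/125 * t + 768/625" by (simp add: power2_eq_square eval_nat_numeral field_simps)
  finally have "bump t \<le> 1393/625 - 256/125 * t" using assms True by (simp add: bump_eq)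
  then have "t ^ 3 * bump t \<le> t ^ 3 * (1393/625 - 256/125 * t)" using assms by (intro mult_left_mono) auto
  also have "\<dots> \<le> t ^ 3 * (4/3 * (817/1000) * (256/125) - 256/125 * t)"
    using assms by (intro mult_left_mono) auto
  also have "\<dots> = (256/125) * (817/1000) ^ 4 / 3
      - (256/375) * ((t - 817/1000)\<^sup>2 * (3 * t\<^sup>2 + 2 * (817/1000) * t + (817/1000)\<^sup>2))"
    by (simp add: power2_eq_square eval_nat_numeral field_simps)
  also have "\<dots> \<le> (256/125) * (817/1000) ^ 4 / 3"
    using assms by (simp add: mult_nonneg_nonneg add_nonneg_nonneg)
  also have "\<dots> \<le> 61/200" by (simp add: eval_nat_numeral)
  finally show ?thesis .
qed (simp add: bump_eq_0)

text \<open>The case of reach above 2, where \<open>r = 15/8\<close>, the slope at 0 is 3/4 and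
  \<open>1 / r\<^sup>2 = 64/225\<close>. The terms with \<open>1 / \<rho>\<close> in the final bound
  can be arbitrarily small, so these three squares must fit into \<open>(3/2)\<^sup>2\<close>
  alone.\<close>

lemma profile_2jet_upper:
  "(profile t)\<^sup>2 + 9/16 * bump t ^ 4 + (64/225 * profile'' t)\<^sup>2 \<le> 9/4"
proof -
  have *: "(profile t)\<^sup>2 + 9/16 * bump t ^ 4 + (16/5 * (t ^ 3 * bump t))\<^sup>2 \<le> 9/4" if t: "0 \<le> t" for t
  \<comment> \<open>Below 13/20 the profile is well under 1 and \<open>bump\<close> may be bounded
    by 1; above it, \<open>bump\<close> has dropped to 83/100 and the profile may be bounded by 1.
    The factor 16/5 is \<open>45/4 * 64/225\<close>.\<close>
  proof (cases "t \<le> 13/20")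
    case True
    have "profile t \<le> 45/32 * t"
    proof -
      have "t ^ 9 \<le> t ^ 5" using t True by (intro power_decreasing) auto
      moreover have "0 \<le> t ^ 5" using t by simp
      ultimately have "5 * t ^ 9 \<le> 18 * t ^ 5" by linarith
      then show ?thesis using t True by (simp add: profile_def profile_poly_def)
    qed
    also have "\<dots> \<le> 45/32 * (13/20)" using True by simp
    finally have "(profile t)\<^sup>2 \<le> (45/32 * (13/20))\<^sup>2" using profile_nonneg[OF t] by (intro power_mono) auto
    moreover have "bump t ^ 4 \<le> 1" using bump_nonneg bump_le_1 by (simp add: power_le_one)
    moreover have "(16/5 * (t ^ 3 * bump t))\<^sup>2 \<le> (16/5 * ((13/20) ^ 3 * 1))\<^sup>2"
      using t True bump_nonneg[of t] bump_le_1[of t] by (intro power_mono mult_mono mult_nonneg_nonneg) auto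
    moreover have "(45/32 * (13/20))\<^sup>2 + 9/16 * 1 + (16/5 * ((13/20) ^ 3 * 1))\<^sup>2 \<le> (9/4 :: real)"
      by (simp add: power2_eq_square eval_nat_numeral)
    ultimately show ?thesis by linarith
  next
    case False
    have "(profile t)\<^sup>2 \<le> 1" by (rule profile_squared_le_1)
    moreover have "bump t ^ 4 \<le> (83/100) ^ 4"
    proof (intro power_mono bump_nonneg)
      have "(13/20) ^ 4 \<le> t ^ 4" using False by (intro power_mono) auto
      then show "bump t \<le> 83/100"
        unfolding bump_def by (intro max.boundedI) (simp_all add: power_divide)
    qed
    moreover have "(16/5 * (t ^ 3 * bump t))\<^sup>2 \<le> (16/5 * (61/200))\<^sup>2"
      using t cube_bump_le[OF t] bump_nonneg[of t] by (intro power_mono mult_left_mono mult_nonneg_nonneg) auto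
    moreover have "1 + 9/16 * (83/100) ^ 4 + (16/5 * (61/200))\<^sup>2 \<le> (9/4 :: real)"
      by (simp add: power2_eq_square eval_nat_numeral)
    ultimately show ?thesis by linarith
  qed
  have "(64/225 * profile'' t)\<^sup>2 = (16/5 * (\<bar>t\<bar> ^ 3 * bump \<bar>t\<bar>))\<^sup>2"
    by (cases "t \<ge> 0") (auto simp: profile''_def bump_minus power_mult_distrib mult.commute)
  moreover have "(profile \<bar>t\<bar>)\<^sup>2 = (profile t)\<^sup>2" "bump \<bar>t\<bar> = bump t"
    by (cases "t \<ge> 0"; simp add: profile_minus bump_minus)+
  ultimately show ?thesis using *[of "\<bar>t\<bar>"] by simp
qed

lemma profile''_le: "\<bar>profile'' t\<bar> \<le> 45/4 * (61/200)"
proof -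
  have "\<bar>profile'' t\<bar> = 45/4 * (\<bar>t\<bar> ^ 3 * bump \<bar>t\<bar>)"
    using bump_nonneg[of t] by (cases "t \<ge> 0") (auto simp: profile''_def bump_minus abs_mult power_abs)
  then show ?thesis using cube_bump_le[of "\<bar>t\<bar>"] by simp
qed

text \<open>The factor \<open>1 - \<bar>t\<bar>\<close> is there to cancel the growth of the
  Lipschitz bound \<open>1 / (\<rho> - \<bar>\<sigma>\<bar>)\<close> towards the edge of the
  tube.\<close>

lemma bump_squared_le: assumes "\<bar>t\<bar> \<le> 1" shows "(bump t)\<^sup>2 \<le> 4 * (1 - \<bar>t\<bar>)"
proof -
  define u where "u = \<bar>t\<bar>"
  have u: "0 \<le> u" "u \<le> 1" "t ^ 4 = u ^ 4" using assms by (auto simp: u_def)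
  have "bump t = (1 - u) * ((1 + u) * (1 + u\<^sup>2))"
    using assms u by (simp add: bump_eq) (simp add: eval_nat_numeral algebra_simps)
  also have "\<dots> \<le> (1 - u) * (2 * 2)"
    using u power_le_one[of u 2] by (intro mult_left_mono mult_mono) auto
  finally have "bump t \<le> 4 * (1 - u)" by simp
  moreover have "(bump t)\<^sup>2 \<le> 1 * bump t"
    unfolding power2_eq_square using bump_nonneg[of t] bump_le_1[of t] by (intro mult_right_mono)
  ultimately show ?thesis by (simp add: u_def)
qed

text \<open>The factor 15/16 turns the slope 45/32 of the profile at 0 into
  \<open>3/2 / min \<rho> 2\<close>, and makes \<open>r\<close> strictly smaller than \<rho>. For
  \<open>\<rho> \<le> 2\<close> the derivatives are absorbed by the corresponding powers of
  \<open>1 / \<rho>\<close>, for larger \<rho> by the constant term and a mixed term.\<close>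

lemma profile_estimates:
  fixes \<rho> \<sigma> :: real and n :: nat
  assumes \<rho>: "\<rho> > 0" and n: "n \<ge> 1"
  defines "r \<equiv> 15/16 * min \<rho> 2"
  defines "f0 \<equiv> profile (\<sigma> / r)" and "f1 \<equiv> profile' (\<sigma> / r) / r" and "f2 \<equiv> profile'' (\<sigma> / r) / r\<^sup>2"
  shows "(3/4)\<^sup>2 \<le> f0\<^sup>2 + f1\<^sup>2"
    and "f0\<^sup>2 + f1\<^sup>2 \<le> (3/2 * (1 + 1 / \<rho>))\<^sup>2"
    and "f0\<^sup>2 + f1\<^sup>2 + (f2\<^sup>2 + n * (f1 / (\<rho> - \<bar>\<sigma>\<bar>))\<^sup>2) \<le> (3/2 * (1 + 1 / \<rho> + 5 * n / \<rho>\<^sup>2))\<^sup>2"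
proof -
  define m where "m = min \<rho> 2"
  define t where "t = \<sigma> / r"
  have m: "m > 0" "m \<le> \<rho>" "m \<le> 2" using \<rho> by (auto simp: m_def)
  have r: "r > 0" "r \<le> \<rho>" "r = 15/16 * m" using m by (auto simp: r_def m_def)
  have \<sigma>: "\<sigma> = r * t" using r by (simp add: t_def)
  have b: "0 \<le> bump t" "bump t \<le> 1" by (rule bump_nonneg bump_le_1)+
  have f1: "f1 = 3/2 * (bump t)\<^sup>2 / m"
  proof -
    have "f1 = profile' t / r" by (simp add: f1_def t_def)
    then show ?thesis using m by (simp add: profile'_def r(3))
  qed
  have f2: "f2 = profile'' t / r\<^sup>2" by (simp add: f2_def t_def)
  have b2: "0 \<le> (bump t)\<^sup>2" "(bump t)\<^sup>2 \<le> 1" using b by (auto simp: power_le_one)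
  have f1_ge: "3/4 * (bump t)\<^sup>2 \<le> f1"
  proof -
    have "m * (bump t)\<^sup>2 \<le> 2 * (bump t)\<^sup>2" using m b2 by (intro mult_right_mono)
    then show ?thesis using m by (simp add: f1 field_simps)
  qed
  then have f1_0: "0 \<le> f1" using b2 by linarith
  have "(3/4 * (bump t)\<^sup>2)\<^sup>2 \<le> f1\<^sup>2" using f1_ge b2 by (intro power_mono) auto
  then have "9/16 * bump t ^ 4 \<le> f1\<^sup>2" by (simp add: power_mult_distrib power2_eq_square eval_nat_numeral)
  then show "(3/4)\<^sup>2 \<le> f0\<^sup>2 + f1\<^sup>2"
    using profile_jet_lower[of t] by (simp add: f0_def t_def[symmetric] power2_eq_square)
  have f0: "f0\<^sup>2 \<le> 1" unfolding f0_def by (rule profile_squared_le_1)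
  have "f1 \<le> 3/2 * 1 / m" unfolding f1 using b2 m by (intro divide_right_mono mult_left_mono) auto
  then have f1_le: "f1\<^sup>2 \<le> (3/2 / m)\<^sup>2" using f1_0 by (intro power_mono) auto
  \<comment> \<open>Numerator and denominator share the factor \<open>1 - \<bar>t\<bar>\<close>.
    Separate worst cases, with \<open>\<rho> - \<bar>\<sigma>\<bar>\<close> as small as
    \<open>\<rho>/16\<close>, would give 24 in place of 6.\<close>
  have curv: "(f1 / (\<rho> - \<bar>\<sigma>\<bar>))\<^sup>2 \<le> (6 / (m * \<rho>))\<^sup>2"
  proof (cases "\<bar>t\<bar> < 1")
    case True
    have le: "\<rho> * (1 - \<bar>t\<bar>) \<le> \<rho> - \<bar>\<sigma>\<bar>"
      using mult_right_mono[OF r(2), of "\<bar>t\<bar>"] r(1) by (simp add: \<sigma> abs_mult algebra_simps)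
    have pos: "0 < \<rho> * (1 - \<bar>t\<bar>)" using \<rho> True by simp
    have "f1 \<le> 3/2 * (4 * (1 - \<bar>t\<bar>)) / m"
      unfolding f1 using m bump_squared_le[of t] True by (intro divide_right_mono mult_left_mono) auto
    then have "f1 / (\<rho> - \<bar>\<sigma>\<bar>) \<le> (3/2 * (4 * (1 - \<bar>t\<bar>)) / m) / (\<rho> * (1 - \<bar>t\<bar>))"
      using le pos f1_0 m True by (intro frac_le) auto
    also have "\<dots> = 6 / (m * \<rho>)" using True m \<rho> by (simp add: field_simps)
    finally show ?thesis using f1_0 le pos by (intro power_mono) auto
  next
    case False
    then show ?thesis by (simp add: f1 bump_eq_0)
  qed
  have n': "real n \<ge> 1" using n by simp
  define a where "a = 1 / \<rho>"
  have a0: "0 < a" using \<rho> by (simp add: a_def)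
  show "f0\<^sup>2 + f1\<^sup>2 \<le> (3/2 * (1 + 1 / \<rho>))\<^sup>2"
  proof (cases "\<rho> \<le> 2")
    case True
    then have "f1\<^sup>2 \<le> 9/4 * a\<^sup>2"
      using f1_le \<rho> by (simp add: m_def a_def power_divide power_mult_distrib)
    moreover have "(3/2 * (1 + a))\<^sup>2 = 9/4 + 9/2 * a + 9/4 * a\<^sup>2" by (simp add: power2_eq_square algebra_simps)
    ultimately show ?thesis using f0 a0 unfolding a_def[symmetric] by linarith
  next
    case False
    then have "f1\<^sup>2 \<le> 9/16" using f1_le by (simp add: m_def power2_eq_square)
    moreover have "(3/2 * 1)\<^sup>2 \<le> (3/2 * (1 + a))\<^sup>2" using a0 by (intro power_mono) auto
    ultimately show ?thesis using f0 unfolding a_def[symmetric] by (simp add: power2_eq_square)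
  qed
  have rhs: "1 + 1 / \<rho> + 5 * n / \<rho>\<^sup>2 = 1 + a + 5 * (n * a\<^sup>2)" by (simp add: a_def power_divide)
  show "f0\<^sup>2 + f1\<^sup>2 + (f2\<^sup>2 + n * (f1 / (\<rho> - \<bar>\<sigma>\<bar>))\<^sup>2) \<le> (3/2 * (1 + 1 / \<rho> + 5 * n / \<rho>\<^sup>2))\<^sup>2"
  proof (cases "\<rho> \<le> 2")
    case True
    then have m\<rho>: "m = \<rho>" by (simp add: m_def)
    have 1: "f1\<^sup>2 \<le> 9/4 * a\<^sup>2"
      using f1_le \<rho> by (simp add: m\<rho> a_def power_divide power_mult_distrib)
    have "\<bar>f2\<bar> = \<bar>profile'' t\<bar> * (256/225) * a\<^sup>2"
      by (simp add: f2 r(3) m\<rho> a_def power_divide power_mult_distrib abs_mult)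
    also have "\<dots> \<le> (45/4 * (61/200)) * (256/225) * a\<^sup>2"
      using profile''_le[of t] by (intro mult_right_mono) auto
    also have "\<dots> = 488/125 * a\<^sup>2" by simp
    finally have "\<bar>f2\<bar>\<^sup>2 \<le> (488/125 * a\<^sup>2)\<^sup>2" by (intro power_mono) auto
    moreover have "(488/125 * a\<^sup>2)\<^sup>2 = (488/125)\<^sup>2 * a ^ 4" by (simp add: power_mult_distrib power_divide)
    moreover have "(488/125)\<^sup>2 * a ^ 4 \<le> 61/4 * a ^ 4" by (intro mult_right_mono) (auto simp: power2_eq_square)
    ultimately have 2: "f2\<^sup>2 \<le> 61/4 * a ^ 4" by simp
    have "(6 / (m * \<rho>))\<^sup>2 = 36 * a ^ 4"
      by (simp add: m\<rho> a_def power_divide power_mult_distrib flip: power_add)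
    then have "n * (f1 / (\<rho> - \<bar>\<sigma>\<bar>))\<^sup>2 \<le> n * (36 * a ^ 4)" using curv by (intro mult_left_mono) auto
    then have 3: "n * (f1 / (\<rho> - \<bar>\<sigma>\<bar>))\<^sup>2 \<le> 36 * (n * a ^ 4)" by (simp add: mult_ac)
    have "1 * a ^ 4 \<le> n * a ^ 4" using n' by (intro mult_right_mono) auto
    moreover have "n * a ^ 4 \<le> n * (n * a ^ 4)" using mult_right_mono[OF n', of "n * a ^ 4"] by simp
    \<comment> \<open>Here the coefficient 5 enters: the square of \<open>3/2 * 5\<close> is 225/4,
      which must dominate 61/4 + 36 = 205/4.\<close>
    ultimately have 4: "61/4 * a ^ 4 + 36 * (n * a ^ 4) \<le> 225/4 * (n * (n * a ^ 4))"
      using a0 zero_le_power[of a 4] by linarith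
    have "(3/2 * (1 + a + 5 * (n * a\<^sup>2)))\<^sup>2
        = 9/4 + 9/4 * a\<^sup>2 + 225/4 * (n * (n * a ^ 4)) + (9/2 * a + 45/2 * (n * a\<^sup>2) + 45/2 * (a * (n * a\<^sup>2)))"
      by (simp add: power2_eq_square eval_nat_numeral algebra_simps)
    moreover have "0 \<le> 9/2 * a + 45/2 * (n * a\<^sup>2) + 45/2 * (a * (n * a\<^sup>2))" using a0 by simp
    ultimately show ?thesis unfolding rhs using f0 1 2 3 4 by linarith
  next
    case False
    then have m2: "m = 2" by (simp add: m_def)
    have e1: "f1\<^sup>2 = 9/16 * bump t ^ 4"
      by (simp add: f1 m2 power_mult_distrib power_divide flip: power_mult)
    have e2: "f2 = 64/225 * profile'' t"
      by (simp add: f2 r(3) m2 power2_eq_square)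
    have 1: "f0\<^sup>2 + f1\<^sup>2 + f2\<^sup>2 \<le> 9/4"
      unfolding e1 e2 f0_def t_def[symmetric] by (rule profile_2jet_upper)
    have "(6 / (m * \<rho>))\<^sup>2 = 9 * a\<^sup>2" by (simp add: m2 a_def power_divide power_mult_distrib)
    then have "n * (f1 / (\<rho> - \<bar>\<sigma>\<bar>))\<^sup>2 \<le> n * (9 * a\<^sup>2)" using curv by (intro mult_left_mono) auto
    \<comment> \<open>The mixed term of the square, with coefficient 45/2, covers the
      \<open>9 * (n * a\<^sup>2)\<close> from the curvature.\<close>
    moreover have "9/4 + 45/2 * (n * a\<^sup>2) \<le> (3/2 * (1 + a + 5 * (n * a\<^sup>2)))\<^sup>2"
    proof -
      have "9/4 + 45/2 * (n * a\<^sup>2) \<le> (3/2 * (1 + 5 * (n * a\<^sup>2)))\<^sup>2"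
        using zero_le_power2[of "n * a\<^sup>2"] by (simp add: power2_eq_square algebra_simps)
      also have "\<dots> \<le> (3/2 * (1 + a + 5 * (n * a\<^sup>2)))\<^sup>2" using a0 by (intro power_mono) auto
      finally show ?thesis .
    qed
    moreover have "0 \<le> n * a\<^sup>2" by simp
    ultimately show ?thesis unfolding rhs using 1 by linarith
  qed
qed

section \<open>Sums over derivatives and the condition number\<close>

abbreviation iterated_partial :: "'n list \<Rightarrow> (real^'n \<Rightarrow> real) \<Rightarrow> real^'n \<Rightarrow> real" where
  "iterated_partial \<equiv> foldr partial_deriv"

text \<open>Sending a multi-index to its chosen list is injective and length-preserving, so the left
  side is part of the right side whatever order was chosen. Summing over all lists counts mixed
  derivatives repeatedly, which the bounds can afford.\<close>

lemma sum_multi_deriv_le: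
  fixes f :: "real^'n \<Rightarrow> real"
  shows "(\<Sum>\<alpha> | (\<Sum>i\<in>UNIV. \<alpha> i) \<le> k. (multi_deriv \<alpha> f z)\<^sup>2)
    \<le> (\<Sum>js | length js \<le> k. (iterated_partial js f z)\<^sup>2)"
proof -
  define js :: "('n \<Rightarrow> nat) \<Rightarrow> 'n list" where "js \<alpha> = (SOME js. \<forall>i. count_list js i = \<alpha> i)" for \<alpha>
  have js: "count_list (js \<alpha>) i = \<alpha> i" for \<alpha> i
    unfolding js_def using someI_ex[OF exists_list_of_multi_index[of \<alpha>]] by blast
  have "inj js"
  proof
    fix \<alpha> \<beta> assume "js \<alpha> = js \<beta>"
    then show "\<alpha> = \<beta>" using js[of \<alpha>] js[of \<beta>] by (simp add: fun_eq_iff)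
  qed
  then have inj: "inj_on js A" for A by (rule inj_on_subset) simp
  have len: "length (js \<alpha>) = (\<Sum>i\<in>UNIV. \<alpha> i)" for \<alpha>
  proof -
    have "length (js \<alpha>) = (\<Sum>i\<in>UNIV. count_list (js \<alpha>) i)"
      using sum_count_set[of "js \<alpha>" UNIV] by simp
    then show ?thesis by (simp add: js)
  qed
  have "(\<Sum>\<alpha> | (\<Sum>i\<in>UNIV. \<alpha> i) \<le> k. (multi_deriv \<alpha> f z)\<^sup>2)
      = (\<Sum>l\<in>js ` {\<alpha>. (\<Sum>i\<in>UNIV. \<alpha> i) \<le> k}. (iterated_partial l f z)\<^sup>2)"
    unfolding sum.reindex[OF inj] by (simp add: multi_deriv_def js_def)
  also have "\<dots> \<le> (\<Sum>js | length js \<le> k. (iterated_partial js f z)\<^sup>2)"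
    using finite_lists_length_le[of "UNIV :: 'n set" k] by (intro sum_mono2) (auto simp: len)
  finally show ?thesis .
qed

lemma norm_squared_vec: "(norm (v :: real^'n))\<^sup>2 = (\<Sum>i\<in>UNIV. (v $ i)\<^sup>2)"
  unfolding power2_norm_eq_inner inner_vec_def by (simp add: power2_eq_square)

lemma sum_iterated_partial_1:
  fixes f :: "real^'n \<Rightarrow> real"
  shows "(\<Sum>js | length js \<le> 1. (iterated_partial js f z)\<^sup>2) = (f z)\<^sup>2 + (norm (grad f z))\<^sup>2"
proof -
  have "{js :: 'n list. length js \<le> 1} = insert [] ((\<lambda>i. [i]) ` UNIV)"
    by (auto simp: le_Suc_eq length_Suc_conv)
  moreover have "inj_on (\<lambda>i::'n. [i]) UNIV" by (simp add: inj_on_def)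
  moreover have "[] \<notin> (\<lambda>i::'n. [i]) ` UNIV" by auto
  ultimately show ?thesis by (simp add: sum.reindex norm_squared_vec grad_def)
qed

lemma sum_iterated_partial_2:
  fixes f :: "real^'n \<Rightarrow> real"
  shows "(\<Sum>js | length js \<le> 2. (iterated_partial js f z)\<^sup>2) = (f z)\<^sup>2 + (norm (grad f z))\<^sup>2
    + (\<Sum>i\<in>UNIV. \<Sum>j\<in>UNIV. (partial_deriv i (partial_deriv j f) z)\<^sup>2)"
proof -
  let ?P = "\<lambda>(i::'n, j). [i, j]"
  have eq: "{js :: 'n list. length js \<le> 2} = {js. length js \<le> 1} \<union> ?P ` (UNIV \<times> UNIV)"
    by (auto simp: numeral_2_eq_2 le_Suc_eq length_Suc_conv image_iff)
  have "finite {js :: 'n list. length js \<le> 1}"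
    using finite_lists_length_le[of "UNIV :: 'n set" 1] by simp
  then have "(\<Sum>js | length js \<le> 2. (iterated_partial js f z)\<^sup>2)
      = (\<Sum>js | length js \<le> 1. (iterated_partial js f z)\<^sup>2) + (\<Sum>js\<in>?P ` (UNIV \<times> UNIV). (iterated_partial js f z)\<^sup>2)"
    unfolding eq by (intro sum.union_disjoint) auto
  also have "(\<Sum>js\<in>?P ` (UNIV \<times> UNIV). (iterated_partial js f z)\<^sup>2)
      = (\<Sum>(i, j)\<in>UNIV \<times> UNIV. (partial_deriv i (partial_deriv j f) z)\<^sup>2)"
    by (subst sum.reindex) (auto simp: inj_on_def intro!: sum.cong)
  also have "\<dots> = (\<Sum>i\<in>UNIV. \<Sum>j\<in>UNIV. (partial_deriv i (partial_deriv j f) z)\<^sup>2)"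
    by (rule sum.cartesian_product[symmetric])
  finally show ?thesis by (simp only: sum_iterated_partial_1)
qed

lemma Ck_norm_le:
  assumes "\<And>z. (\<Sum>js | length js \<le> k. (iterated_partial js f z)\<^sup>2) \<le> b\<^sup>2" and b: "0 \<le> b"
  shows "Ck_norm k f c r \<le> ennreal b"
  unfolding Ck_norm_def
proof (intro SUP_least ennreal_leI)
  fix z
  show "sqrt (\<Sum>\<alpha> | (\<Sum>i\<in>UNIV. \<alpha> i) \<le> k. (multi_deriv \<alpha> f z)\<^sup>2) \<le> b"
    using sum_multi_deriv_le[where k = k and f = f and z = z] assms(1)[of z] b by (intro real_le_lsqrt) (auto intro: sum_nonneg)
qed

text \<open>On the sphere the value of \<open>f\<close> alone exceeds 3/4, so nothing about
  \<open>sphere_grad\<close> is required.\<close>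

lemma cond_num_le:
  assumes norm: "\<And>z. (\<Sum>js | length js \<le> k. (iterated_partial js f z)\<^sup>2) \<le> (3/2 * b)\<^sup>2" and b: "0 \<le> b"
    and lower: "\<And>z. (3/4)\<^sup>2 \<le> (f z)\<^sup>2 + (norm (grad f z))\<^sup>2"
    and sphere: "\<And>z. z \<in> sphere c r \<Longrightarrow> \<bar>f z\<bar> = 1"
  shows "cond_num k f c r \<le> ennreal (2 * b)"
proof -
  have discr: "ennreal (3/4) \<le> discr_dist f c r"
    unfolding discr_dist_def
  proof (intro min.boundedI INF_greatest ennreal_leI)
    fix z
    show "3/4 \<le> sqrt ((f z)\<^sup>2 + (norm (grad f z))\<^sup>2)"
      using lower[of z] by (intro real_le_rsqrt)
    assume "z \<in> sphere c r"
    then have "(f z)\<^sup>2 = 1" using sphere[of z] by (metis power2_abs one_power2)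
    then have "(3/4)\<^sup>2 \<le> (f z)\<^sup>2 + (norm (sphere_grad f c r z))\<^sup>2"
      by (simp add: power2_eq_square add_increasing2)
    then show "3/4 \<le> sqrt ((f z)\<^sup>2 + (norm (sphere_grad f c r z))\<^sup>2)" by (rule real_le_rsqrt)
  qed
  have "Ck_norm k f c r \<le> ennreal (3/2 * b)" using norm b by (intro Ck_norm_le) auto
  also have "\<dots> = ennreal (3/4) * ennreal (2 * b)" using b by (simp flip: ennreal_mult)
  also have "\<dots> \<le> discr_dist f c r * ennreal (2 * b)" by (intro mult_right_mono discr) simp
  finally show ?thesis
    unfolding cond_num_def using discr by (intro divide_le_posI_ennreal) (auto intro: less_le_trans[of _ "ennreal (3/4)"])
qed

section \<open>Composition of the profile with the signed distance\<close>

text \<open>The strict inequality \<open>r < \<rho>\<close> leaves a collar inside the tube on which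
  the composed function is already locally constant, so every formula extends across the edge of the
  tube.\<close>

locale cutoff = eikonal s N \<rho> for s :: "real^'n \<Rightarrow> real" and N :: "real^'n \<Rightarrow> real^'n" and \<rho> :: real +
  fixes r :: real
  assumes r: "0 < r" "r < \<rho>"
begin

definition f0 :: "real^'n \<Rightarrow> real" where "f0 x = profile (s x / r)"
definition f1 :: "real^'n \<Rightarrow> real" where "f1 x = profile' (s x / r) / r"
definition f2 :: "real^'n \<Rightarrow> real" where "f2 x = profile'' (s x / r) / r\<^sup>2"

lemma abs_ge_1: "r \<le> \<bar>s x\<bar> \<Longrightarrow> 1 \<le> \<bar>s x / r\<bar>"
  using r by (simp add: abs_divide)

lemma outside:
  assumes "r \<le> \<bar>s x\<bar>"
  shows "f1 x = 0" "f2 x = 0" "\<bar>f0 x\<bar> = 1"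
  using abs_ge_1[OF assms] bump_eq_0[OF abs_ge_1[OF assms]]
  by (auto simp: f0_def f1_def f2_def profile_def profile'_def profile''_def sgn_real_def)

lemma scaled_derivative:
  assumes x: "\<bar>s x\<bar> < \<rho>" and p: "\<And>t. (p has_real_derivative p' t) (at t)"
  shows "((\<lambda>x. p (s x / r)) has_derivative (\<lambda>h. p' (s x / r) / r * (N x \<bullet> h))) (at x)"
proof -
  have "((\<lambda>x. s x / r) has_derivative (\<lambda>h. (N x \<bullet> h) / r)) (at x)"
    using has_derivative_mult_right[OF der[OF x], of "1 / r"] by simp
  from DERIV_compose_FDERIV[OF p this] show ?thesis by (simp add: mult_ac)
qed

text \<open>Outside the tube nothing is known about \<open>N x\<close>; the formula stays correct
  because \<open>f1\<close> vanishes and \<open>f0\<close> is locally constant there.\<close>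

lemma f0_has_derivative: "(f0 has_derivative (\<lambda>h. (f1 x *\<^sub>R N x) \<bullet> h)) (at x)"
proof (cases "\<bar>s x\<bar> < \<rho>")
  case True
  from scaled_derivative[OF True DERIV_profile] show ?thesis
    by (simp add: f0_def[abs_def] f1_def)
next
  case False
  define c where "c = sgn (s x)"
  have c: "\<bar>c\<bar> = 1" "s x = c * \<bar>s x\<bar>" using False r by (auto simp: c_def sgn_real_def)
  define S where "S = {y. r < c * s y}"
  have "open S" unfolding S_def by (intro open_Collect_less continuous_intros continuous_s)
  moreover have "x \<in> S"
  proof -
    have "c * s x = \<bar>s x\<bar>" by (simp add: c_def sgn_mult_self_eq abs_sgn mult.commute)
    then show ?thesis using False r by (simp add: S_def)
  qed
  moreover have "c = f0 y" if "y \<in> S" for y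
  proof -
    have "c = 1 \<or> c = -1" using c(1) by linarith
    then show ?thesis using that r by (auto simp: S_def f0_def profile_def sgn_real_def abs_divide field_simps)
  qed
  ultimately have "(f0 has_derivative (\<lambda>h. 0)) (at x)"
    by (intro has_derivative_transform_within_open[OF has_derivative_const[of c]])
  moreover have "f1 x = 0" using outside[of x] False r by simp
  ultimately show ?thesis by simp
qed

lemma partial_deriv_f0: "partial_deriv i f0 = (\<lambda>x. (f1 x *\<^sub>R N x) $ i)"
  using partial_deriv_eq[OF f0_has_derivative] by (simp add: fun_eq_iff inner_axis)

lemma grad_f0: "grad f0 x = f1 x *\<^sub>R N x"
  by (simp add: grad_def partial_deriv_f0 vec_eq_iff)

lemma isCont_s: "isCont s x"
  using continuous_s[of UNIV] by (simp add: continuous_on_eq_continuous_at)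

lemma continuous_cutoff:
  fixes h :: "real^'n \<Rightarrow> 'b::real_normed_vector"
  assumes h: "\<And>x. \<bar>s x\<bar> < \<rho> \<Longrightarrow> isCont h x" and 0: "\<And>x. r \<le> \<bar>s x\<bar> \<Longrightarrow> h x = 0"
  shows "continuous_on UNIV h"
proof -
  have "isCont h x" for x
  proof (cases "\<bar>s x\<bar> < \<rho>")
    case False
    let ?S = "{y. r < \<bar>s y\<bar>}"
    have S: "open ?S" by (intro open_Collect_less continuous_intros continuous_s)
    have "continuous_on ?S h" by (rule continuous_on_eq[OF continuous_on_const[of _ 0]]) (simp add: 0)
    moreover have "x \<in> ?S" using False r by simp
    ultimately show ?thesis using continuous_on_eq_continuous_at[OF S] by blast
  qed (rule h)
  then show ?thesis by (simp add: continuous_on_eq_continuous_at)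
qed

lemma isCont_f1: "isCont f1 x"
proof -
  have "isCont (\<lambda>x. s x / r) x" using r by (intro continuous_intros isCont_s) auto
  then have "isCont (\<lambda>x. profile' (s x / r)) x"
    by (rule isCont_o2) (rule DERIV_isCont[OF DERIV_profile'])
  then show ?thesis unfolding f1_def[abs_def] using r by (intro continuous_intros) auto
qed

lemma isCont_f2: "isCont f2 x"
proof -
  have "isCont (\<lambda>x. s x / r) x" using r by (intro continuous_intros isCont_s) auto
  moreover have "isCont profile'' t" for t
    using continuous_profile''[of UNIV] by (simp add: continuous_on_eq_continuous_at)
  ultimately have "isCont (\<lambda>x. profile'' (s x / r)) x" by (rule isCont_o2)
  then show ?thesis unfolding f2_def[abs_def] using r by (intro continuous_intros) auto
qed

lemma Ck_1: "Ck_on 1 UNIV f0"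
proof -
  have "continuous_on UNIV (\<lambda>x. (f1 x *\<^sub>R N x) $ i)" for i
    by (rule continuous_cutoff) (auto intro!: continuous_intros isCont_f1 isCont_N simp: outside)
  moreover have "f0 differentiable (at x)" for x
    using f0_has_derivative unfolding differentiable_def by blast
  ultimately show ?thesis by (simp add: partial_deriv_f0)
qed

context
  fixes A :: "real^'n \<Rightarrow> (real^'n) \<Rightarrow>\<^sub>L (real^'n)"
  assumes A: "\<And>x. \<bar>s x\<bar> < \<rho> \<Longrightarrow> (N has_derivative blinfun_apply (A x)) (at x)"
    and contA: "\<And>x. \<bar>s x\<bar> < \<rho> \<Longrightarrow> isCont A x"
begin

lemma grad_has_derivative:
  "((\<lambda>x. f1 x *\<^sub>R N x) has_derivative (\<lambda>h. (f2 x * (N x \<bullet> h)) *\<^sub>R N x + f1 x *\<^sub>R A x h)) (at x)"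
proof (cases "\<bar>s x\<bar> < \<rho>")
  case True
  have "(f1 has_derivative (\<lambda>h. f2 x * (N x \<bullet> h))) (at x)"
    using has_derivative_mult_right[OF scaled_derivative[OF True DERIV_profile'], of "1 / r"]
    by (simp add: f1_def[abs_def] f2_def power2_eq_square)
  from has_derivative_scaleR[OF this A[OF True]] show ?thesis by (simp add: add.commute)
next
  case False
  let ?S = "{y. r < \<bar>s y\<bar>}"
  have "open ?S" by (intro open_Collect_less continuous_intros continuous_s)
  moreover have "x \<in> ?S" using False r by simp
  moreover have "0 = f1 y *\<^sub>R N y" if "y \<in> ?S" for y using outside[of y] that by simp
  ultimately have "((\<lambda>x. f1 x *\<^sub>R N x) has_derivative (\<lambda>h. 0)) (at x)"
    by (intro has_derivative_transform_within_open[OF has_derivative_const[of 0]])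
  then show ?thesis using outside[of x] False r by simp
qed

lemma partial_deriv2_f0:
  "partial_deriv j (partial_deriv i f0) = (\<lambda>x. f2 x * (N x $ j) * (N x $ i) + f1 x * (A x (axis j 1) $ i))"
proof
  fix x
  have "((\<lambda>x. (f1 x *\<^sub>R N x) $ i) has_derivative
      (\<lambda>h. ((f2 x * (N x \<bullet> h)) *\<^sub>R N x + f1 x *\<^sub>R A x h) $ i)) (at x)"
    by (rule bounded_linear.has_derivative[OF bounded_linear_vec_nth grad_has_derivative])
  from partial_deriv_eq[OF this, of j]
  show "partial_deriv j (partial_deriv i f0) x = f2 x * (N x $ j) * (N x $ i) + f1 x * (A x (axis j 1) $ i)"
    unfolding partial_deriv_f0 by (simp add: inner_axis)
qed

lemma Ck_2: "Ck_on 2 UNIV f0"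
proof -
  have "continuous_on UNIV (\<lambda>x. f2 x * (N x $ j) * (N x $ i) + f1 x * (A x (axis j 1) $ i))" for i j
    by (rule continuous_cutoff)
       (auto intro!: continuous_intros isCont_f1 isCont_f2 isCont_N contA simp: outside)
  moreover have "(\<lambda>x. (f1 x *\<^sub>R N x) $ i) differentiable (at x)" for i x
    using bounded_linear.has_derivative[OF bounded_linear_vec_nth grad_has_derivative]
    unfolding differentiable_def by blast
  moreover have "f0 differentiable (at x)" for x
    using f0_has_derivative unfolding differentiable_def by blast
  ultimately show ?thesis
    by (simp add: numeral_2_eq_2 partial_deriv2_f0) (simp add: partial_deriv_f0)
qed

text \<open>The radial part \<open>f2 x * N N\<^sup>T\<close> and the part \<open>f1 x * A x\<close> of the Hessian are orthogonal, because
  \<open>A x\<close> takes values orthogonal to \<open>N x\<close>.\<close>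

lemma hessian_le:
  "(\<Sum>i\<in>UNIV. \<Sum>j\<in>UNIV. (partial_deriv i (partial_deriv j f0) x)\<^sup>2)
    \<le> (f2 x)\<^sup>2 + CARD('n) * (f1 x / (\<rho> - \<bar>s x\<bar>))\<^sup>2"
proof (cases "\<bar>s x\<bar> < \<rho>")
  case True
  define K where "K = 1 / (\<rho> - \<bar>s x\<bar>)"
  \<comment> \<open>A row is the image of one basis vector and costs one squared operator norm of
    \<open>A x\<close>. Summing over the rows produces the dimension in the final bound.\<close>
  have row: "(\<Sum>j\<in>UNIV. (partial_deriv i (partial_deriv j f0) x)\<^sup>2) \<le> (f2 x)\<^sup>2 * (N x $ i)\<^sup>2 + (f1 x * K)\<^sup>2" for i
  proof -
    let ?a = "A x (axis i 1)"
    have "(\<Sum>j\<in>UNIV. (partial_deriv i (partial_deriv j f0) x)\<^sup>2)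
        = (norm ((f2 x * (N x $ i)) *\<^sub>R N x + f1 x *\<^sub>R ?a))\<^sup>2"
      unfolding power2_norm_eq_inner inner_vec_def
      by (simp add: partial_deriv2_f0 power2_eq_square)
    also have "\<dots> = (f2 x * (N x $ i))\<^sup>2 * (N x \<bullet> N x) + 2 * (f2 x * (N x $ i)) * f1 x * (N x \<bullet> ?a)
        + (f1 x)\<^sup>2 * (norm ?a)\<^sup>2"
      unfolding power2_norm_eq_inner
      by (simp add: inner_add_left inner_add_right inner_commute power2_eq_square algebra_simps)
    also have "\<dots> = (f2 x)\<^sup>2 * (N x $ i)\<^sup>2 + (f1 x)\<^sup>2 * (norm ?a)\<^sup>2"
      using derivative_N_orthogonal[OF True A[OF True]] unit[OF True]
      by (simp add: dot_square_norm power_mult_distrib)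
    also have "(norm ?a)\<^sup>2 \<le> K\<^sup>2"
      using derivative_N_bound[OF True A[OF True], of "axis i 1"]
      by (intro power_mono) (auto simp: K_def)
    finally show ?thesis by (simp add: power_mult_distrib mult_left_mono)
  qed
  have "(\<Sum>i\<in>UNIV. \<Sum>j\<in>UNIV. (partial_deriv i (partial_deriv j f0) x)\<^sup>2)
      \<le> (\<Sum>i\<in>UNIV. (f2 x)\<^sup>2 * (N x $ i)\<^sup>2 + (f1 x * K)\<^sup>2)"
    by (intro sum_mono row)
  also have "\<dots> = (f2 x)\<^sup>2 * (N x \<bullet> N x) + CARD('n) * (f1 x * K)\<^sup>2"
    by (simp add: sum.distrib inner_vec_def power2_eq_square flip: sum_distrib_left)
  finally show ?thesis using unit[OF True] by (simp add: K_def dot_square_norm)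
next
  case False
  then have "f1 x = 0" "f2 x = 0" using outside[of x] r by auto
  then show ?thesis by (simp add: partial_deriv2_f0)
qed

end

end

section \<open>The defining function\<close>

lemma unit_normal_hypersurface:
  fixes Z :: "(real^'n) set"
  assumes Z: "closed Z" and U: "open U" and g: "Ck_on (Suc k) U g" "Z \<inter> U = {x \<in> U. g x = 0}"
    and y: "y \<in> Z \<inter> U" "grad g y \<noteq> 0"
  shows "unit_normal Z y (grad g y /\<^sub>R norm (grad g y))"
proof -
  have dg: "g differentiable (at x)" if "x \<in> U" for x using g(1) that by simp
  then have "continuous_on U g"
    by (intro continuous_at_imp_continuous_on ballI differentiable_imp_continuous_within)
  then show ?thesis
    using y dg by (intro unit_normal_grad[OF Z _ U _ _ g(2)] has_derivative_grad) auto
qed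

lemma Ck_on_Suc_imp: "Ck_on (Suc k) U f \<Longrightarrow> Ck_on k U f"
proof (induction k arbitrary: f)
  case 0
  then show ?case
    by (auto intro!: continuous_at_imp_continuous_on differentiable_imp_continuous_within)
next
  case (Suc k)
  then show ?case by (metis Ck_on.simps(2))
qed

lemma Ck_on_imp_continuous_on: "Ck_on k U f \<Longrightarrow> continuous_on U f"
proof (induction k)
  case (Suc k)
  then show ?case using Ck_on_Suc_imp by blast
qed simp

lemma continuous_on_grad:
  assumes "Ck_on (Suc k) U g"
  shows "continuous_on U (grad g)"
  unfolding grad_def[abs_def]
  using assms by (intro continuous_on_vec_lambda) (auto intro: Ck_on_imp_continuous_on)

lemma has_derivative_vec_lambda:
  fixes f :: "'a::real_normed_vector \<Rightarrow> real^'n"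
  assumes "\<And>i. ((\<lambda>x. f x $ i) has_derivative (\<lambda>h. f' h $ i)) (at x)"
  shows "(f has_derivative f') (at x)"
  unfolding has_derivative_componentwise_within[of f]
  using assms by (auto simp: Basis_vec_def inner_axis)

lemma grad_has_blinfun_derivative:
  assumes g: "Ck_on 2 U g"
  shows "\<exists>F'. continuous_on U F' \<and> (\<forall>y\<in>U. (grad g has_derivative blinfun_apply (F' y)) (at y))"
proof -
  have g1: "Ck_on 1 U (partial_deriv i g)" for i using g by (simp add: numeral_2_eq_2)
  define F where "F y h = (\<chi> i. grad (partial_deriv i g) y \<bullet> h)" for y h
  have bl: "bounded_linear (F y)" for y
    unfolding F_def by (rule linear_conv_bounded_linear[THEN iffD1], rule linearI)
      (simp_all add: vec_eq_iff inner_add_right)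
  have "continuous_on U (\<lambda>y. Blinfun (F y))"
  proof (rule continuous_on_blinfun_componentwise)
    fix b :: "real^'a"
    show "continuous_on U (\<lambda>y. Blinfun (F y) b)"
      unfolding bounded_linear_Blinfun_apply[OF bl] F_def
      using g1 by (intro continuous_intros continuous_on_grad[of 0]) simp
  qed
  moreover have "(grad g has_derivative blinfun_apply (Blinfun (F y))) (at y)" if "y \<in> U" for y
    unfolding bounded_linear_Blinfun_apply[OF bl]
  proof (rule has_derivative_vec_lambda)
    fix i
    have "partial_deriv i g differentiable (at y)" using g1[of i] that by simp
    from has_derivative_grad[OF this]
    show "((\<lambda>x. grad g x $ i) has_derivative (\<lambda>h. F y h $ i)) (at y)"
      by (simp add: grad_def F_def)
  qed
  ultimately show ?thesis by blast
qed

lemma normalized_has_blinfun_derivative: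
  fixes F :: "'a::euclidean_space \<Rightarrow> 'a" and F' :: "'a \<Rightarrow> 'a \<Rightarrow>\<^sub>L 'a"
  assumes F: "\<And>y. y \<in> U \<Longrightarrow> (F has_derivative blinfun_apply (F' y)) (at y)"
    and contF': "continuous_on U F'" and nz: "\<And>y. y \<in> U \<Longrightarrow> F y \<noteq> 0"
  shows "\<exists>G'. continuous_on U G' \<and>
    (\<forall>y\<in>U. ((\<lambda>y. F y /\<^sub>R norm (F y)) has_derivative blinfun_apply (G' y)) (at y))"
proof -
  define G' where "G' y = inverse (norm (F y)) *\<^sub>R F' y
    - (inverse (norm (F y)) ^ 3) *\<^sub>R (blinfun_scaleR_left (F y) o\<^sub>L (blinfun_inner_left (F y) o\<^sub>L F' y))" for y
  have contF: "continuous_on U F"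
    using F by (intro continuous_at_imp_continuous_on ballI has_derivative_continuous)
  have "continuous_on U G'"
    unfolding G'_def
    by (intro continuous_intros contF contF' bounded_linear.continuous_on[OF bounded_linear_blinfun_scaleR_left]
        bounded_linear.continuous_on[OF bounded_linear_blinfun_inner_left]
        bounded_bilinear.continuous_on[OF bounded_bilinear_blinfun_compose]) (use nz in auto)
  moreover have "((\<lambda>y. F y /\<^sub>R norm (F y)) has_derivative blinfun_apply (G' y)) (at y)" if y: "y \<in> U" for y
  proof -
    define n where "n = norm (F y)"
    have n: "n > 0" using nz[OF y] by (simp add: n_def)
    have "((\<lambda>y. norm (F y)) has_derivative (\<lambda>h. sgn (F y) \<bullet> F' y h)) (at y)"
      using has_derivative_compose[OF F[OF y] has_derivative_norm[OF nz[OF y]]] by (simp add: inner_commute)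
    then have "((\<lambda>y. inverse (norm (F y))) has_derivative
        (\<lambda>h. - (inverse n * (sgn (F y) \<bullet> F' y h) * inverse n))) (at y)"
      unfolding n_def by (intro Deriv.has_derivative_inverse) (use nz[OF y] in simp_all)
    from has_derivative_scaleR[OF this F[OF y]]
    have "((\<lambda>y. F y /\<^sub>R norm (F y)) has_derivative (\<lambda>h. inverse n *\<^sub>R F' y h
        + (- (inverse n * (sgn (F y) \<bullet> F' y h) * inverse n)) *\<^sub>R F y)) (at y)"
      by (simp add: n_def)
    moreover have "inverse n *\<^sub>R F' y h + (- (inverse n * (sgn (F y) \<bullet> F' y h) * inverse n)) *\<^sub>R F y = G' y h" for h
      by (simp add: G'_def n_def[symmetric] sgn_div_norm blinfun.bilinear_simps inner_commute power3_eq_cube mult_ac)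
    ultimately show ?thesis by simp
  qed
  ultimately show ?thesis by blast
qed

lemma hypersurfaceE:
  assumes "hypersurface k Z" "z \<in> Z"
  obtains U g where "open U" "z \<in> U" "Ck_on k U g" "Z \<inter> U = {x \<in> U. g x = 0}"
    "\<And>x. x \<in> U \<Longrightarrow> grad g x \<noteq> 0"
proof -
  from assms have "\<exists>U g. open U \<and> z \<in> U \<and> Ck_on k U g \<and> Z \<inter> U = {x \<in> U. g x = 0} \<and>
      (\<forall>x\<in>U. grad g x \<noteq> 0)"
    unfolding hypersurface_def by (rule bspec)
  then show thesis by (elim exE conjE) (rule that, assumption+, erule (1) bspec)
qed

text \<open>The construction does not depend on the class of \<open>Z\<close>, so a single
  \<open>f\<close> serves both parts and the C^2 conclusion is stated conditionally.\<close>

lemma defining_function: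
  fixes Z :: "(real^'n) set"
  assumes Z: "compact Z" "Z \<noteq> {}" and hyp: "hypersurface 1 Z" and \<rho>: "\<rho> > 0"
    and uniq: "\<And>x. infdist x Z < \<rho> \<Longrightarrow> \<exists>!z. z \<in> Z \<and> infdist x Z = dist x z"
  shows "\<exists>f. Ck_on 1 UNIV f \<and> {x. f x = 0} = Z \<and> (\<forall>x. \<rho> \<le> infdist x Z \<longrightarrow> \<bar>f x\<bar> = 1) \<and>
    (\<forall>x. (3/4)\<^sup>2 \<le> (f x)\<^sup>2 + (norm (grad f x))\<^sup>2) \<and>
    (\<forall>x. (\<Sum>js | length js \<le> 1. (iterated_partial js f x)\<^sup>2) \<le> (3/2 * (1 + 1 / \<rho>))\<^sup>2) \<and>
    (hypersurface 2 Z \<longrightarrow> Ck_on 2 UNIV f \<and>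
      (\<forall>x. (\<Sum>js | length js \<le> 2. (iterated_partial js f x)\<^sup>2)
        \<le> (3/2 * (1 + 1 / \<rho> + 5 * CARD('n) / \<rho>\<^sup>2))\<^sup>2))"
proof -
  have clZ: "closed Z" using Z by (simp add: compact_imp_closed)
  have "\<exists>U G. open U \<and> z \<in> U \<and> continuous_on U G \<and> (\<forall>y\<in>Z \<inter> U. unit_normal Z y (G y))"
    if z: "z \<in> Z" for z
  proof -
    obtain U g where U: "open U" "z \<in> U" and g: "Ck_on 1 U g" "Z \<inter> U = {x \<in> U. g x = 0}"
      and nz: "\<And>x. x \<in> U \<Longrightarrow> grad g x \<noteq> 0"
      by (rule hypersurfaceE[OF hyp z]) blast
    have "continuous_on U (grad g)" using g(1) continuous_on_grad[of 0 U g] by simp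
    then have "continuous_on U (\<lambda>y. grad g y /\<^sub>R norm (grad g y))"
      using nz by (intro continuous_intros) auto
    moreover have "unit_normal Z y (grad g y /\<^sub>R norm (grad g y))" if "y \<in> Z \<inter> U" for y
      using unit_normal_hypersurface[OF clZ U(1) _ g(2) that, of 0] g(1) nz that by simp
    ultimately show ?thesis using U by blast
  qed
  from signed_distance[OF Z \<rho> uniq this] obtain s N where eik: "eikonal s N \<rho>"
    and s_abs: "\<And>x. \<bar>s x\<bar> = infdist x Z" and N: "\<And>z. z \<in> Z \<Longrightarrow> unit_normal Z z (N z)"
    by blast
  define r where "r = 15/16 * min \<rho> 2"
  have r: "0 < r" "r < \<rho>" using \<rho> by (auto simp: r_def min_def)
  interpret cutoff s N \<rho> r using eik r by (simp add: cutoff_def cutoff_axioms_def)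
  have s0: "s x = 0 \<longleftrightarrow> x \<in> Z" for x
    unfolding in_closed_iff_infdist_zero[OF clZ Z(2), of x] s_abs[of x, symmetric] by simp
  have card: "CARD('n) \<ge> 1" by (simp add: Suc_le_eq)
  have est: "(3/4)\<^sup>2 \<le> (f0 x)\<^sup>2 + (f1 x)\<^sup>2"
    "(f0 x)\<^sup>2 + (f1 x)\<^sup>2 \<le> (3/2 * (1 + 1 / \<rho>))\<^sup>2"
    "(f0 x)\<^sup>2 + (f1 x)\<^sup>2 + ((f2 x)\<^sup>2 + CARD('n) * (f1 x / (\<rho> - \<bar>s x\<bar>))\<^sup>2)
      \<le> (3/2 * (1 + 1 / \<rho> + 5 * CARD('n) / \<rho>\<^sup>2))\<^sup>2" for x
    unfolding f0_def f1_def f2_def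
    by (rule profile_estimates[OF \<rho> card, of "s x", folded r_def])+
  have norm_grad: "(norm (grad f0 x))\<^sup>2 = (f1 x)\<^sup>2" for x
  proof (cases "\<bar>s x\<bar> < \<rho>")
    case True then show ?thesis using unit[OF True] by (simp add: grad_f0)
  next
    case False then show ?thesis using outside(1)[of x] r by (simp add: grad_f0)
  qed
  have zero: "{x. f0 x = 0} = Z" using s0 r by (auto simp: f0_def profile_eq_0_iff)
  have C2: "Ck_on 2 UNIV f0 \<and> (\<forall>x. (\<Sum>js | length js \<le> 2. (iterated_partial js f0 x)\<^sup>2)
        \<le> (3/2 * (1 + 1 / \<rho> + 5 * CARD('n) / \<rho>\<^sup>2))\<^sup>2)" if hyp2: "hypersurface 2 Z"
  proof -
    interpret eikonal_C2 s N \<rho>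
    proof
      show "\<exists>z. s z = 0 \<and> dist x z = \<bar>s x\<bar>" for x
        using infdist_attains_inf[OF clZ Z(2), of x] by (metis s0 s_abs)
      fix z assume "s z = 0"
      then have "z \<in> Z" by (simp add: s0)
      then obtain U g where U: "open U" "z \<in> U" and g: "Ck_on 2 U g" "Z \<inter> U = {x \<in> U. g x = 0}"
        and nz: "\<And>x. x \<in> U \<Longrightarrow> grad g x \<noteq> 0"
        by (rule hypersurfaceE[OF hyp2]) blast
      obtain F' where "continuous_on U F'" "\<And>y. y \<in> U \<Longrightarrow> (grad g has_derivative blinfun_apply (F' y)) (at y)"
        using grad_has_blinfun_derivative[OF g(1)] by blast
      then obtain G' where G': "continuous_on U G'"
        "\<And>y. y \<in> U \<Longrightarrow> ((\<lambda>y. grad g y /\<^sub>R norm (grad g y)) has_derivative blinfun_apply (G' y)) (at y)"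
        using normalized_has_blinfun_derivative[of U "grad g" F'] nz by blast
      have "N y = grad g y /\<^sub>R norm (grad g y) \<or> N y = - (grad g y /\<^sub>R norm (grad g y))"
        if y: "y \<in> U" "s y = 0" for y
      proof (rule unit_normal_unique)
        show "unit_normal Z y (grad g y /\<^sub>R norm (grad g y))"
          using g(1) y s0 nz by (intro unit_normal_hypersurface[OF clZ U(1) _ g(2), of 1]) (auto simp: numeral_2_eq_2)
        show "unit_normal Z y (N y)" using y s0 N by blast
      qed
      then show "\<exists>U G G'. open U \<and> z \<in> U \<and> (\<forall>y\<in>U. (G has_derivative blinfun_apply (G' y)) (at y)) \<and>
          continuous_on U G' \<and> (\<forall>y\<in>U. s y = 0 \<longrightarrow> N y = G y \<or> N y = - G y)"
        using U G' by (intro exI[of _ U] exI[of _ "\<lambda>y. grad g y /\<^sub>R norm (grad g y)"] exI[of _ G']) auto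
    qed
    note A = N_has_derivative isCont_J
    show ?thesis
    proof (intro conjI allI Ck_2[OF A])
      fix x
      have "(\<Sum>js | length js \<le> 2. (iterated_partial js f0 x)\<^sup>2)
          \<le> (f0 x)\<^sup>2 + (f1 x)\<^sup>2 + ((f2 x)\<^sup>2 + CARD('n) * (f1 x / (\<rho> - \<bar>s x\<bar>))\<^sup>2)"
        using hessian_le[OF A, of x] by (simp add: sum_iterated_partial_2 norm_grad)
      then show "(\<Sum>js | length js \<le> 2. (iterated_partial js f0 x)\<^sup>2)
          \<le> (3/2 * (1 + 1 / \<rho> + 5 * CARD('n) / \<rho>\<^sup>2))\<^sup>2"
        using est(3)[of x] by linarith
    qed
  qed
  show ?thesis
  proof (intro exI[of _ f0] conjI allI impI)
    show "\<bar>f0 x\<bar> = 1" if "\<rho> \<le> infdist x Z" for x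
      using that r s_abs[of x] by (intro outside) simp
    show "(3/4)\<^sup>2 \<le> (f0 x)\<^sup>2 + (norm (grad f0 x))\<^sup>2" for x
      using est(1)[of x] norm_grad[of x] by simp
    show "(\<Sum>js | length js \<le> 1. (iterated_partial js f0 x)\<^sup>2) \<le> (3/2 * (1 + 1 / \<rho>))\<^sup>2" for x
      unfolding sum_iterated_partial_1 norm_grad by (rule est(2))
  qed (use Ck_1 zero C2 in auto)
qed

section \<open>The reach and the passage from extended to real values\<close>

lemma reach_unique_nearest:
  assumes "Z \<noteq> {}" "ennreal (infdist x Z) < reach Z"
  shows "\<exists>!z. z \<in> Z \<and> infdist x Z = dist x z"
proof -
  obtain t where "ennreal (infdist x Z) < ennreal t"
    and t: "\<And>x. dist_to x Z < ennreal t \<Longrightarrow> \<exists>!z. z \<in> Z \<and> dist_to x Z = ennreal (dist x z)"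
    using assms(2) unfolding reach_def less_Sup_iff by blast
  then have "\<exists>!z. z \<in> Z \<and> ennreal (infdist x Z) = ennreal (dist x z)"
    using t[of x] by (simp add: dist_to_eq_infdist[OF assms(1)])
  then show ?thesis by (simp add: infdist_nonneg)
qed

text \<open>All distances to the empty set are infinite, so the uniqueness condition holds vacuously
  for every \<open>t\<close>.\<close>

lemma reach_empty: "reach ({} :: (real^'n) set) = \<infinity>"
proof -
  have le: "ennreal t \<le> reach ({} :: (real^'n) set)" if "t > 0" for t
    unfolding reach_def using that by (intro Sup_upper) (auto simp: dist_to_def)
  have "ennreal (real n) \<le> reach ({} :: (real^'n) set)" for n :: nat
    using le[of "real n"] by (cases "n = 0") auto
  then show ?thesis
    using ennreal_of_nat_eq_real_of_nat ennreal_Ex_less_of_nat[of "reach ({} :: (real^'n) set)"]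
    by (metis infinity_ennreal_def less_top not_less)
qed

theorem theorem5:
  fixes Z :: "(real^'n) set"
  assumes "compact Z" and "hypersurface 1 Z" and "reach Z > 0"
  shows
    "(\<exists>f. Ck_on 1 UNIV f \<and> {x. f x = 0} = Z \<and>
        (\<forall>c r. r > 0 \<and> Z \<subseteq> cball c r \<and> dist_sets Z (sphere c r) > reach Z \<longrightarrow>
           cond_num 1 f c r \<le> 2 * (1 + 1 / reach Z))) \<and>
     (hypersurface 2 Z \<longrightarrow>
       (\<exists>f. Ck_on 2 UNIV f \<and> {x. f x = 0} = Z \<and>
          (\<forall>c r. r > 0 \<and> Z \<subseteq> cball c r \<and> dist_sets Z (sphere c r) > reach Z \<longrightarrow>
             cond_num 1 f c r \<le> 2 * (1 + 1 / reach Z) \<and>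
             cond_num 2 f c r \<le> 2 * (1 + 1 / reach Z + 5 * of_nat CARD('n) / (reach Z)\<^sup>2))))"
proof (cases "Z = {}")
  case True
  have "partial_deriv i (\<lambda>_. c) = (\<lambda>_. 0)" for i :: 'n and c
    by (simp add: partial_deriv_def fun_eq_iff)
  then have "Ck_on 1 UNIV (\<lambda>_::real^'n. 1)" "Ck_on 2 UNIV (\<lambda>_::real^'n. 1)"
    by (simp_all add: numeral_2_eq_2)
  moreover have "{x :: real^'n. (1::real) = 0} = Z" using True by simp
  \<comment> \<open>No distance exceeds an infinite reach, so no disk is subject to the
    estimates.\<close>
  ultimately show ?thesis using True reach_empty[where 'n = 'n]
    by (intro conjI impI; intro exI[of _ "\<lambda>_. 1"]) auto
next
  case False
  \<comment> \<open>An infinite reach occurs also for nonempty \<open>Z\<close>, such as a point on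
    the line. No disk then satisfies the distance condition, and the value 1 is an arbitrary radius
    with unique nearest points.\<close>
  define \<rho> where "\<rho> = (if reach Z = \<infinity> then 1 else enn2real (reach Z))"
  have \<rho>: "\<rho> > 0" "ennreal \<rho> \<le> reach Z"
    using assms(3) by (auto simp: \<rho>_def enn2real_positive_iff less_top)
  have \<rho>_eq: "reach Z = ennreal \<rho>" if "reach Z < a" for a
    using less_le_trans[OF that top_greatest] by (auto simp: \<rho>_def)
  obtain f where f: "Ck_on 1 UNIV f" "{x. f x = 0} = Z" "\<And>x. \<rho> \<le> infdist x Z \<Longrightarrow> \<bar>f x\<bar> = 1"
    "\<And>x. (3/4)\<^sup>2 \<le> (f x)\<^sup>2 + (norm (grad f x))\<^sup>2"
    "\<And>x. (\<Sum>js | length js \<le> 1. (iterated_partial js f x)\<^sup>2) \<le> (3/2 * (1 + 1 / \<rho>))\<^sup>2"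
    and f2: "hypersurface 2 Z \<Longrightarrow> Ck_on 2 UNIV f"
    "\<And>x. hypersurface 2 Z \<Longrightarrow> (\<Sum>js | length js \<le> 2. (iterated_partial js f x)\<^sup>2)
        \<le> (3/2 * (1 + 1 / \<rho> + 5 * CARD('n) / \<rho>\<^sup>2))\<^sup>2"
  proof -
    have "\<exists>!z. z \<in> Z \<and> infdist x Z = dist x z" if "infdist x Z < \<rho>" for x
    proof (rule reach_unique_nearest[OF False])
      have "ennreal (infdist x Z) < ennreal \<rho>" using that by (simp add: ennreal_lessI \<rho>(1))
      then show "ennreal (infdist x Z) < reach Z" using \<rho>(2) by simp
    qed
    from defining_function[OF assms(1) False assms(2) \<rho>(1) this] show thesis using that by blast
  qed
  have sphere: "\<bar>f x\<bar> = 1" if D: "dist_sets Z (sphere c r) > reach Z" and x: "x \<in> sphere c r" for c r x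
  proof (rule f(3))
    obtain z where z: "z \<in> Z" "infdist x Z = dist x z"
      using infdist_attains_inf[OF compact_imp_closed[OF assms(1)] False] by blast
    have "dist_sets Z (sphere c r) \<le> ennreal (dist z x)"
      unfolding dist_sets_def dist_to_def using z(1) x by (intro INF_lower2[of z] INF_lower2[of x]) auto
    then have "ennreal \<rho> < ennreal (dist z x)" using D \<rho>_eq[OF D] by simp
    then show "\<rho> \<le> infdist x Z" using \<rho>(1) z(2) by (simp add: ennreal_less_iff dist_commute)
  qed
  have inv: "ennreal (1 / \<rho>) = 1 / ennreal \<rho>" using divide_ennreal[of 1 \<rho>] \<rho>(1) by simp
  have inv2: "ennreal (5 * CARD('n) / \<rho>\<^sup>2) = 5 * of_nat CARD('n) / (ennreal \<rho>)\<^sup>2"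
  proof -
    have "ennreal (5 * CARD('n) / \<rho>\<^sup>2) = ennreal (5 * CARD('n)) / ennreal (\<rho>\<^sup>2)"
      using \<rho>(1) by (intro divide_ennreal[symmetric]) auto
    also have "ennreal (5 * CARD('n)) = ennreal 5 * ennreal CARD('n)"
      by (simp add: ennreal_mult del: ennreal_numeral)
    also have "ennreal (\<rho>\<^sup>2) = (ennreal \<rho>)\<^sup>2" using \<rho>(1) by (simp add: ennreal_power)
    finally show ?thesis by (simp add: ennreal_of_nat_eq_real_of_nat)
  qed
  have bound1: "ennreal (2 * (1 + 1 / \<rho>)) = 2 * (1 + 1 / ennreal \<rho>)"
  proof -
    have "ennreal (2 * (1 + 1 / \<rho>)) = ennreal 2 * ennreal (1 + 1 / \<rho>)"
      using \<rho>(1) by (intro ennreal_mult) auto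
    also have "ennreal (1 + 1 / \<rho>) = ennreal 1 + ennreal (1 / \<rho>)"
      using \<rho>(1) by (intro ennreal_plus) auto
    finally show ?thesis unfolding inv by simp
  qed
  have bound2: "ennreal (2 * (1 + 1 / \<rho> + 5 * CARD('n) / \<rho>\<^sup>2))
      = 2 * (1 + 1 / ennreal \<rho> + 5 * of_nat CARD('n) / (ennreal \<rho>)\<^sup>2)"
  proof -
    have "ennreal (2 * (1 + 1 / \<rho> + 5 * CARD('n) / \<rho>\<^sup>2))
        = ennreal 2 * ennreal (1 + 1 / \<rho> + 5 * CARD('n) / \<rho>\<^sup>2)"
      using \<rho>(1) by (intro ennreal_mult add_nonneg_nonneg) auto
    also have "ennreal (1 + 1 / \<rho> + 5 * CARD('n) / \<rho>\<^sup>2)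
        = ennreal 1 + ennreal (1 / \<rho>) + ennreal (5 * CARD('n) / \<rho>\<^sup>2)"
      using \<rho>(1) by (subst ennreal_plus, simp, simp, subst ennreal_plus) auto
    finally show ?thesis unfolding inv inv2 by simp
  qed
  have k1: "cond_num 1 f c r \<le> 2 * (1 + 1 / reach Z)" if D: "dist_sets Z (sphere c r) > reach Z" for c r
    unfolding \<rho>_eq[OF D] bound1[symmetric] using f(4,5) sphere[OF D] \<rho> by (intro cond_num_le) auto
  have k2: "cond_num 2 f c r \<le> 2 * (1 + 1 / reach Z + 5 * of_nat CARD('n) / (reach Z)\<^sup>2)"
    if "hypersurface 2 Z" and D: "dist_sets Z (sphere c r) > reach Z" for c r
    unfolding \<rho>_eq[OF D] bound2[symmetric] using f(4) f2(2)[OF that(1)] sphere[OF D] \<rho>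
    by (intro cond_num_le) auto
  show ?thesis using f(1,2) f2(1) k1 k2 by blast
qed

end
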